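(* Let $p\in\mathbb{N}$ and let $\boldsymbol{\mu}=(\mu^{i,j})_{i,j=1,\dots,p}$ be a $p\times p$ matrix of locally finite measures on $[0,\infty)$ which is non-lattice. Let $\vartheta\in\mathbb{R}$ lie in the interior of $\mathcal{D}(\mathcal{L}\boldsymbol{\mu})$, suppose that the spectral radius of the matrix $\boldsymbol{\mu}(0)=(\mu^{i,j}(\{0\}))_{i,j}$ is strictly smaller than $1$, and suppose that $$\sup_{\eta\in\mathbb{R}}\big\|(\mathbf{I}_p-\mathcal{L}\boldsymbol{\mu}(\vartheta+\mathrm{i}\eta))^{-1}\big\|<\infty$$ (in particular, all these inverses exist). Suppose further that $\Lambda_\vartheta$ is finite. Then there exist matrices $C_{\lambda,k}\in\mathbb{C}^{p\times p}$, $k=0,\dots,\mathtt{k}(\lambda)-1$, $\lambda\in\Lambda_\vartheta$, and a matrix $C_{0,\mathtt{k}(0)}\in\mathbb{C}^{p\times p}$ such that $$\boldsymbol{U}(t)=\sum_{\lambda\in\Lambda_\vartheta}e^{\lambda t}\sum_{k=0}^{\mathtt{k}(\lambda)-1}t^k C_{\lambda,k}+t^{\mathtt{k}(0)}C_{0,\mathtt{k}(0)}+O(te^{\vartheta t})\quad\text{as }t\to\infty,$$ where the error bound applies entry by entry.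
   Context: $\mathbf{I}_p$ is the $p\times p$ identity matrix; $\|\cdot\|$ is a matrix norm on $\mathbb{C}^{p\times p}$. $\mathcal{L}\boldsymbol{\mu}(z)=(\mathcal{L}\mu^{i,j}(z))_{i,j}$ with $\mathcal{L}\mu^{i,j}(z)=\int_{[0,\infty)} e^{-zx}\,\mu^{i,j}(\mathrm{d}x)$, and $$\mathcal{D}(\mathcal{L}\boldsymbol{\mu})=\Big\{z\in\mathbb{C}:\int e^{-\mathrm{Re}(z)x}\,\mu^{i,j}(\mathrm{d}x)<\infty\text{ for all }i,j\Big\}.$$ Non-lattice: for all $h>0$ and all $h_1,\dots,h_p\in[0,h)$ there exist $i,j$ with $\mu^{i,j}\big((h_j-h_i+h\mathbb{Z})^{\mathsf{c}}\big)>0$. Roots: $\Lambda=\{\lambda\in\mathcal{D}(\mathcal{L}\boldsymbol{\mu}):\det(\mathbf{I}_p-\mathcal{L}\boldsymbol{\mu}(\lambda))=0\}$ and, for $\theta\in\mathbb{R}$, $\Lambda_\theta=\{\lambda\in\Lambda:\mathrm{Re}(\lambda)>\theta\}$. For $\lambda\in\Lambda$, $\mathtt{k}(\lambda)\in\mathbb{N}=\{1,2,\dots\}$ is the maximal order of the poles of the entries of $(\mathbf{I}_p-\mathcal{L}\boldsymbol{\mu}(z))^{-1}$ at $z=\lambda$, i.e. the smallest natural number such that all entries of $(z-\lambda)^{\mathtt{k}(\lambda)}(\mathbf{I}_p-\mathcal{L}\boldsymbol{\mu}(z))^{-1}$ are holomorphic in some neighborhood of $\lambda$. For $z\notin\Lambda$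 set $\mathtt{k}(z)=0$. Renewal measure: $\boldsymbol{U}=\sum_{n=0}^\infty\boldsymbol{\mu}^{*n}$, where $\boldsymbol{\mu}^{*n}$ is the $n$-fold matrix convolution power ($(\boldsymbol{\mu}*\boldsymbol{\nu})^{i,j}=\sum_k\mu^{i,k}*\nu^{k,j}$, and $\boldsymbol{\mu}^{*0}=\mathbf{I}_p\delta_0$), and $\boldsymbol{U}(t)=\boldsymbol{U}([0,t])$, which is finite for all $t\ge0$. *)

theory Defs
  imports "HOL-Probability.Probability" "HOL-Complex_Analysis.Complex_Analysis"
    "HOL-Library.Landau_Symbols"
begin

text \<open>
  A locally finite measure on \<open>[0,\<infinity>)\<close> is encoded as a Borel measure on the real line which
  does not charge the negative half-line. A \<open>p \<times> p\<close> matrix of such measures is a function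
  \<open>'p \<Rightarrow> 'p \<Rightarrow> real measure\<close>.
\<close>

definition locally_finite_measure :: "real measure \<Rightarrow> bool" where
  "locally_finite_measure M \<longleftrightarrow>
     sets M = sets borel \<and> emeasure M {..<0} = 0 \<and> (\<forall>t. emeasure M {0..t} < \<infinity>)"

definition non_lattice :: "('p \<Rightarrow> 'p \<Rightarrow> real measure) \<Rightarrow> bool" where
  "non_lattice \<mu> \<longleftrightarrow>
     (\<forall>h>0. \<forall>s. (\<forall>i. 0 \<le> s i \<and> s i < h) \<longrightarrow>
        (\<exists>i j. emeasure (\<mu> i j) ({0..} - range (\<lambda>m::int. s j - s i + h * of_int m)) > 0))"

definition laplace_mat :: "('p::finite \<Rightarrow> 'p \<Rightarrow> real measure) \<Rightarrow> complex \<Rightarrow> complex^'p^'p" where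
  "laplace_mat \<mu> z = (\<chi> i j. LINT x:{0..}|\<mu> i j. exp (- z * complex_of_real x))"

definition laplace_dom :: "('p \<Rightarrow> 'p \<Rightarrow> real measure) \<Rightarrow> complex set" where
  "laplace_dom \<mu> =
     {z. \<forall>i j. (\<integral>\<^sup>+x\<in>{0..}. ennreal (exp (- Re z * x)) \<partial>\<mu> i j) < \<infinity>}"

definition atom_zero_mat :: "('p::finite \<Rightarrow> 'p \<Rightarrow> real measure) \<Rightarrow> complex^'p^'p" where
  "atom_zero_mat \<mu> = (\<chi> i j. complex_of_real (measure (\<mu> i j) {0}))"

definition spectral_radius :: "complex^'p::finite^'p \<Rightarrow> real" where
  "spectral_radius A = Sup {cmod c | c. \<exists>v. v \<noteq> 0 \<and> A *v v = c *s v}"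

definition roots :: "('p::finite \<Rightarrow> 'p \<Rightarrow> real measure) \<Rightarrow> complex set" where
  "roots \<mu> = {z \<in> laplace_dom \<mu>. det (mat 1 - laplace_mat \<mu> z) = 0}"

definition roots_above :: "('p::finite \<Rightarrow> 'p \<Rightarrow> real measure) \<Rightarrow> real \<Rightarrow> complex set" where
  "roots_above \<mu> \<theta> = {z \<in> roots \<mu>. Re z > \<theta>}"

text \<open>
  The inverse does not exist at a root \<open>\<rho>\<close> itself, so holomorphy of
  \<open>(z - \<rho>)\<^sup>k (I - L\<mu>(z))\<^sup>-\<^sup>1\<close> near \<open>\<rho>\<close> is understood after removing the singularity: \<open>G\<close> is the
  holomorphic extension of this function from a punctured neighbourhood on which the inverse exists.
\<close>

definition pole_order :: "('p::finite \<Rightarrow> 'p \<Rightarrow> real measure) \<Rightarrow> complex \<Rightarrow> nat" where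
  "pole_order \<mu> \<rho> =
     (if \<rho> \<in> roots \<mu> then
        (LEAST k. 1 \<le> k \<and>
           (\<exists>S (G :: complex \<Rightarrow> complex^'p^'p).
              open S \<and> \<rho> \<in> S \<and> S - {\<rho>} \<subseteq> laplace_dom \<mu> - roots \<mu> \<and>
              (\<forall>i j. (\<lambda>z. G z $ i $ j) holomorphic_on S) \<and>
              (\<forall>z\<in>S - {\<rho>}. \<forall>i j.
                 G z $ i $ j = (z - \<rho>) ^ k * matrix_inv (mat 1 - laplace_mat \<mu> z) $ i $ j)))
      else 0)"

definition mat_convolution ::
  "('p::finite \<Rightarrow> 'p \<Rightarrow> real measure) \<Rightarrow> ('p \<Rightarrow> 'p \<Rightarrow> real measure) \<Rightarrow> 'p \<Rightarrow> 'p \<Rightarrow> real measure" where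
  "mat_convolution \<mu> \<nu> i j =
     measure_of UNIV (sets borel) (\<lambda>A. \<Sum>k\<in>UNIV. emeasure (\<mu> i k \<star> \<nu> k j) A)"

primrec conv_power :: "('p::finite \<Rightarrow> 'p \<Rightarrow> real measure) \<Rightarrow> nat \<Rightarrow> 'p \<Rightarrow> 'p \<Rightarrow> real measure" where
  "conv_power \<mu> 0 = (\<lambda>i j. if i = j then return borel 0 else null_measure borel)"
| "conv_power \<mu> (Suc n) = mat_convolution \<mu> (conv_power \<mu> n)"

definition renewal_measure :: "('p::finite \<Rightarrow> 'p \<Rightarrow> real measure) \<Rightarrow> 'p \<Rightarrow> 'p \<Rightarrow> real measure" where
  "renewal_measure \<mu> i j =
     measure_of UNIV (sets borel) (\<lambda>A. \<Sum>n. emeasure (conv_power \<mu> n i j) A)"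

definition renewal_fun :: "('p::finite \<Rightarrow> 'p \<Rightarrow> real measure) \<Rightarrow> real \<Rightarrow> real^'p^'p" where
  "renewal_fun \<mu> t = (\<chi> i j. measure (renewal_measure \<mu> i j) {0..t})"

text \<open>
  The set functions passed to \<^const>\<open>measure_of\<close> above are measures, so the entries take the
  intended values.
\<close>

lemma sets_mat_convolution [simp, measurable_cong]: "sets (mat_convolution \<mu> \<nu> i j) = sets borel"
  unfolding mat_convolution_def
  using sets.sets_measure_of_eq[of borel] by simp

lemma sets_conv_power [simp, measurable_cong]: "sets (conv_power \<mu> n i j) = sets borel"
  by (cases n) auto

lemma sets_renewal_measure [simp, measurable_cong]: "sets (renewal_measure \<mu> i j) = sets borel"
  unfolding renewal_measure_def
  using sets.sets_measure_of_eq[of borel] by simp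

lemma emeasure_mat_convolution:
  assumes "A \<in> sets borel"
  shows "emeasure (mat_convolution \<mu> \<nu> i j) A = (\<Sum>k\<in>UNIV. emeasure (\<mu> i k \<star> \<nu> k j) A)"
proof (rule emeasure_measure_of[OF mat_convolution_def])
  show "countably_additive (sets (mat_convolution \<mu> \<nu> i j))
          (\<lambda>A. \<Sum>k\<in>UNIV. emeasure (\<mu> i k \<star> \<nu> k j) A)"
  proof (rule countably_additiveI)
    fix B :: "nat \<Rightarrow> real set"
    assume B: "range B \<subseteq> sets (mat_convolution \<mu> \<nu> i j)" "disjoint_family B"
    have "(\<Sum>n. \<Sum>k\<in>UNIV. emeasure (\<mu> i k \<star> \<nu> k j) (B n))
        = (\<Sum>k\<in>UNIV. \<Sum>n. emeasure (\<mu> i k \<star> \<nu> k j) (B n))"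
      by (rule suminf_sum) simp
    also have "\<dots> = (\<Sum>k\<in>UNIV. emeasure (\<mu> i k \<star> \<nu> k j) (\<Union>n. B n))"
      using B by (intro sum.cong refl suminf_emeasure) auto
    finally show "(\<Sum>n. \<Sum>k\<in>UNIV. emeasure (\<mu> i k \<star> \<nu> k j) (B n))
        = (\<Sum>k\<in>UNIV. emeasure (\<mu> i k \<star> \<nu> k j) (\<Union>n. B n))" .
  qed
qed (use assms in \<open>auto simp: positive_def\<close>)

lemma emeasure_renewal_measure:
  assumes "A \<in> sets borel"
  shows "emeasure (renewal_measure \<mu> i j) A = (\<Sum>n. emeasure (conv_power \<mu> n i j) A)"
proof (rule emeasure_measure_of[OF renewal_measure_def])
  show "countably_additive (sets (renewal_measure \<mu> i j))
          (\<lambda>A. \<Sum>n. emeasure (conv_power \<mu> n i j) A)"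
  proof (rule countably_additiveI)
    fix B :: "nat \<Rightarrow> real set"
    assume B: "range B \<subseteq> sets (renewal_measure \<mu> i j)" "disjoint_family B"
    have "(\<Sum>m. \<Sum>n. emeasure (conv_power \<mu> n i j) (B m))
        = (\<Sum>n. \<Sum>m. emeasure (conv_power \<mu> n i j) (B m))"
      unfolding nn_integral_count_space_nat[symmetric]
      by (rule pair_sigma_finite.Fubini') (auto simp: pair_sigma_finite_def sigma_finite_measure_count_space)
    also have "\<dots> = (\<Sum>n. emeasure (conv_power \<mu> n i j) (\<Union>m. B m))"
      using B by (intro suminf_cong suminf_emeasure) auto
    finally show "(\<Sum>m. \<Sum>n. emeasure (conv_power \<mu> n i j) (B m))
        = (\<Sum>n. emeasure (conv_power \<mu> n i j) (\<Union>m. B m))" .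
  qed
qed (use assms in \<open>auto simp: positive_def\<close>)

end

theory Submission imports Defs begin

text \<open>
  The inverse \<open>F = (I - L\<mu>)\<^sup>-\<^sup>1\<close> is the Laplace transform of the renewal measure \<open>U\<close> far to the right.
  The function \<open>V(t) = \<integral> (t - x)\<^sup>+ U(dx)\<close> is the integral of \<open>e\<^sup>z\<^sup>t F(z) / z\<^sup>2\<close> over a vertical line,
  which converges absolutely. Moving the line to \<open>Re z = \<theta>'\<close> with \<open>\<theta>'\<close> slightly smaller than \<open>\<theta>\<close>
  picks up the residues at the roots (and at \<open>0\<close> if \<open>\<theta> \<le> 0\<close>), which make up an exponential
  polynomial \<open>W(t)\<close>; its derivative is the main term. By monotonicity \<open>U(t)\<close> lies between the
  difference quotients of \<open>V\<close> on \<open>[t - \<epsilon>, t]\<close> and \<open>[t, t + \<epsilon>]\<close>. The remaining integral contributes to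
  them at most a multiple of \<open>e\<^sup>\<theta>\<^sup>'\<^sup>t \<integral> min(1 / |z|, 1 / (\<epsilon> |z|\<^sup>2)) |dz|\<close>, which is of order \<open>e\<^sup>\<theta>\<^sup>'\<^sup>t log(1 / \<epsilon>)\<close>, and
  \<open>\<epsilon> = e\<^sup>-\<^sup>c\<^sup>t\<close> with large \<open>c\<close> makes the discretisation error of \<open>W\<close> negligible.

  The shift of the line needs \<open>F\<close> to be bounded in the strip away from the real axis. Vertical
  translates of \<open>det (I - L\<mu>)\<close> form a normal family whose limits do not vanish identically, because
  the determinant is bounded away from \<open>0\<close> far to the right; by Hurwitz the limits have no zeros.
\<close>

text \<open>On vertical lines \<open>F\<close> is bounded but need not decay, so the inversion
  integral of \<open>U\<close> itself, with weight 1/z, need not converge absolutely. The weight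
  1/z^2 repairs this; the price is the logarithm, which for \<epsilon> = e^(-ct) becomes the factor
  t of the error term. The spectral radius acts far to the right, where L\<mu>(s) tends to \<mu>(0):
  a vector v >= 1 with \<mu>(0) v = v - 1 makes L\<mu> a contraction in a weighted maximum norm.
  This yields a finite transform of \<open>U\<close> and a bounded inverse. Room to the left of
  \<theta> comes from det A det A^(-1) = 1: the bounded inverse keeps the determinant away from 0 on
  the line, and a Lipschitz bound extends this to a neighbourhood. The new abscissa must avoid the
  pole of 1/z^2, so \<theta>' is nonzero and positive exactly when \<theta> is. The pole at 0 is
  crossed exactly if \<theta> <= 0; there 1/z^2 raises the order by two and differentiation lowers
  the degree by one, which leaves t^k(0).\<close>

unbundle no fps_syntax

subsection \<open>Vertical line integrals\<close>

lemma integrable_inverse_one_plus_square: "integrable lborel (\<lambda>x::real. 1 / (1 + x\<^sup>2))"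
proof -
  have "set_integrable lborel (einterval (-\<infinity>) \<infinity>) (\<lambda>x::real. inverse (1 + x^2))"
    by (rule integrable_inverse_1_plus_square)
  then show ?thesis by (simp add: set_integrable_def inverse_eq_divide)
qed

lemma quadratic_decay_bound:
  fixes g :: "real \<Rightarrow> complex"
  assumes cont: "continuous_on UNIV g"
    and bound: "\<And>x. T \<le> \<bar>x\<bar> \<Longrightarrow> norm (g x) \<le> C / x\<^sup>2"
  obtains K where "K \<ge> 0" "\<And>x. norm (g x) \<le> K * (1 / (1 + x\<^sup>2))"
proof -
  \<comment> \<open>Beyond \<open>S\<close> one has 1 + x^2 <= 2 x^2, because \<open>S\<close> is at
    least 1; this is the factor 2 in \<open>K\<close>.\<close>
  define S where "S = max 1 T"
  have "compact (g ` {-S..S})"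
    by (intro compact_continuous_image continuous_on_subset[OF cont]) auto
  then obtain B where B: "\<And>x. x \<in> {-S..S} \<Longrightarrow> norm (g x) \<le> B"
    unfolding compact_eq_bounded_closed bounded_iff by (metis imageI)
  define K where "K = max (\<bar>B\<bar> * (1 + S\<^sup>2)) (2 * \<bar>C\<bar>)"
  have "norm (g x) \<le> K * (1 / (1 + x\<^sup>2))" for x
  proof (cases "\<bar>x\<bar> \<le> S")
    case True
    have "x\<^sup>2 \<le> S\<^sup>2"
      using True by (meson abs_le_square_iff abs_ge_self order_trans)
    then have "norm (g x) * (1 + x\<^sup>2) \<le> \<bar>B\<bar> * (1 + S\<^sup>2)"
      using B[of x] True by (intro mult_mono) (auto simp: abs_le_iff)
    also have "\<dots> \<le> K" by (simp add: K_def)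
    finally show ?thesis by (simp add: field_simps add_pos_nonneg)
  next
    case False
    then have x: "1 \<le> \<bar>x\<bar>" "T \<le> \<bar>x\<bar>" by (auto simp: S_def)
    have x1: "1 \<le> x\<^sup>2" using x(1) by (simp add: abs_le_square_iff[of 1 x, simplified])
    have "norm (g x) \<le> C / x\<^sup>2" using bound x by blast
    also have "\<dots> \<le> \<bar>C\<bar> / x\<^sup>2" by (simp add: divide_right_mono)
    also have "\<dots> \<le> 2 * \<bar>C\<bar> / (1 + x\<^sup>2)"
      using x1 mult_left_mono[OF x1, of "\<bar>C\<bar>"] by (simp add: divide_simps algebra_simps add_pos_nonneg)
    also have "\<dots> \<le> K / (1 + x\<^sup>2)" by (intro divide_right_mono) (auto simp: K_def)
    finally show ?thesis by simp
  qed
  moreover have "K \<ge> 0" by (simp add: K_def)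
  ultimately show ?thesis using that by blast
qed

lemma integrable_quadratic_decay:
  fixes g :: "real \<Rightarrow> complex"
  assumes cont: "continuous_on UNIV g"
    and bound: "\<And>x. T \<le> \<bar>x\<bar> \<Longrightarrow> norm (g x) \<le> C / x\<^sup>2"
  shows "integrable lborel g"
proof -
  obtain K where K: "K \<ge> 0" "\<And>x. norm (g x) \<le> K * (1 / (1 + x\<^sup>2))"
    using quadratic_decay_bound[OF assms] by metis
  show ?thesis
  proof (rule Bochner_Integration.integrable_bound)
    show "integrable lborel (\<lambda>x. K * (1 / (1 + x\<^sup>2)))"
      by (intro integrable_mult_right integrable_inverse_one_plus_square)
    show "g \<in> borel_measurable lborel"
      using borel_measurable_continuous_onI[OF cont] by simp
    show "AE x in lborel. norm (g x) \<le> norm (K * (1 / (1 + x\<^sup>2)))"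
      using K by (intro AE_I2) (auto simp: abs_mult intro: order_trans)
  qed
qed

text \<open>Contour integrals over vertical segments are gauge integrals over bounded intervals,
  whereas the inversion formula uses Lebesgue integrals over the whole line. Dominated convergence
  connects the two.\<close>

lemma integral_symmetric_tendsto:
  fixes g :: "real \<Rightarrow> complex"
  assumes "integrable lborel g"
  shows "(\<lambda>n. integral {- real n..real n} g) \<longlonglongrightarrow> (LINT x|lborel. g x)"
proof -
  have eq: "integral {- real n..real n} g = (LINT x|lborel. indicator {- real n..real n} x *\<^sub>R g x)" for n
  proof -
    have "set_integrable lborel {- real n..real n} g"
      unfolding set_integrable_def using assms by (intro integrable_mult_indicator) auto
    from set_borel_integral_eq_integral(2)[OF this] show ?thesis
      by (simp add: set_lebesgue_integral_def)
  qed
  have [measurable]: "g \<in> borel_measurable borel" using assms by auto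
  show ?thesis unfolding eq
  proof (rule integral_dominated_convergence[where w="\<lambda>x. norm (g x)"])
    show "AE x in lborel. (\<lambda>n. indicator {- real n..real n} x *\<^sub>R g x) \<longlonglongrightarrow> g x"
    proof (intro AE_I2 tendsto_eventually)
      fix x :: real
      obtain N where N: "\<bar>x\<bar> \<le> real N" using real_arch_simple by blast
      show "\<forall>\<^sub>F n in sequentially. indicator {- real n..real n} x *\<^sub>R g x = g x"
        using eventually_ge_at_top[of N]
      proof eventually_elim
        case (elim n)
        then have "\<bar>x\<bar> \<le> real n" using N by linarith
        then show ?case by (simp add: abs_le_iff)
      qed
    qed
  qed (use assms in \<open>auto intro!: AE_I2 simp: indicator_def\<close>)
qed

text \<open>The residue theorem on growing rectangles, whose horizontal sides vanish by the
  quadratic decay. On a vertical line dz = i dy, so 2 pi i becomes 2 pi. The margins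
  \<open>a'\<close> and \<open>b'\<close> provide an open set around both lines.\<close>

theorem vertical_line_shift:
  fixes f :: "complex \<Rightarrow> complex" and a b a' b' C T :: real
  assumes ab: "a' < a" "a < b" "b < b'"
    and P: "finite P" "P \<subseteq> {z. a < Re z \<and> Re z < b}"
    and holo: "f holomorphic_on {z. a' < Re z \<and> Re z < b'} - P"
    and bound: "\<And>z. a \<le> Re z \<Longrightarrow> Re z \<le> b \<Longrightarrow> T \<le> \<bar>Im z\<bar> \<Longrightarrow> norm (f z) \<le> C / (Im z)\<^sup>2"
  shows "(LINT y|lborel. f (Complex b y)) = (LINT y|lborel. f (Complex a y)) + 2 * pi * (\<Sum>p\<in>P. residue f p)"
proof -
  define S where "S = {z. a' < Re z \<and> Re z < b'}"
  have S_eq: "S = {z. a' < Re z} \<inter> {z. Re z < b'}" by (auto simp: S_def)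
  have "open S" unfolding S_eq by (intro open_Int open_halfspace_Re_gt open_halfspace_Re_lt)
  have "convex S" unfolding S_eq by (intro convex_Int convex_halfspace_Re_gt convex_halfspace_Re_lt)
  have holo: "f holomorphic_on S - P" using holo by (simp add: S_def)
  have cont: "continuous_on (S - P) f" using holo by (rule holomorphic_on_imp_continuous_on)
  have line: "continuous_on UNIV (\<lambda>y. f (Complex c y))" if "c = a \<or> c = b" for c
  proof (rule continuous_on_compose2[OF cont])
    show "continuous_on UNIV (Complex c)"
      unfolding Complex_eq by (intro continuous_intros)
    show "Complex c ` UNIV \<subseteq> S - P" using that ab P by (auto simp: S_def)
  qed
  have integ: "integrable lborel (\<lambda>y. f (Complex c y))" if "c = a \<or> c = b" for c
  proof (rule integrable_quadratic_decay[OF line[OF that]])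
    show "norm (f (Complex c x)) \<le> C / x\<^sup>2" if "T \<le> \<bar>x\<bar>" for x
      using bound[of "Complex c x"] \<open>c = a \<or> c = b\<close> ab that by auto
  qed
  obtain R where R: "\<And>p. p \<in> P \<Longrightarrow> \<bar>Im p\<bar> \<le> R"
    using finite_imp_bounded[OF finite_imageI[OF P(1), of Im]] by (auto simp: bounded_iff)
  obtain N where N: "\<bar>R\<bar> + \<bar>T\<bar> + 1 \<le> real N" using real_arch_simple by blast
  \<comment> \<open>The defect of the claimed identity, times i, with both lines cut off at height
    \<open>n\<close>. For large \<open>n\<close> it is minus the sum of the horizontal
    sides.\<close>
  define D where "D n = \<i> * integral {- real n..real n} (\<lambda>y. f (Complex b y))
      - \<i> * integral {- real n..real n} (\<lambda>y. f (Complex a y)) - 2 * pi * \<i> * (\<Sum>p\<in>P. residue f p)" for n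
  have D: "norm (D n) \<le> 2 * (b - a) * (C / (real n)\<^sup>2)" if "n \<ge> N" for n
  proof -
    define t where "t = real n"
    have t: "\<bar>R\<bar> + \<bar>T\<bar> + 1 \<le> t" using N that by (simp add: t_def)
    \<comment> \<open>The sign of \<open>C\<close> is not prescribed; \<open>bound\<close> at a
      point of height \<open>t\<close> supplies the nonnegativity that the length estimate
      requires.\<close>
    have ct: "0 \<le> C / t\<^sup>2"
      using order_trans[OF norm_ge_zero bound[of "Complex a t"]] t ab by auto
    define a1 a2 a3 a4 where "a1 = Complex a (-t)" and "a2 = Complex b (-t)"
      and "a3 = Complex b t" and "a4 = Complex a t"
    have rect: "rectpath a1 a3 = linepath a1 a2 +++ linepath a2 a3 +++ linepath a3 a4 +++ linepath a4 a1"
      by (simp add: rectpath_def Let_def a1_def a2_def a3_def a4_def)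
    have im: "path_image (rectpath a1 a3) \<subseteq> S - P"
    proof (subst path_image_rectpath)
      show "Re a1 \<le> Re a3" "Im a1 \<le> Im a3" using ab t by (auto simp: a1_def a3_def)
      show "{z. Re z \<in> {Re a1, Re a3} \<and> Im z \<in> {Im a1..Im a3}} \<union>
        {z. Im z \<in> {Im a1, Im a3} \<and> Re z \<in> {Re a1..Re a3}} \<subseteq> S - P"
        using ab t R P by (fastforce simp: a1_def a3_def S_def)
    qed
    have seg: "closed_segment a1 a2 \<subseteq> S - P" "closed_segment a2 a3 \<subseteq> S - P"
      "closed_segment a3 a4 \<subseteq> S - P" "closed_segment a4 a1 \<subseteq> S - P"
      using im by (auto simp: rect path_image_join)
    note ci = contour_integrable_continuous_linepath[OF continuous_on_subset[OF cont]]
    have "contour_integral (rectpath a1 a3) f =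
        2 * pi * \<i> * (\<Sum>p\<in>P. winding_number (rectpath a1 a3) p * residue f p)"
    proof (rule Residue_theorem[OF \<open>open S\<close> _ P(1) holo])
      show "connected S" using \<open>convex S\<close> by (rule convex_connected)
      show "\<forall>z. z \<notin> S \<longrightarrow> winding_number (rectpath a1 a3) z = 0"
        using ab t by (auto intro!: winding_number_rectpath_outside
            simp: S_def a1_def a3_def in_cbox_complex_iff)
    qed (use im in auto)
    also have "(\<Sum>p\<in>P. winding_number (rectpath a1 a3) p * residue f p) = (\<Sum>p\<in>P. residue f p)"
    proof (rule sum.cong[OF refl])
      fix p assume p: "p \<in> P"
      then have "p \<in> box a1 a3"
        using P(2) R[OF p] t by (auto simp: in_box_complex_iff a1_def a3_def)
      then show "winding_number (rectpath a1 a3) p * residue f p = residue f p"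
        by (simp add: winding_number_rectpath)
    qed
    finally have res: "contour_integral (rectpath a1 a3) f = 2 * pi * \<i> * (\<Sum>p\<in>P. residue f p)" .
    have "contour_integral (rectpath a1 a3) f = contour_integral (linepath a1 a2) f
        + (contour_integral (linepath a2 a3) f + (contour_integral (linepath a3 a4) f
        + contour_integral (linepath a4 a1) f))"
      unfolding rect using ci[OF seg(1)] ci[OF seg(2)] ci[OF seg(3)] ci[OF seg(4)]
      by simp
    moreover have "contour_integral (linepath a2 a3) f = \<i> * integral {-t..t} (\<lambda>y. f (Complex b y))"
      using t by (intro contour_integral_linepath_same_Re) (auto simp: a2_def a3_def)
    moreover have "contour_integral (linepath a4 a1) f = - (\<i> * integral {-t..t} (\<lambda>y. f (Complex a y)))"
    proof -
      have "contour_integral (linepath a4 a1) f = - contour_integral (linepath a1 a4) f"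
        using contour_integral_reverse_linepath[OF continuous_on_subset[OF cont], of a4 a1] seg(4)
        by simp
      also have "contour_integral (linepath a1 a4) f = \<i> * integral {-t..t} (\<lambda>y. f (Complex a y))"
        using t by (intro contour_integral_linepath_same_Re) (auto simp: a4_def a1_def)
      finally show ?thesis .
    qed
    ultimately have "D n = - (contour_integral (linepath a1 a2) f + contour_integral (linepath a3 a4) f)"
      using res unfolding D_def t_def[symmetric] by (simp add: algebra_simps add_eq_0_iff)
    then have "norm (D n) \<le> norm (contour_integral (linepath a1 a2) f) + norm (contour_integral (linepath a3 a4) f)"
      by (metis norm_minus_cancel norm_triangle_ineq)
    also have "\<dots> \<le> C / t\<^sup>2 * norm (a2 - a1) + C / t\<^sup>2 * norm (a4 - a3)"
    proof (intro add_mono)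
      show "norm (contour_integral (linepath a1 a2) f) \<le> C / t\<^sup>2 * norm (a2 - a1)"
      proof (rule has_contour_integral_bound_linepath[OF has_contour_integral_integral[OF ci[OF seg(1)]] ct])
        fix x assume x: "x \<in> closed_segment a1 a2"
        then have "Im x = -t \<and> a \<le> Re x \<and> Re x \<le> b"
          using ab by (auto simp: a1_def a2_def closed_segment_same_Im closed_segment_eq_real_ivl)
        then show "norm (f x) \<le> C / t\<^sup>2" using bound[of x] t by auto
      qed
      show "norm (contour_integral (linepath a3 a4) f) \<le> C / t\<^sup>2 * norm (a4 - a3)"
      proof (rule has_contour_integral_bound_linepath[OF has_contour_integral_integral[OF ci[OF seg(3)]] ct])
        fix x assume x: "x \<in> closed_segment a3 a4"
        then have "Im x = t \<and> a \<le> Re x \<and> Re x \<le> b"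
          using ab by (auto simp: a3_def a4_def closed_segment_same_Im closed_segment_eq_real_ivl)
        then show "norm (f x) \<le> C / t\<^sup>2" using bound[of x] t by auto
      qed
    qed
    also have "norm (a2 - a1) = b - a" using ab by (simp add: a1_def a2_def cmod_def)
    also have "norm (a4 - a3) = b - a" using ab by (simp add: a3_def a4_def cmod_def)
    also have "q * (b - a) + q * (b - a) = 2 * (b - a) * q" for q :: real by (simp add: algebra_simps)
    finally show ?thesis by (simp add: t_def)
  qed
  have "D \<longlonglongrightarrow> 0"
  proof (rule Lim_null_comparison)
    show "\<forall>\<^sub>F n in sequentially. norm (D n) \<le> 2 * (b - a) * (C / (real n)\<^sup>2)"
      using D by (auto simp: eventually_sequentially)
    show "(\<lambda>n. 2 * (b - a) * (C / (real n)\<^sup>2)) \<longlonglongrightarrow> 0" by real_asymp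
  qed
  moreover have "D \<longlonglongrightarrow> \<i> * (LINT y|lborel. f (Complex b y)) - \<i> * (LINT y|lborel. f (Complex a y))
      - 2 * pi * \<i> * (\<Sum>p\<in>P. residue f p)"
    unfolding D_def by (intro tendsto_intros integral_symmetric_tendsto integ) auto
  ultimately have "\<i> * (LINT y|lborel. f (Complex b y)) - \<i> * (LINT y|lborel. f (Complex a y))
      - 2 * pi * \<i> * (\<Sum>p\<in>P. residue f p) = 0"
    using LIMSEQ_unique by blast
  then have "\<i> * ((LINT y|lborel. f (Complex b y)) -
      ((LINT y|lborel. f (Complex a y)) + 2 * pi * (\<Sum>p\<in>P. residue f p))) = 0"
    by (simp add: algebra_simps)
  then show ?thesis by simp
qed

lemma norm_exp_Complex: "norm (exp (Complex c y * of_real x)) = exp (c * x)"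
  by (simp add: norm_exp_eq_Re)

lemma norm_vertical_line_ge: "\<bar>Im z\<bar> \<ge> T \<Longrightarrow> T > 0 \<Longrightarrow> norm (w / z\<^sup>2) \<le> norm w / (Im z)\<^sup>2"
proof -
  assume "\<bar>Im z\<bar> \<ge> T" "T > 0"
  then have "0 < (Im z)\<^sup>2" by auto
  moreover have "(Im z)\<^sup>2 \<le> (norm z)\<^sup>2"
    using abs_Im_le_cmod[of z] by (metis abs_ge_zero power2_abs power_mono)
  ultimately show ?thesis
    by (auto simp: norm_divide norm_power intro!: divide_left_mono mult_pos_pos)
qed

text \<open>The line is pushed to infinity: to the right for \<open>x \<le> 0\<close>, meeting no
  pole, and to the left for \<open>x > 0\<close>, crossing the double pole at 0 with residue
  \<open>x\<close>. In both cases the integral over the moving line tends to 0.\<close>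

theorem inverse_laplace_inverse_square:
  fixes \<sigma> x :: real
  assumes \<sigma>: "\<sigma> > 0"
  shows "(LINT y|lborel. exp (Complex \<sigma> y * of_real x) / (Complex \<sigma> y)\<^sup>2) = 2 * pi * of_real (max 0 x)"
proof -
  define f where "f z = exp (z * of_real x) / z\<^sup>2" for z :: complex
  define I where "I c = (LINT y|lborel. f (Complex c y))" for c
  have bound: "norm (f z) \<le> exp (max (a * x) (b * x)) / (Im z)\<^sup>2"
    if "a \<le> Re z" "Re z \<le> b" "1 \<le> \<bar>Im z\<bar>" for a b z
  proof -
    have "norm (f z) \<le> norm (exp (z * of_real x)) / (Im z)\<^sup>2"
      unfolding f_def using that by (intro norm_vertical_line_ge[of 1]) auto
    also have "norm (exp (z * of_real x)) \<le> exp (max (a * x) (b * x))"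
    proof -
      have "Re z * x \<le> max (a * x) (b * x)"
        using that mult_right_mono[of "Re z" b x] mult_right_mono_neg[of a "Re z" x]
        by (cases "x \<ge> 0") (auto simp: le_max_iff_disj)
      then show ?thesis by (simp add: norm_exp_eq_Re)
    qed
    finally show ?thesis by (simp add: divide_right_mono)
  qed
  have holo: "f holomorphic_on A - {0}" for A
    unfolding f_def by (intro holomorphic_intros) auto
  have meas: "(\<lambda>y. f (Complex c y)) \<in> borel_measurable lborel" if "c \<noteq> 0" for c
  proof -
    have "continuous_on UNIV (\<lambda>y. f (Complex c y))"
      unfolding f_def using that
      by (intro continuous_intros continuous_on_Complex) (simp add: Complex_eq_0)
    from borel_measurable_continuous_onI[OF this] show ?thesis by simp
  qed
  \<comment> \<open>When c x <= 0 the exponential is at most 1, and |c| >= 1 makes |z|^2 at least 1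
    + y^2 and at least c^2: a majorant free of \<open>c\<close>, and a bound that vanishes as |c|
    grows.\<close>
  have dec: "norm (f (Complex c y)) \<le> 1 / (1 + y\<^sup>2)" "norm (f (Complex c y)) \<le> 1 / c\<^sup>2"
    if "c * x \<le> 0" "1 \<le> \<bar>c\<bar>" for c y
  proof -
    have "1 \<le> c\<^sup>2" using that(2) by (simp add: abs_le_square_iff[of 1 c, simplified])
    moreover have "norm (f (Complex c y)) = exp (c * x) / (c\<^sup>2 + y\<^sup>2)"
      by (simp add: f_def norm_divide norm_power norm_exp_eq_Re cmod_power2)
    moreover have "exp (c * x) \<le> 1" using that(1) by simp
    ultimately show "norm (f (Complex c y)) \<le> 1 / (1 + y\<^sup>2)" "norm (f (Complex c y)) \<le> 1 / c\<^sup>2"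
      by (auto intro!: frac_le add_pos_nonneg)
  qed
  \<comment> \<open>The sign \<open>s\<close> is the direction of the shift, chosen such that the
    exponential stays bounded.\<close>
  have lim: "(\<lambda>n. I (s * real (Suc n))) \<longlonglongrightarrow> 0" if s: "s * x \<le> 0" "\<bar>s\<bar> = 1" for s
  proof -
    have s2: "s\<^sup>2 = 1" using s(2) by (metis one_power2 power2_abs)
    have s': "s * real (Suc n) * x \<le> 0" "1 \<le> \<bar>s * real (Suc n)\<bar>" "s * real (Suc n) \<noteq> 0" for n
    proof -
      show "s * real (Suc n) * x \<le> 0" using mult_nonneg_nonpos[OF _ s(1), of "real (Suc n)"]
        by (simp add: mult_ac)
    qed (use s in \<open>auto simp: abs_mult\<close>)
    have "(\<lambda>n. LINT y|lborel. f (Complex (s * real (Suc n)) y)) \<longlonglongrightarrow> (LINT (y::real)|lborel. 0)"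
    proof (rule integral_dominated_convergence[where w="\<lambda>y. 1 / (1 + y\<^sup>2)"])
      show "AE y in lborel. (\<lambda>n. f (Complex (s * real (Suc n)) y)) \<longlonglongrightarrow> 0"
      proof (rule AE_I2, rule Lim_null_comparison[where g="\<lambda>n. 1 / (real (Suc n))\<^sup>2"])
        fix y :: real
        have "norm (f (Complex (s * real (Suc n)) y)) \<le> 1 / (real (Suc n))\<^sup>2" for n
          using dec(2)[OF s'(1,2)] by (simp add: power_mult_distrib s2 del: of_nat_Suc)
        then show "\<forall>\<^sub>F n in sequentially. norm (f (Complex (s * real (Suc n)) y)) \<le> 1 / (real (Suc n))\<^sup>2"
          by simp
        show "(\<lambda>n. 1 / (real (Suc n))\<^sup>2) \<longlonglongrightarrow> 0" by real_asymp
      qed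
      show "AE y in lborel. norm (f (Complex (s * real (Suc n)) y)) \<le> 1 / (1 + y\<^sup>2)" for n
        using dec(1)[OF s'(1,2)] by auto
    next
      show "(\<lambda>y. f (Complex (s * real (Suc n)) y)) \<in> borel_measurable lborel" for n by (rule meas[OF s'(3)])
    qed (use integrable_inverse_one_plus_square in simp_all)
    then show ?thesis by (simp add: I_def)
  qed
  show ?thesis
  proof (cases "x \<le> 0")
    case True
    have "I (1 * real (Suc n)) = I \<sigma>" if "real (Suc n) > \<sigma>" for n
    proof -
      have "(LINT y|lborel. f (Complex (real (Suc n)) y)) = (LINT y|lborel. f (Complex \<sigma> y)) + 2 * pi * (\<Sum>p\<in>{}. residue f p)"
      proof (rule vertical_line_shift[where a'=0 and b'="real (Suc n) + 1" and T=1, OF _ that _ _ _ _ bound])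
        show "f holomorphic_on {z. 0 < Re z \<and> Re z < real (Suc n) + 1} - {}"
          unfolding f_def by (intro holomorphic_intros) auto
      qed (use \<sigma> in auto)
      then show ?thesis by (simp add: I_def)
    qed
    moreover obtain N where "real N > \<sigma>" using reals_Archimedean2 by blast
    ultimately have "\<forall>\<^sub>F n in sequentially. I (1 * real (Suc n)) = I \<sigma>"
      by (intro eventually_sequentiallyI[of N]) auto
    from tendsto_cong[OF this] lim[of 1] True have "(\<lambda>n::nat. I \<sigma>) \<longlonglongrightarrow> 0" by simp
    then have "I \<sigma> = 0" by (simp add: LIMSEQ_const_iff)
    then show ?thesis using True by (simp add: I_def f_def)
  next
    case False
    have "residue f 0 = (deriv ^^ 1) (\<lambda>z. exp (z * of_real x)) 0 / fact 1"
      unfolding f_def using residue_holomorphic_over_power'[of UNIV "\<lambda>z. exp (z * of_real x)" 1]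
      by (simp add: holomorphic_intros numeral_2_eq_2)
    also have "\<dots> = of_real x"
      by (auto intro!: DERIV_imp_deriv derivative_eq_intros)
    finally have res: "residue f 0 = of_real x" .
    have "I (-1 * real (Suc n)) = I \<sigma> - 2 * pi * of_real x" for n
    proof -
      have "(LINT y|lborel. f (Complex \<sigma> y)) =
          (LINT y|lborel. f (Complex (- real (Suc n)) y)) + 2 * pi * (\<Sum>p\<in>{0}. residue f p)"
        by (rule vertical_line_shift[where a'="- real (Suc n) - 1" and b'="\<sigma> + 1" and T=1, OF _ _ _ _ _ _ bound])
           (use \<sigma> holo in auto)
      then show ?thesis by (simp add: I_def res)
    qed
    with lim[of "-1"] False have "(\<lambda>n::nat. I \<sigma> - 2 * pi * of_real x) \<longlonglongrightarrow> 0" by simp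
    then have "I \<sigma> = 2 * pi * of_real x" by (simp add: LIMSEQ_const_iff)
    then show ?thesis using False by (simp add: I_def f_def)
  qed
qed

subsection \<open>Lower bounds in vertical strips\<close>

text \<open>Cauchy's estimate on circles of radius (b - a)/2, which stay in the larger half-plane,
  bounds the derivative; the smaller half-plane is convex.\<close>

lemma bounded_halfplane_lipschitz:
  fixes d :: "complex \<Rightarrow> complex"
  assumes holo: "d holomorphic_on {z. a < Re z}" and bnd: "\<And>z. a < Re z \<Longrightarrow> norm (d z) \<le> B"
    and b: "a < b" and zw: "b \<le> Re z" "b \<le> Re w"
  shows "norm (d z - d w) \<le> 2 * B / (b - a) * norm (z - w)"
proof (rule field_differentiable_bound[where S="{z. b \<le> Re z}" and f'="deriv d"])
  have op: "open {z. a < Re z}" by (rule open_halfspace_Re_gt)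
  fix u assume u: "u \<in> {z. b \<le> Re z}"
  then have u': "u \<in> {z. a < Re z}" using b by auto
  show "(d has_field_derivative deriv d u) (at u within {z. b \<le> Re z})"
    using holomorphic_derivI[OF holo op u'] by (rule has_field_derivative_at_within)
  have sub: "cball u ((b - a) / 2) \<subseteq> {z. a < Re z}"
  proof
    fix v assume "v \<in> cball u ((b - a) / 2)"
    then have "\<bar>Re (u - v)\<bar> \<le> (b - a) / 2"
      using abs_Re_le_cmod[of "u - v"] by (auto simp: dist_norm)
    then have "Re u - Re v \<le> (b - a) / 2" unfolding minus_complex.sel by linarith
    moreover have "b \<le> Re u" using u by simp
    ultimately show "v \<in> {z. a < Re z}" using b unfolding mem_Collect_eq by argo
  qed
  have "norm ((deriv ^^ 1) d u) \<le> fact 1 * B / ((b - a) / 2) ^ 1"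
  proof (rule Cauchy_inequality)
    show "d holomorphic_on ball u ((b - a) / 2)"
      using sub ball_subset_cball by (blast intro: holomorphic_on_subset[OF holo])
    show "continuous_on (cball u ((b - a) / 2)) d"
      using sub by (blast intro: continuous_on_subset holomorphic_on_imp_continuous_on[OF holo])
    show "norm (d x) \<le> B" if "norm (u - x) = (b - a) / 2" for x
    proof -
      have "x \<in> cball u ((b - a) / 2)" using that by (simp add: dist_norm)
      then show ?thesis using sub bnd by blast
    qed
  qed (use b in auto)
  then show "norm (deriv d u) \<le> 2 * B / (b - a)" by (simp add: mult.commute)
qed (use zw in \<open>auto intro: convex_halfspace_Re_ge\<close>)

text \<open>The gap between \<theta> and \<alpha> places the segment from \<alpha> to \<sigma>
  inside the open set where the translates converge. Finitely many zeros have bounded imaginary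
  parts, so high translates have no zeros there.\<close>

lemma strip_lower_bound_interior:
  fixes d :: "complex \<Rightarrow> complex"
  assumes holo: "d holomorphic_on {z. \<theta> < Re z}"
    and bnd: "\<And>z. \<theta> < Re z \<Longrightarrow> norm (d z) \<le> B"
    and c: "c > 0" and \<alpha>: "\<theta> < \<alpha>" "\<alpha> \<le> \<sigma>"
    and line: "\<And>y. c \<le> norm (d (Complex \<sigma> y))"
    and fin: "finite {z. \<theta> < Re z \<and> d z = 0}"
  shows "\<exists>e>0. \<exists>T. \<forall>z. \<alpha> \<le> Re z \<longrightarrow> Re z \<le> \<sigma> \<longrightarrow> T \<le> \<bar>Im z\<bar> \<longrightarrow> e \<le> norm (d z)"
proof (rule ccontr)
  assume contr: "\<not> ?thesis"
  obtain R where R: "\<And>p. \<theta> < Re p \<Longrightarrow> d p = 0 \<Longrightarrow> \<bar>Im p\<bar> \<le> R"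
    using finite_imp_bounded[OF finite_imageI[OF fin, of Im]] by (auto simp: bounded_iff)
  \<comment> \<open>Counterexamples of height at least |R| + 1: the windows of half-height 1 around
    them stay above all zeros in absolute imaginary part.\<close>
  have "\<exists>z. \<alpha> \<le> Re z \<and> Re z \<le> \<sigma> \<and> \<bar>R\<bar> + 1 \<le> \<bar>Im z\<bar> \<and> norm (d z) < 1 / real (Suc n)" for n
    using contr by (auto simp: not_le dest!: spec[of _ "1 / real (Suc n)"] spec[of _ "\<bar>R\<bar> + 1"])
  then obtain z where z: "\<And>n. \<alpha> \<le> Re (z n)" "\<And>n. Re (z n) \<le> \<sigma>" "\<And>n. \<bar>R\<bar> + 1 \<le> \<bar>Im (z n)\<bar>"
      "\<And>n. norm (d (z n)) < 1 / real (Suc n)" by metis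
  \<comment> \<open>The translation moves the counterexample \<open>z n\<close> to its real part, a
    point of a fixed compact segment.\<close>
  define f where "f n w = d (w + \<i> * of_real (Im (z n)))" for n w
  define S where "S = {w. \<theta> < Re w \<and> \<bar>Im w\<bar> < 1}"
  have S_eq: "S = {w. \<theta> < Re w} \<inter> {w. - 1 < Im w} \<inter> {w. Im w < 1}" by (auto simp: S_def)
  have "open S" unfolding S_eq
    by (intro open_Int open_halfspace_Re_gt open_halfspace_Im_gt open_halfspace_Im_lt)
  have "convex S" unfolding S_eq
    by (intro convex_Int convex_halfspace_Re_gt convex_halfspace_Im_gt convex_halfspace_Im_lt)
  have f_holo: "f n holomorphic_on S" for n
    unfolding f_def
    by (rule holomorphic_on_compose_gen[OF _ holo, unfolded comp_def]) (auto intro!: holomorphic_intros simp: S_def)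
  have f_nz: "f n w \<noteq> 0" if "w \<in> S" for n w
  proof
    assume "f n w = 0"
    then have "\<bar>Im (w + \<i> * of_real (Im (z n)))\<bar> \<le> R"
      using that by (intro R) (auto simp: f_def S_def)
    then show False using z(3)[of n] that by (auto simp: S_def)
  qed
  obtain g r where g: "g holomorphic_on S" "strict_mono (r :: nat \<Rightarrow> nat)"
      "\<And>x. x \<in> S \<Longrightarrow> ((\<lambda>n. f (r n) x) \<longlongrightarrow> g x) sequentially"
      "\<And>K. compact K \<Longrightarrow> K \<subseteq> S \<Longrightarrow> uniform_limit K (f \<circ> r) g sequentially"
  proof (rule Montel[OF \<open>open S\<close>, of "range f" f])
    show "h holomorphic_on S" if "h \<in> range f" for h using that f_holo by auto
    show "\<exists>B. \<forall>h\<in>range f. \<forall>z\<in>K. norm (h z) \<le> B" if "compact K" "K \<subseteq> S" for K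
      using that by (intro exI[of _ B]) (auto simp: f_def S_def intro!: bnd)
  qed auto
  define z0 where "z0 = Complex \<sigma> 0"
  have z0: "z0 \<in> S" using \<alpha> by (simp add: z0_def S_def)
  \<comment> \<open>Hurwitz' theorem requires a nonconstant limit; a constant limit is nonzero by
    its value at \<open>z0\<close>, where \<open>line\<close> applies.\<close>
  have g_nz: "g x \<noteq> 0" if x: "x \<in> S" for x
  proof (cases "g constant_on S")
    case True
    have "c \<le> norm (g z0)"
    proof (rule tendsto_lowerbound[OF tendsto_norm[OF g(3)[OF z0]]])
      have "z0 + \<i> * of_real y = Complex \<sigma> y" for y by (simp add: z0_def complex_eq_iff)
      then show "\<forall>\<^sub>F n in sequentially. c \<le> norm (f (r n) z0)"
        using line by (intro always_eventually) (simp add: f_def)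
    qed simp
    moreover have "g x = g z0" using True x z0 by (auto simp: constant_on_def)
    ultimately show ?thesis using c by auto
  next
    case False
    show ?thesis
      by (rule Hurwitz_no_zeros[OF \<open>open S\<close> convex_connected[OF \<open>convex S\<close>], of "f \<circ> r" g])
         (use f_holo f_nz g False x in auto)
  qed
  define K where "K = complex_of_real ` {\<alpha>..\<sigma>}"
  have K: "compact K" "K \<subseteq> S" "K \<noteq> {}"
    unfolding K_def using \<alpha> by (auto intro!: compact_continuous_image continuous_intros simp: S_def)
  have "continuous_on K (\<lambda>x. norm (g x))"
    by (intro continuous_intros holomorphic_on_imp_continuous_on holomorphic_on_subset[OF g(1)] K)
  from continuous_attains_inf[OF K(1,3) this] obtain k where k: "k \<in> K" "\<And>y. y \<in> K \<Longrightarrow> norm (g k) \<le> norm (g y)"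
    by auto
  define m where "m = norm (g k)"
  have m: "m > 0" using g_nz k(1) K(2) by (auto simp: m_def)
  have "\<forall>\<^sub>F n in sequentially. \<forall>x\<in>K. dist ((f \<circ> r) n x) (g x) < m / 2"
    using uniform_limitD[OF g(4)[OF K(1,2)], of "m / 2"] m by simp
  moreover have "\<forall>\<^sub>F n in sequentially. 1 / real (Suc n) < m / 2" using m by real_asymp
  ultimately have "\<forall>\<^sub>F n in sequentially. False"
  proof eventually_elim
    case (elim n)
    \<comment> \<open>At this point \<open>f (r n)\<close> takes the value
      \<open>d (z (r n))\<close>, too small for a function uniformly close to \<open>g\<close> on
      \<open>K\<close>.\<close>
    define x where "x = complex_of_real (Re (z (r n)))"
    have x: "x \<in> K" using z by (auto simp: K_def x_def)
    have "x + \<i> * of_real (Im (z (r n))) = z (r n)" by (simp add: x_def complex_eq_iff)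
    then have "norm (f (r n) x) < 1 / real (Suc (r n))" using z(4)[of "r n"] by (simp add: f_def)
    also have "\<dots> \<le> 1 / real (Suc n)" using seq_suble[OF g(2), of n] by (simp add: frac_le)
    finally have "norm (f (r n) x) < m / 2" using elim by simp
    moreover have "norm (g x - f (r n) x) < m / 2" using elim x by (auto simp: dist_norm norm_minus_commute)
    moreover have "m \<le> norm (g x)" using k x by (auto simp: m_def)
    ultimately show False using norm_triangle_ineq[of "g x - f (r n) x" "f (r n) x"] by simp
  qed
  then show False by simp
qed

text \<open>Near the line through \<theta> the Lipschitz bound preserves \<open>c / 2\<close> on
  both sides, in particular to the left, which is what the later shift beyond \<theta> relies on.
  From \<open>\<theta> + \<delta>\<close> on, \<open>strip_lower_bound_interior\<close> takes
  over.\<close>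

theorem strip_lower_bound:
  fixes d :: "complex \<Rightarrow> complex"
  assumes holo: "d holomorphic_on {z. a < Re z}"
    and bnd: "\<And>z. a < Re z \<Longrightarrow> norm (d z) \<le> B"
    and c: "c > 0" and a: "a < \<theta>" "\<theta> < \<sigma>"
    and line\<theta>: "\<And>y. c \<le> norm (d (Complex \<theta> y))"
    and line\<sigma>: "\<And>y. c \<le> norm (d (Complex \<sigma> y))"
    and fin: "finite {z. \<theta> < Re z \<and> d z = 0}"
  obtains \<delta> e T where "\<delta> > 0" "e > 0" "\<delta> < \<theta> - a" "\<delta> < \<sigma> - \<theta>"
    "\<And>z. \<bar>Re z - \<theta>\<bar> \<le> \<delta> \<Longrightarrow> e \<le> norm (d z)"
    "\<And>z. \<theta> - \<delta> \<le> Re z \<Longrightarrow> Re z \<le> \<sigma> \<Longrightarrow> T \<le> \<bar>Im z\<bar> \<Longrightarrow> e \<le> norm (d z)"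
proof -
  define b where "b = (a + \<theta>) / 2"
  define L where "L = 2 * B / (b - a)"
  have b: "a < b" "b < \<theta>" using a by (auto simp: b_def)
  have "c \<le> B" using line\<theta>[of 0] bnd[of "Complex \<theta> 0"] a by simp
  then have "L > 0" using c b by (simp add: L_def)
  \<comment> \<open>The three bounds keep the loss L \<delta> at most c/2, the points in the
    half-plane Re z >= b of the Lipschitz estimate, and \<theta> + \<delta> to the left of
    \<sigma>.\<close>
  define \<delta> where "\<delta> = min (c / (2 * L)) (min (\<theta> - b) ((\<sigma> - \<theta>) / 2))"
  have \<delta>: "\<delta> > 0" "\<delta> \<le> c / (2 * L)" "\<delta> \<le> \<theta> - b" "\<delta> \<le> (\<sigma> - \<theta>) / 2"
    unfolding \<delta>_def using c \<open>L > 0\<close> a b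
    by (simp_all only: min_less_iff_conj min.cobounded1 min.coboundedI2 min.cobounded2 order_refl
        divide_pos_pos mult_pos_pos zero_less_numeral diff_gt_0_iff_gt simp_thms)
  have near: "c / 2 \<le> norm (d z)" if "\<bar>Re z - \<theta>\<bar> \<le> \<delta>" for z
  proof -
    have "norm (d (Complex \<theta> (Im z)) - d z) \<le> L * norm (Complex \<theta> (Im z) - z)"
      unfolding L_def using that \<delta> b by (intro bounded_halfplane_lipschitz[OF holo bnd]) auto
    also have "norm (Complex \<theta> (Im z) - z) = \<bar>Re z - \<theta>\<bar>" by (simp add: cmod_def)
    also have "L * \<bar>Re z - \<theta>\<bar> \<le> L * (c / (2 * L))"
      using that \<delta> \<open>L > 0\<close> by (intro mult_left_mono) auto
    also have "\<dots> = c / 2" using \<open>L > 0\<close> by simp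
    finally have *: "norm (d (Complex \<theta> (Im z)) - d z) \<le> c / 2" .
    show ?thesis
      using norm_triangle_ineq[of "d (Complex \<theta> (Im z)) - d z" "d z"] line\<theta>[of "Im z"] * by simp
  qed
  have "\<exists>e>0. \<exists>T. \<forall>z. \<theta> + \<delta> \<le> Re z \<longrightarrow> Re z \<le> \<sigma> \<longrightarrow> T \<le> \<bar>Im z\<bar> \<longrightarrow> e \<le> norm (d z)"
  proof (rule strip_lower_bound_interior[OF _ _ c _ _ line\<sigma> fin])
    show "d holomorphic_on {z. \<theta> < Re z}" using a by (intro holomorphic_on_subset[OF holo]) auto
    show "norm (d z) \<le> B" if "\<theta> < Re z" for z using that a by (intro bnd) auto
  qed (use \<delta> a in auto)
  then obtain e T where e: "e > 0" and T: "\<And>z. \<theta> + \<delta> \<le> Re z \<Longrightarrow> Re z \<le> \<sigma> \<Longrightarrow> T \<le> \<bar>Im z\<bar> \<Longrightarrow> e \<le> norm (d z)"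
    by blast
  show thesis
  proof (rule that[of \<delta> "min (c / 2) e" T])
    show "min (c / 2) e \<le> norm (d z)" if "\<bar>Re z - \<theta>\<bar> \<le> \<delta>" for z using near[OF that] by simp
    show "min (c / 2) e \<le> norm (d z)" if "\<theta> - \<delta> \<le> Re z" "Re z \<le> \<sigma>" "T \<le> \<bar>Im z\<bar>" for z
    proof (cases "\<theta> + \<delta> \<le> Re z")
      case True
      then show ?thesis using T[OF True that(2,3)] by simp
    next
      case False
      then have "\<bar>Re z - \<theta>\<bar> \<le> \<delta>" using that by auto
      then show ?thesis by (intro min.coboundedI1 near)
    qed
  qed (use \<delta> b e c a in auto)
qed

subsection \<open>Laplace transforms of measures\<close>

definition laplace :: "real measure \<Rightarrow> complex \<Rightarrow> complex" where
  "laplace M z = (LINT x:{0..}|M. exp (- z * complex_of_real x))"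

text \<open>Values in \<open>ennreal\<close> turn convergence into finiteness, and product and
  series identities then carry no integrability conditions.\<close>

definition nn_laplace :: "real measure \<Rightarrow> real \<Rightarrow> ennreal" where
  "nn_laplace M s = (\<integral>\<^sup>+x\<in>{0..}. ennreal (exp (- s * x)) \<partial>M)"

text \<open>Mean value inequality on the convex strip |Re u| <= |Re w|, where the derivative of exp
  is at most exp |Re w| in modulus.\<close>

lemma norm_exp_minus_one_le: "norm (exp w - 1) \<le> norm w * exp \<bar>Re w\<bar>" for w :: complex
proof -
  define S where "S = {u. - \<bar>Re w\<bar> \<le> Re u} \<inter> {u. Re u \<le> \<bar>Re w\<bar>}"
  have "norm (exp w - exp 0) \<le> exp \<bar>Re w\<bar> * norm (w - 0)"
  proof (rule field_differentiable_bound[where S=S and f'=exp])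
    show "convex S" unfolding S_def by (intro convex_Int convex_halfspace_Re_ge convex_halfspace_Re_le)
    show "(exp has_field_derivative exp z) (at z within S)" for z :: complex
      by (rule has_field_derivative_at_within) (rule DERIV_exp)
  qed (auto simp: S_def norm_exp_eq_Re)
  then show ?thesis by (simp add: mult.commute)
qed

lemma locally_finite_measureD:
  assumes "locally_finite_measure M"
  shows "sets M = sets borel" "space M = UNIV" "AE x in M. 0 \<le> x" "\<And>t. emeasure M {0..t} < \<infinity>"
proof -
  show s: "sets M = sets borel" using assms by (simp add: locally_finite_measure_def)
  then show "space M = UNIV" using sets_eq_imp_space_eq by fastforce
  show "AE x in M. 0 \<le> x"
    by (rule AE_I[of _ _ "{..<0}"]) (use assms s in \<open>auto simp: locally_finite_measure_def not_le\<close>)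
qed (use assms in \<open>auto simp: locally_finite_measure_def\<close>)

lemma locally_finite_measure_sigma_finite:
  assumes "locally_finite_measure M"
  shows "sigma_finite_measure M"
proof
  note M = locally_finite_measureD[OF assms]
  define A where "A = insert {..<0::real} (range (\<lambda>n. {0..real n}))"
  have "\<Union> A = UNIV"
  proof -
    have "x \<in> \<Union> A" for x
      using real_arch_simple[of x] by (cases "x < 0") (auto simp: A_def not_less)
    then show ?thesis by blast
  qed
  moreover have "\<forall>a\<in>A. emeasure M a \<noteq> \<infinity>"
    using assms unfolding A_def locally_finite_measure_def by (auto simp: less_top[symmetric])
  ultimately show "\<exists>A. countable A \<and> A \<subseteq> sets M \<and> \<Union> A = space M \<and> (\<forall>a\<in>A. emeasure M a \<noteq> \<infinity>)"
    using M by (intro exI[of _ A]) (auto simp: A_def)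
qed

lemma nn_laplace_eq:
  assumes "locally_finite_measure M"
  shows "nn_laplace M s = (\<integral>\<^sup>+x. ennreal (exp (- s * x)) \<partial>M)"
  unfolding nn_laplace_def
  by (rule nn_integral_cong_AE, use locally_finite_measureD(3)[OF assms] in eventually_elim) auto

lemma laplace_eq:
  assumes "locally_finite_measure M"
  shows "laplace M z = (LINT x|M. exp (- z * complex_of_real x))"
  unfolding laplace_def set_lebesgue_integral_def
proof (rule integral_cong_AE)
  note [measurable_cong] = locally_finite_measureD(1)[OF assms]
  show "(\<lambda>x. indicat_real {0..} x *\<^sub>R exp (- z * complex_of_real x)) \<in> borel_measurable M" by measurable
  show "(\<lambda>x. exp (- z * complex_of_real x)) \<in> borel_measurable M" by measurable
qed (use locally_finite_measureD(3)[OF assms] in eventually_elim, auto)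

lemma locally_finite_measureI_nn_laplace:
  assumes "sets M = sets borel" "emeasure M {..<0} = 0" "nn_laplace M s < \<infinity>"
  shows "locally_finite_measure M"
  unfolding locally_finite_measure_def
proof (intro conjI allI assms)
  fix t :: real
  note [measurable_cong] = assms(1)
  \<comment> \<open>On \<open>{0..t}\<close> the weight exp(-s x) is at least 1/c, whatever the sign
    of \<open>s\<close>.\<close>
  define c where "c = exp (\<bar>s\<bar> * \<bar>t\<bar>)"
  have "emeasure M {0..t} = (\<integral>\<^sup>+x. indicator {0..t} x \<partial>M)" using assms(1) by simp
  also have "\<dots> \<le> (\<integral>\<^sup>+x. ennreal c * (ennreal (exp (- s * x)) * indicator {0..} x) \<partial>M)"
  proof (intro nn_integral_mono)
    fix x :: real
    have "1 \<le> c * exp (- s * x)" if "0 \<le> x" "x \<le> t"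
    proof -
      have "s * x \<le> \<bar>s\<bar> * \<bar>t\<bar>" using that by (intro mult_mono) auto
      then show ?thesis by (simp add: c_def exp_add[symmetric])
    qed
    then show "indicator {0..t} x \<le> ennreal c * (ennreal (exp (- s * x)) * indicator {0..} x)"
      by (auto simp: indicator_def ennreal_mult[symmetric] c_def)
  qed
  also have "\<dots> = ennreal c * nn_laplace M s"
    unfolding nn_laplace_def by (rule nn_integral_cmult) measurable
  also have "\<dots> < \<infinity>" using assms(3) by (simp add: ennreal_mult_less_top)
  finally show "emeasure M {0..t} < \<infinity>" .
qed

lemma nn_laplace_antimono: "s \<le> s' \<Longrightarrow> nn_laplace M s' \<le> nn_laplace M s"
  unfolding nn_laplace_def
  by (intro nn_integral_mono) (auto simp: indicator_def mult_right_mono intro!: ennreal_leI)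

context
  fixes M :: "real measure" and a :: real
  assumes M: "locally_finite_measure M" and a: "nn_laplace M a < \<infinity>"
begin

lemma laplace_measurable [measurable_cong]: "sets M = sets borel"
  using locally_finite_measureD(1)[OF M] .

lemma integrable_exp:
  assumes "a \<le> s"
  shows "integrable M (\<lambda>x. exp (- s * x))"
proof (rule integrableI_nonneg)
  have "nn_laplace M s < \<infinity>" using nn_laplace_antimono[OF assms, of M] a by (rule order.strict_trans1)
  then show "(\<integral>\<^sup>+x. ennreal (exp (- s * x)) \<partial>M) < \<infinity>" by (simp add: nn_laplace_eq[OF M])
qed auto

lemma integrable_cexp:
  assumes "a \<le> Re z"
  shows "integrable M (\<lambda>x. exp (- z * complex_of_real x))"
  by (rule Bochner_Integration.integrable_bound[OF integrable_exp[OF assms]])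
     (auto simp: norm_exp_eq_Re)

lemma nn_laplace_ennreal: "a \<le> s \<Longrightarrow> nn_laplace M s = ennreal (LINT x|M. exp (- s * x))"
  unfolding nn_laplace_eq[OF M] using integrable_exp by (intro nn_integral_eq_integral) auto

lemma laplace_of_real: "a \<le> s \<Longrightarrow> laplace M (of_real s) = of_real (enn2real (nn_laplace M s))"
proof -
  assume "a \<le> s"
  then have "enn2real (nn_laplace M s) = (LINT x|M. exp (- s * x))"
    by (simp add: nn_laplace_ennreal integral_nonneg_AE)
  moreover have "exp (- complex_of_real s * complex_of_real x) = of_real (exp (- s * x))" for x
    by (simp add: exp_of_real[symmetric])
  ultimately show ?thesis by (simp add: laplace_eq[OF M])
qed

lemma norm_laplace_le: "a \<le> Re z \<Longrightarrow> norm (laplace M z) \<le> enn2real (nn_laplace M (Re z))"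
proof -
  assume z: "a \<le> Re z"
  have "norm (laplace M z) \<le> (LINT x|M. norm (exp (- z * complex_of_real x)))"
    unfolding laplace_eq[OF M] by (rule integral_norm_bound)
  also have "\<dots> = (LINT x|M. exp (- Re z * x))" by (simp add: norm_exp_eq_Re)
  also have "\<dots> = enn2real (nn_laplace M (Re z))"
    using z by (simp add: nn_laplace_ennreal integral_nonneg_AE)
  finally show ?thesis .
qed

lemma laplace_has_field_derivative:
  assumes z: "a < Re z"
  shows "(laplace M has_field_derivative (LINT x|M. - of_real x * exp (- z * complex_of_real x))) (at z)"
  unfolding has_field_derivative_iff tendsto_at_iff_sequentially comp_def
proof (intro allI impI)
  fix X assume X: "\<forall>i. X i \<in> UNIV - {z}" "X \<longlonglongrightarrow> z"
  \<comment> \<open>Half the distance to the abscissa \<open>a\<close> is spent twice: one factor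
    exp(\<delta> x) pays for moving by |h| < \<delta>, the other for the factor x produced by the
    derivative. Together they turn exp(-Re z x) into exp(-a x).\<close>
  define \<delta> where "\<delta> = (Re z - a) / 2"
  have \<delta>: "\<delta> > 0" "2 * \<delta> = Re z - a" using z by (auto simp: \<delta>_def)
  obtain N where N: "\<And>n. n \<ge> N \<Longrightarrow> norm (X n - z) < \<delta>"
    using LIMSEQ_D[OF X(2) \<delta>(1)] by blast
  \<comment> \<open>The offset \<open>N\<close> makes the majorant valid for every \<open>n\<close>;
    \<open>LIMSEQ_offset\<close> removes it at the end.\<close>
  define q where "q n x = (exp (- X (n + N) * complex_of_real x) - exp (- z * complex_of_real x)) / (X (n + N) - z)"
    for n and x :: real
  have q_bound: "norm (q n x) \<le> exp (- a * x) / \<delta>" if x: "0 \<le> x" for n x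
  proof -
    define h where "h = X (n + N) - z"
    have h: "h \<noteq> 0" "norm h < \<delta>" using X(1) N[of "n + N"] by (auto simp: h_def)
    have "q n x = exp (- z * complex_of_real x) * (exp (- h * of_real x) - 1) / h"
      by (simp add: q_def h_def right_diff_distrib exp_add[symmetric] algebra_simps)
    then have "norm (q n x) = exp (- Re z * x) * norm (exp (- h * of_real x) - 1) / norm h"
      by (simp add: norm_mult norm_divide norm_exp_eq_Re)
    also have "\<dots> \<le> exp (- Re z * x) * (norm h * x * exp (\<delta> * x)) / norm h"
    proof (intro divide_right_mono mult_left_mono)
      have "norm (exp (- h * of_real x) - 1) \<le> norm h * x * exp \<bar>Re (- h * of_real x)\<bar>"
        using norm_exp_minus_one_le[of "- h * of_real x"] x by (simp add: norm_mult)
      also have "\<bar>Re (- h * of_real x)\<bar> \<le> \<delta> * x"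
        using x h abs_Re_le_cmod[of h] by (simp add: abs_mult mult_right_mono)
      finally show "norm (exp (- h * of_real x) - 1) \<le> norm h * x * exp (\<delta> * x)"
        using x by (simp add: mult_left_mono)
    qed auto
    also have "\<dots> = exp (- Re z * x) * exp (\<delta> * x) * x" using h(1) by simp
    also have "\<dots> \<le> exp (- Re z * x) * exp (\<delta> * x) * (exp (\<delta> * x) / \<delta>)"
    proof (intro mult_left_mono)
      have "\<delta> * x \<le> exp (\<delta> * x)" using exp_ge_add_one_self[of "\<delta> * x"] by linarith
      then show "x \<le> exp (\<delta> * x) / \<delta>" using \<delta> by (simp add: field_simps)
    qed auto
    also have "\<dots> = exp (- a * x) / \<delta>"
    proof -
      have "- Re z * x + \<delta> * x + \<delta> * x = - a * x"
      proof -
        have "- Re z * x + \<delta> * x + \<delta> * x = (2 * \<delta> - Re z) * x" by (simp add: algebra_simps)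
        then show ?thesis using \<delta>(2) by simp
      qed
      then show ?thesis by (simp add: exp_add[symmetric])
    qed
    finally show ?thesis .
  qed
  have "(\<lambda>n. LINT x|M. q n x) \<longlonglongrightarrow> (LINT x|M. - of_real x * exp (- z * complex_of_real x))"
  proof (rule integral_dominated_convergence[where w="\<lambda>x. exp (- a * x) / \<delta>"])
    show "integrable M (\<lambda>x. exp (- a * x) / \<delta>)" by (intro integrable_divide integrable_exp) auto
    show "AE x in M. norm (q n x) \<le> exp (- a * x) / \<delta>" for n
      using locally_finite_measureD(3)[OF M] by eventually_elim (rule q_bound)
    show "AE x in M. (\<lambda>n. q n x) \<longlonglongrightarrow> - of_real x * exp (- z * complex_of_real x)"
    proof (rule AE_I2)
      fix x
      have "((\<lambda>w. exp (- w * complex_of_real x)) has_field_derivative - of_real x * exp (- z * complex_of_real x)) (at z)"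
        by (auto intro!: derivative_eq_intros)
      then have "(\<lambda>n. (exp (- X n * complex_of_real x) - exp (- z * complex_of_real x)) / (X n - z))
          \<longlonglongrightarrow> - of_real x * exp (- z * complex_of_real x)"
        using X unfolding has_field_derivative_iff tendsto_at_iff_sequentially comp_def by blast
      from LIMSEQ_ignore_initial_segment[OF this, of N]
      show "(\<lambda>n. q n x) \<longlonglongrightarrow> - of_real x * exp (- z * complex_of_real x)" by (simp add: q_def)
    qed
  qed (unfold q_def, measurable)
  moreover have "(LINT x|M. q n x) = (laplace M (X (n + N)) - laplace M z) / (X (n + N) - z)" for n
  proof -
    have "a \<le> Re (X (n + N))"
      using N[of "n + N"] \<delta> abs_Re_le_cmod[of "X (n + N) - z"] by simp
    then show ?thesis
      unfolding q_def laplace_eq[OF M] integral_divide_zero using z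
      by (subst Bochner_Integration.integral_diff) (rule integrable_cexp, simp | simp)+
  qed
  ultimately have "(\<lambda>n. (laplace M (X (n + N)) - laplace M z) / (X (n + N) - z)) \<longlonglongrightarrow>
      (LINT x|M. - of_real x * exp (- z * complex_of_real x))" by simp
  then show "(\<lambda>n. (laplace M (X n) - laplace M z) / (X n - z)) \<longlonglongrightarrow>
      (LINT x|M. - of_real x * exp (- z * complex_of_real x))" by (rule LIMSEQ_offset)
qed

lemma holomorphic_laplace: "laplace M holomorphic_on {z. a < Re z}"
  unfolding holomorphic_on_def field_differentiable_def
  using laplace_has_field_derivative has_field_derivative_at_within by blast

text \<open>On [0, \<infinity>) the exponentials tend to the indicator of {0}. This links the
  transform far to the right with the matrix of atoms whose spectral radius is controlled.\<close>

lemma nn_laplace_tendsto_atom: "((\<lambda>s. enn2real (nn_laplace M s)) \<longlongrightarrow> measure M {0}) at_top"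
proof -
  have "((\<lambda>s. LINT x|M. exp (- s * x)) \<longlongrightarrow> (LINT x|M. indicator {0} x)) at_top"
  proof (rule integral_dominated_convergence_at_top[where w="\<lambda>x. exp (- a * x)"])
    show "integrable M (\<lambda>x. exp (- a * x))" by (rule integrable_exp) simp
    show "AE x in M. ((\<lambda>s. exp (- s * x)) \<longlongrightarrow> indicator {0} x) at_top"
      using locally_finite_measureD(3)[OF M]
    proof eventually_elim
      case (elim x)
      show ?case
      proof (cases "x = 0")
        case False
        then have "x > 0" using elim by simp
        then have "((\<lambda>s. exp (- s * x)) \<longlongrightarrow> 0) at_top" by real_asymp
        then show ?thesis using False by simp
      qed simp
    qed
    show "\<forall>\<^sub>F s in at_top. AE x in M. norm (exp (- s * x)) \<le> exp (- a * x)"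
      using eventually_ge_at_top[of a]
    proof eventually_elim
      case (elim s)
      show ?case using locally_finite_measureD(3)[OF M] by eventually_elim (simp add: elim mult_right_mono)
    qed
  qed measurable
  moreover have "(LINT x|M. indicator {0} x) = measure M {0}" by (simp add: locally_finite_measureD(2)[OF M])
  moreover have "\<forall>\<^sub>F s in at_top. (LINT x|M. exp (- s * x)) = enn2real (nn_laplace M s)"
    using eventually_ge_at_top[of a] by eventually_elim (simp add: nn_laplace_ennreal integral_nonneg_AE)
  ultimately show ?thesis using tendsto_cong by force
qed

lemma integrable_ramp: "integrable M (\<lambda>x. max 0 (t - x))"
proof (rule Bochner_Integration.integrable_bound)
  show "integrable M (\<lambda>x. \<bar>t\<bar> * indicat_real {0..t} x)"
    using locally_finite_measureD(4)[OF M, of t] laplace_measurable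
    by (intro integrable_mult_right integrable_real_indicator) (auto simp: less_top)
  show "AE x in M. norm (max 0 (t - x)) \<le> norm (\<bar>t\<bar> * indicat_real {0..t} x)"
    using locally_finite_measureD(3)[OF M] by eventually_elim (auto simp: indicator_def)
qed measurable

text \<open>On [0, \<infinity>) the quotients of the ramp are piecewise linear cutoffs: the backward
  one reaches 0 at t and lies below the indicator of \<open>{0..t}\<close>; the forward one is still
  1 at t and lies above it.\<close>

lemma measure_between_ramp_quotients:
  assumes \<epsilon>: "\<epsilon> > 0"
  shows "((LINT x|M. max 0 (t - x)) - (LINT x|M. max 0 (t - \<epsilon> - x))) / \<epsilon> \<le> measure M {0..t}"
    and "measure M {0..t} \<le> ((LINT x|M. max 0 (t + \<epsilon> - x)) - (LINT x|M. max 0 (t - x))) / \<epsilon>"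
proof -
  have int: "integrable M (indicat_real {0..t})"
    using locally_finite_measureD(4)[OF M, of t] laplace_measurable
    by (intro integrable_real_indicator) (auto simp: less_top)
  have int2: "integrable M (\<lambda>x. (max 0 (u - x) - max 0 (v - x)) / \<epsilon>)" for u v
    by (intro integrable_divide Bochner_Integration.integrable_diff integrable_ramp)
  have eq: "measure M {0..t} = (LINT x|M. indicat_real {0..t} x)"
    by (simp add: locally_finite_measureD(2)[OF M])
  have "((LINT x|M. max 0 (t - x)) - (LINT x|M. max 0 (t - \<epsilon> - x))) / \<epsilon> =
      (LINT x|M. (max 0 (t - x) - max 0 (t - \<epsilon> - x)) / \<epsilon>)"
    by (simp add: integrable_ramp)
  also have "\<dots> \<le> (LINT x|M. indicat_real {0..t} x)"
  proof (rule integral_mono_AE)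
    have "max 0 (t - x) - max 0 (t - \<epsilon> - x) \<le> \<epsilon> * indicat_real {0..t} x" if "0 \<le> x" for x
      using that \<epsilon> by (cases "x \<le> t") (simp_all add: max_def)
    then show "AE x in M. (max 0 (t - x) - max 0 (t - \<epsilon> - x)) / \<epsilon> \<le> indicat_real {0..t} x"
      using locally_finite_measureD(3)[OF M] \<epsilon>
      by (auto elim!: eventually_mono simp: pos_divide_le_eq mult.commute)
  qed (rule int int2)+
  finally show "((LINT x|M. max 0 (t - x)) - (LINT x|M. max 0 (t - \<epsilon> - x))) / \<epsilon> \<le> measure M {0..t}"
    unfolding eq .
  have "(LINT x|M. indicat_real {0..t} x) \<le> (LINT x|M. (max 0 (t + \<epsilon> - x) - max 0 (t - x)) / \<epsilon>)"
  proof (rule integral_mono_AE)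
    have "\<epsilon> * indicat_real {0..t} x \<le> max 0 (t + \<epsilon> - x) - max 0 (t - x)" if "0 \<le> x" for x
      using that \<epsilon> by (cases "x \<le> t") (simp_all add: max_def)
    then show "AE x in M. indicat_real {0..t} x \<le> (max 0 (t + \<epsilon> - x) - max 0 (t - x)) / \<epsilon>"
      using locally_finite_measureD(3)[OF M] \<epsilon>
      by (auto elim!: eventually_mono simp: pos_le_divide_eq mult.commute)
  qed (rule int int2)+
  also have "\<dots> = ((LINT x|M. max 0 (t + \<epsilon> - x)) - (LINT x|M. max 0 (t - x))) / \<epsilon>"
    by (simp add: integrable_ramp)
  finally show "measure M {0..t} \<le> ((LINT x|M. max 0 (t + \<epsilon> - x)) - (LINT x|M. max 0 (t - x))) / \<epsilon>"
    unfolding eq .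
qed

text \<open>Integrating \<open>inverse_laplace_inverse_square\<close> at t - x against
  \<open>M\<close> and swapping by Fubini. The modulus of the kernel is a product of exp(-\<sigma>
  x), integrable for \<open>M\<close>, and 1/(\<sigma>^2 + y^2), integrable on the line.\<close>

theorem ramp_integral_inversion:
  assumes \<sigma>: "\<sigma> > 0" "a \<le> \<sigma>"
  shows "2 * pi * complex_of_real (LINT x|M. max 0 (t - x)) =
    (LINT y|lborel. exp (Complex \<sigma> y * of_real t) * laplace M (Complex \<sigma> y) / (Complex \<sigma> y)\<^sup>2)"
proof -
  interpret M: sigma_finite_measure M by (rule locally_finite_measure_sigma_finite[OF M])
  interpret pair_sigma_finite M lborel ..
  define f where "f x y = exp (Complex \<sigma> y * of_real (t - x)) / (Complex \<sigma> y)\<^sup>2" for x y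
  have f_meas [measurable]: "case_prod f \<in> borel_measurable (M \<Otimes>\<^sub>M lborel)"
  proof -
    have "continuous_on UNIV (\<lambda>p. f (fst p) (snd p))"
      unfolding f_def using \<sigma> by (intro continuous_intros continuous_on_Complex) (simp add: Complex_eq_0)
    from borel_measurable_continuous_onI[OF this]
    have "case_prod f \<in> borel_measurable (borel \<Otimes>\<^sub>M borel)" by (simp add: borel_prod case_prod_beta')
    then show ?thesis by (simp cong: measurable_cong_sets sets_pair_measure_cong add: laplace_measurable)
  qed
  have norm_f: "norm (f x y) = exp (\<sigma> * t) * exp (- \<sigma> * x) * (1 / (\<sigma>\<^sup>2 + y\<^sup>2))" for x y
    by (simp add: f_def norm_divide norm_power norm_exp_eq_Re cmod_power2 exp_add[symmetric] algebra_simps)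
  have int_y: "integrable lborel (f x)" for x
  proof (rule integrable_quadratic_decay[where T=1 and C="exp (\<sigma> * t) * exp (- \<sigma> * x)"])
    show "continuous_on UNIV (f x)"
      unfolding f_def using \<sigma> by (intro continuous_intros continuous_on_Complex) (simp add: Complex_eq_0)
    show "norm (f x y) \<le> exp (\<sigma> * t) * exp (- \<sigma> * x) / y\<^sup>2" if "1 \<le> \<bar>y\<bar>" for y
      unfolding norm_f times_divide_eq_right mult_1_right using that
      by (intro divide_left_mono) (auto simp: zero_less_mult_iff intro!: add_nonneg_pos)
  qed
  have int: "integrable (M \<Otimes>\<^sub>M lborel) (case_prod f)"
  proof (rule Fubini_integrable)
    have "(\<lambda>x. LINT y|lborel. norm (case_prod f (x, y))) =
        (\<lambda>x. exp (- \<sigma> * x) * (exp (\<sigma> * t) * (LINT y|lborel. 1 / (\<sigma>\<^sup>2 + y\<^sup>2))))"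
      unfolding case_prod_conv norm_f integral_mult_right_zero by (simp add: mult_ac)
    then show "integrable M (\<lambda>x. LINT y|lborel. norm (case_prod f (x, y)))"
      using \<sigma> by (simp only:) (intro integrable_mult_left integrable_exp)
  qed (use int_y in auto)
  have "2 * pi * complex_of_real (LINT x|M. max 0 (t - x)) = (LINT x|M. (LINT y|lborel. f x y))"
    unfolding f_def inverse_laplace_inverse_square[OF \<sigma>(1)]
    by (simp flip: integral_complex_of_real)
  also have "\<dots> = (LINT y|lborel. (LINT x|M. f x y))" by (rule Fubini_integral[OF int, symmetric])
  also have "\<dots> = (LINT y|lborel. exp (Complex \<sigma> y * of_real t) * laplace M (Complex \<sigma> y) / (Complex \<sigma> y)\<^sup>2)"
  proof (rule Bochner_Integration.integral_cong[OF refl])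
    fix y
    have "f x y = exp (Complex \<sigma> y * of_real t) / (Complex \<sigma> y)\<^sup>2 * exp (- Complex \<sigma> y * of_real x)" for x
      by (simp add: f_def exp_diff exp_minus field_simps)
    then show "(LINT x|M. f x y) = exp (Complex \<sigma> y * of_real t) * laplace M (Complex \<sigma> y) / (Complex \<sigma> y)\<^sup>2"
      by (simp add: laplace_eq[OF M])
  qed
  finally show ?thesis .
qed

end

subsection \<open>Exponential polynomials\<close>

lemma higher_deriv_exp_mult: "(deriv ^^ i) (\<lambda>z::complex. exp (z * t)) = (\<lambda>z. t ^ i * exp (z * t))"
proof (induction i)
  case (Suc i)
  have "deriv (\<lambda>z. t ^ i * exp (z * t)) z = t ^ Suc i * exp (z * t)" for z
    by (rule DERIV_imp_deriv) (auto intro!: derivative_eq_intros)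
  then show ?case using Suc by auto
qed auto

text \<open>For \<open>m = Suc n\<close> the residue is the n-th derivative of exp(z t) g(z) at
  \<rho>, divided by n!. Leibniz' rule separates the powers of \<open>t\<close> from coefficients
  that do not depend on \<open>t\<close>.\<close>

lemma residue_exp_over_power:
  fixes g :: "complex \<Rightarrow> complex"
  assumes "open S" "\<rho> \<in> S" "g holomorphic_on S"
  shows "\<exists>c. \<forall>t. residue (\<lambda>z. exp (z * t) * g z / (z - \<rho>) ^ m) \<rho> = exp (\<rho> * t) * (\<Sum>k<m. t ^ k * c k)"
proof (cases m)
  case 0
  have "residue (\<lambda>z. exp (z * t) * g z) \<rho> = 0" for t
    by (rule residue_holo[OF assms(1,2)]) (intro holomorphic_intros assms)
  then show ?thesis using 0 by simp
next
  case (Suc n)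
  define c where "c k = of_nat (n choose k) * (deriv ^^ (n - k)) g \<rho> / fact n" for k
  have "residue (\<lambda>z. exp (z * t) * g z / (z - \<rho>) ^ m) \<rho> = exp (\<rho> * t) * (\<Sum>k<m. t ^ k * c k)" for t
  proof -
    have holo: "(\<lambda>z. exp (z * t)) holomorphic_on S" by (intro holomorphic_intros)
    have "residue (\<lambda>z. exp (z * t) * g z / (z - \<rho>) ^ m) \<rho> = (deriv ^^ n) (\<lambda>z. exp (z * t) * g z) \<rho> / fact n"
      unfolding Suc by (rule residue_holomorphic_over_power[OF assms(1,2)]) (intro holomorphic_intros assms)
    also have "\<dots> = (\<Sum>i = 0..n. of_nat (n choose i) * (t ^ i * exp (\<rho> * t)) * (deriv ^^ (n - i)) g \<rho>) / fact n"
      by (simp add: higher_deriv_mult[OF holo assms(3,1,2)] higher_deriv_exp_mult)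
    also have "\<dots> = exp (\<rho> * t) * (\<Sum>k<m. t ^ k * c k)"
      unfolding Suc lessThan_Suc_atMost atLeast0AtMost sum_distrib_left sum_divide_distrib
      by (intro sum.cong) (auto simp: c_def)
    finally show ?thesis .
  qed
  then show ?thesis by blast
qed

text \<open>The number of coefficients is kept, and the last new one is \<rho> times the last old
  one. Hence it vanishes for \<rho> = 0, and the degree drops there; the treatment of the pole at 0
  depends on this.\<close>

lemma exp_poly_has_field_derivative:
  fixes c :: "nat \<Rightarrow> complex"
  shows "((\<lambda>w. exp (\<rho> * w) * (\<Sum>k<m. w ^ k * c k)) has_field_derivative
    exp (\<rho> * w) * (\<Sum>k<m. w ^ k * (\<rho> * c k + (if Suc k < m then of_nat (Suc k) * c (Suc k) else 0)))) (at w)"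
proof -
  have "((\<lambda>w. \<Sum>k<m. w ^ k * c k) has_field_derivative (\<Sum>k<m. of_nat k * w ^ (k - 1) * c k)) (at w)"
    by (auto intro!: derivative_eq_intros sum.cong)
  moreover have "(\<Sum>k<m. of_nat k * w ^ (k - 1) * c k) = (\<Sum>k<m. w ^ k * (if Suc k < m then of_nat (Suc k) * c (Suc k) else 0))"
  proof (cases m)
    case (Suc n)
    have "(\<Sum>k<Suc n. of_nat k * w ^ (k - 1) * c k) = (\<Sum>k<n. of_nat (Suc k) * w ^ k * c (Suc k))"
      unfolding sum.lessThan_Suc_shift by simp
    also have "\<dots> = (\<Sum>k<Suc n. w ^ k * (if Suc k < Suc n then of_nat (Suc k) * c (Suc k) else 0))"
      by (simp add: mult_ac)
    finally show ?thesis using Suc by simp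
  qed auto
  ultimately have "((\<lambda>w. exp (\<rho> * w) * (\<Sum>k<m. w ^ k * c k)) has_field_derivative
      exp (\<rho> * w) * (\<Sum>k<m. w ^ k * (if Suc k < m then of_nat (Suc k) * c (Suc k) else 0)) +
      \<rho> * exp (\<rho> * w) * (\<Sum>k<m. w ^ k * c k)) (at w)"
    by (auto intro!: derivative_eq_intros)
  then show ?thesis
    by (simp add: distrib_left sum.distrib sum_distrib_left mult_ac add_ac)
qed

text \<open>The bound is stated for complex \<open>w\<close>, since Cauchy's inequality will be
  applied on circles that leave the real line. In \<open>b\<close> the summand 1 absorbs the powers
  of w through r^k <= k! e^r.\<close>

lemma exp_poly_growth:
  fixes c :: "complex \<Rightarrow> nat \<Rightarrow> complex"
  assumes "finite P"
  obtains K b where "K \<ge> 0" "b \<ge> 0"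
    "\<And>w. norm (\<Sum>\<rho>\<in>P. exp (\<rho> * w) * (\<Sum>k<m \<rho>. w ^ k * c \<rho> k)) \<le> K * exp (b * norm w)"
proof -
  obtain R where R: "\<And>\<rho>. \<rho> \<in> P \<Longrightarrow> norm \<rho> \<le> R"
    using finite_imp_bounded[OF assms] by (auto simp: bounded_iff)
  define b where "b = \<bar>R\<bar> + 1"
  define K where "K = (\<Sum>\<rho>\<in>P. \<Sum>k<m \<rho>. fact k * norm (c \<rho> k))"
  have pow: "r ^ k \<le> fact k * exp r" if "0 \<le> r" for r :: real and k
  proof -
    have "r ^ k / fact k \<le> (\<Sum>n. r ^ n / fact n)"
      using that summable_exp_generic[of r]
      by (intro order_trans[OF _ sum_le_suminf[where I="{k}"]]) (auto simp: divide_inverse mult_ac)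
    then show ?thesis by (simp add: exp_def field_simps)
  qed
  have "norm (\<Sum>\<rho>\<in>P. exp (\<rho> * w) * (\<Sum>k<m \<rho>. w ^ k * c \<rho> k)) \<le> K * exp (b * norm w)" for w
  proof -
    have "norm (\<Sum>\<rho>\<in>P. exp (\<rho> * w) * (\<Sum>k<m \<rho>. w ^ k * c \<rho> k))
        \<le> (\<Sum>\<rho>\<in>P. exp (\<bar>R\<bar> * norm w) * (\<Sum>k<m \<rho>. fact k * exp (norm w) * norm (c \<rho> k)))"
    proof (rule sum_norm_le)
      fix \<rho> assume \<rho>: "\<rho> \<in> P"
      have "norm (exp (\<rho> * w)) \<le> exp (\<bar>R\<bar> * norm w)"
      proof -
        have "Re (\<rho> * w) \<le> norm (\<rho> * w)" by (rule complex_Re_le_cmod)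
        also have "\<dots> \<le> \<bar>R\<bar> * norm w" using R[OF \<rho>] by (simp add: norm_mult mult_right_mono)
        finally show ?thesis by (simp add: norm_exp_eq_Re)
      qed
      moreover have "norm (\<Sum>k<m \<rho>. w ^ k * c \<rho> k) \<le> (\<Sum>k<m \<rho>. fact k * exp (norm w) * norm (c \<rho> k))"
        by (intro sum_norm_le) (auto simp: norm_mult norm_power intro!: mult_right_mono pow)
      ultimately show "norm (exp (\<rho> * w) * (\<Sum>k<m \<rho>. w ^ k * c \<rho> k))
          \<le> exp (\<bar>R\<bar> * norm w) * (\<Sum>k<m \<rho>. fact k * exp (norm w) * norm (c \<rho> k))"
        unfolding norm_mult by (intro mult_mono) auto
    qed
    also have "\<dots> = K * exp (b * norm w)"
    proof -
      have "exp (b * norm w) = exp (\<bar>R\<bar> * norm w) * exp (norm w)"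
        by (simp add: b_def exp_add[symmetric] algebra_simps)
      then show ?thesis by (simp add: K_def sum_distrib_left sum_distrib_right mult_ac)
    qed
    finally show ?thesis .
  qed
  moreover have "K \<ge> 0" "b \<ge> 0" by (auto simp: K_def b_def intro!: sum_nonneg)
  ultimately show ?thesis using that by blast
qed

text \<open>Taylor's formula, with the second derivative bounded by Cauchy's inequality on unit
  circles around points of \<open>cball w 1\<close>. The two unit steps give
  \<open>norm w + 2\<close>, and the factor 2 is 2!.\<close>

lemma entire_first_order_remainder:
  fixes f :: "complex \<Rightarrow> complex"
  assumes f: "\<And>w. (f has_field_derivative f' w) (at w)"
    and growth: "\<And>w. norm (f w) \<le> K * exp (b * norm w)" and "b \<ge> 0" "K \<ge> 0"
    and h: "norm h \<le> 1"
  shows "norm (f (w + h) - f w - h * f' w) \<le> 2 * K * exp (b * (norm w + 2)) * (norm h)\<^sup>2"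
proof -
  have holo: "f holomorphic_on UNIV"
    using f by (auto simp: holomorphic_on_def field_differentiable_def intro: has_field_derivative_at_within)
  have d1: "deriv f = f'" using f by (auto intro: DERIV_imp_deriv)
  define F where "F i = (deriv ^^ i) f" for i :: nat
  have "norm (F 0 (w + h) - (\<Sum>i\<le>1. F i w * (w + h - w) ^ i / fact i))
      \<le> 2 * K * exp (b * (norm w + 2)) * norm (w + h - w) ^ Suc 1 / fact 1"
  proof (rule complex_Taylor[where S="cball w 1"])
    fix i x
    have "(deriv ^^ i) f holomorphic_on UNIV" by (rule holomorphic_higher_deriv[OF holo]) auto
    then show "(F i has_field_derivative F (Suc i) x) (at x within cball w 1)"
      unfolding F_def using holomorphic_derivI[of "(deriv ^^ i) f" UNIV x]
      by (auto intro: has_field_derivative_at_within)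
  next
    fix x assume x: "x \<in> cball w 1"
    have "norm ((deriv ^^ 2) f x) \<le> fact 2 * (K * exp (b * (norm w + 2))) / 1 ^ 2"
    proof (rule Cauchy_inequality)
      show "f holomorphic_on ball x 1" "continuous_on (cball x 1) f"
        using holo by (auto intro: holomorphic_on_subset holomorphic_on_imp_continuous_on continuous_on_subset)
      show "norm (f y) \<le> K * exp (b * (norm w + 2))" if "norm (x - y) = 1" for y
      proof -
        have "norm (w - x) \<le> 1" using x by (simp add: dist_norm)
        moreover have "norm y \<le> norm w + norm (w - x) + norm (x - y)" by norm
        ultimately have "norm y \<le> norm w + 2" using that by simp
        then have "K * exp (b * norm y) \<le> K * exp (b * (norm w + 2))"
          using assms by (intro mult_left_mono) (auto intro: mult_left_mono)
        then show ?thesis using growth[of y] by simp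
      qed
    qed auto
    then show "norm (F (Suc 1) x) \<le> 2 * K * exp (b * (norm w + 2))"
      by (simp add: F_def numeral_2_eq_2)
  qed (use h in \<open>auto simp: dist_norm\<close>)
  then show ?thesis by (simp add: F_def d1 power2_eq_square algebra_simps)
qed

section \<open>Increments of the integral over a vertical line\<close>

lemma nn_integral_log_kernel:
  fixes \<epsilon> :: real
  assumes \<epsilon>: "0 < \<epsilon>" "\<epsilon> \<le> 1"
  shows "(\<integral>\<^sup>+y. ennreal (2 * \<epsilon> / (y * (1 + \<epsilon> * y))) * indicator {1..} y \<partial>lborel) \<le> ennreal (2 * \<epsilon> * (1 + ln (1 / \<epsilon>)))"
proof -
  have "(\<integral>\<^sup>+y. ennreal (2 * \<epsilon> / (y * (1 + \<epsilon> * y))) * indicator {1..} y \<partial>lborel) =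
      ennreal (2 * \<epsilon> * ln (1 / \<epsilon>) - 2 * \<epsilon> * ln (1 / (1 + \<epsilon> * 1)))"
  \<comment> \<open>The integrand dominates min(\<epsilon>/y, 1/y^2) and has an elementary
    primitive. Its limit at infinity yields the logarithm, its value at 1 the term 2 \<epsilon> ln(1
    + \<epsilon>) <= 2 \<epsilon>.\<close>
  proof (rule nn_integral_FTC_atLeast[where F="\<lambda>y. 2 * \<epsilon> * ln (y / (1 + \<epsilon> * y))" and a=1])
    show "((\<lambda>y. 2 * \<epsilon> * ln (y / (1 + \<epsilon> * y))) has_real_derivative 2 * \<epsilon> / (y * (1 + \<epsilon> * y))) (at y)"
      if "1 \<le> y" for y
    proof -
      have "0 < 1 + \<epsilon> * y" "0 < y" using that \<epsilon> by (auto intro!: add_pos_pos mult_pos_pos)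
      then show ?thesis
        by (auto intro!: derivative_eq_intros simp: divide_simps)
    qed
    show "0 \<le> 2 * \<epsilon> / (y * (1 + \<epsilon> * y))" if "1 \<le> y" for y
      using that \<epsilon> by (intro divide_nonneg_nonneg mult_nonneg_nonneg add_nonneg_nonneg) auto
    show "((\<lambda>y. 2 * \<epsilon> * ln (y / (1 + \<epsilon> * y))) \<longlongrightarrow> 2 * \<epsilon> * ln (1 / \<epsilon>)) at_top"
    proof -
      have "((\<lambda>y. 2 * \<epsilon> * ln (y / (1 + \<epsilon> * y))) \<longlongrightarrow> 2 * \<epsilon> * ln (inverse \<epsilon>)) at_top"
        using \<epsilon> by real_asymp
      then show ?thesis by (simp add: inverse_eq_divide)
    qed
  qed measurable
  also have "2 * \<epsilon> * ln (1 / \<epsilon>) - 2 * \<epsilon> * ln (1 / (1 + \<epsilon> * 1)) \<le> 2 * \<epsilon> * (1 + ln (1 / \<epsilon>))"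
  proof -
    have "ln (1 + \<epsilon>) \<le> 1" using ln_add_one_self_le_self[of \<epsilon>] \<epsilon> by simp
    then show ?thesis using \<epsilon> by (simp add: ln_div algebra_simps)
  qed
  finally show ?thesis by (simp add: ennreal_leI)
qed

text \<open>Two bounds compete for the numerator: a multiple of |s| |z| and a constant. For small
  |Im z| the inequality |z| >= |Re z| takes the place of |z| >= |Im z|. Both signs of
  \<open>s\<close> occur because the quotients are taken on both sides.\<close>

lemma norm_exp_minus_one_quotient_le:
  fixes z :: complex and s :: real
  assumes s: "s \<noteq> 0" "\<bar>s\<bar> \<le> 1" and z: "Re z \<noteq> 0" and y: "y = Im z"
  shows "norm ((exp (of_real s * z) - 1) / z\<^sup>2) \<le> 2 * exp \<bar>Re z\<bar> *
    (\<bar>s\<bar> / \<bar>Re z\<bar> * indicator {-1..1} y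
      + 2 * \<bar>s\<bar> / (y * (1 + \<bar>s\<bar> * y)) * indicator {1..} y
      + 2 * \<bar>s\<bar> / (- y * (1 + \<bar>s\<bar> * - y)) * indicator {1..} (- y))"
proof -
  define \<epsilon> where "\<epsilon> = \<bar>s\<bar>"
  have \<epsilon>: "0 < \<epsilon>" "\<epsilon> \<le> 1" using s by (auto simp: \<epsilon>_def)
  define r where "r = norm z"
  have r: "\<bar>Re z\<bar> \<le> r" "\<bar>y\<bar> \<le> r" "r > 0"
    using abs_Re_le_cmod[of z] abs_Im_le_cmod[of z] z by (auto simp: r_def y)
  have re: "\<bar>s * Re z\<bar> \<le> \<bar>Re z\<bar>" using s by (simp add: abs_mult mult_left_le_one_le)
  have "norm (exp (of_real s * z) - 1) \<le> \<epsilon> * r * exp \<bar>s * Re z\<bar>"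
    using norm_exp_minus_one_le[of "of_real s * z"] by (simp add: norm_mult \<epsilon>_def r_def)
  also have "\<dots> \<le> \<epsilon> * r * exp \<bar>Re z\<bar>" using re \<epsilon> r by (intro mult_left_mono) auto
  finally have 1: "norm (exp (of_real s * z) - 1) \<le> exp \<bar>Re z\<bar> * (\<epsilon> * r)" by (simp add: mult_ac)
  have "norm (exp (of_real s * z) - 1) \<le> norm (exp (of_real s * z)) + norm (1::complex)"
    by (rule norm_triangle_ineq4)
  also have "norm (exp (of_real s * z)) \<le> exp \<bar>Re z\<bar>" using re by (simp add: norm_exp_eq_Re)
  also have "norm (1::complex) \<le> exp \<bar>Re z\<bar>" by simp
  finally have 2: "norm (exp (of_real s * z) - 1) \<le> 2 * exp \<bar>Re z\<bar>" by simp
  have A: "norm ((exp (of_real s * z) - 1) / z\<^sup>2) \<le> 2 * exp \<bar>Re z\<bar> * (\<epsilon> / r)"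
  proof -
    have "norm (exp (of_real s * z) - 1) / r\<^sup>2 \<le> 2 * (exp \<bar>Re z\<bar> * (\<epsilon> * r)) / r\<^sup>2"
      using order_trans[OF norm_ge_zero 1] by (intro divide_right_mono order_trans[OF 1]) (linarith | simp)+
    also have "\<dots> = 2 * exp \<bar>Re z\<bar> * (\<epsilon> / r)" using r by (simp add: power2_eq_square field_simps)
    finally show ?thesis by (simp add: norm_divide norm_power r_def)
  qed
  have B: "norm ((exp (of_real s * z) - 1) / z\<^sup>2) \<le> 2 * exp \<bar>Re z\<bar> * (1 / r\<^sup>2)"
    using divide_right_mono[OF 2, of "r\<^sup>2"] by (simp add: norm_divide norm_power r_def)
  have C: "norm ((exp (of_real s * z) - 1) / z\<^sup>2) \<le> 2 * exp \<bar>Re z\<bar> * (2 * \<epsilon> / (x * (1 + \<epsilon> * x)))"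
    if x: "x = \<bar>y\<bar>" "1 \<le> x" for x
  \<comment> \<open>Bound \<open>A\<close> is used while \<epsilon> x <= 1 and bound
    \<open>B\<close> beyond; the rational kernel dominates the respective one in each range.\<close>
  proof (cases "\<epsilon> * x \<le> 1")
    case True
    have "\<epsilon> / r \<le> \<epsilon> / x" using r x \<epsilon> by (intro divide_left_mono) auto
    also have "\<dots> \<le> 2 * \<epsilon> / (x * (1 + \<epsilon> * x))"
      using True x \<epsilon> by (simp add: divide_simps add_pos_pos)
    finally show ?thesis by (intro order_trans[OF A] mult_left_mono) auto
  next
    case False
    have "1 / r\<^sup>2 \<le> 1 / x\<^sup>2" using r x by (intro divide_left_mono power_mono) auto
    also have "\<dots> \<le> 2 * \<epsilon> / (x * (1 + \<epsilon> * x))"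
    proof -
      have "x * (1 + \<epsilon> * x) \<le> x * (2 * \<epsilon> * x)" using False x by (intro mult_left_mono) auto
      then have "2 * \<epsilon> / (x * (2 * \<epsilon> * x)) \<le> 2 * \<epsilon> / (x * (1 + \<epsilon> * x))"
        using x(2) \<epsilon> by (intro divide_left_mono) (auto intro!: mult_pos_pos add_pos_pos)
      then show ?thesis using \<epsilon> by (simp add: power2_eq_square)
    qed
    finally show ?thesis by (intro order_trans[OF B] mult_left_mono) auto
  qed
  have nn: "0 \<le> 2 * \<epsilon> / (x * (1 + \<epsilon> * x)) * indicator {1..} x" for x
    using \<epsilon> by (auto simp: indicator_def intro!: divide_nonneg_nonneg mult_nonneg_nonneg add_nonneg_nonneg)
  have nn': "0 \<le> \<epsilon> / \<bar>Re z\<bar> * indicator {-1..1} y" using \<epsilon> by auto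
  consider "\<bar>y\<bar> \<le> 1" | "1 \<le> y" | "1 \<le> - y" by linarith
  then have "norm ((exp (of_real s * z) - 1) / z\<^sup>2) \<le> 2 * exp \<bar>Re z\<bar> *
    (\<epsilon> / \<bar>Re z\<bar> * indicator {-1..1} y
      + 2 * \<epsilon> / (y * (1 + \<epsilon> * y)) * indicator {1..} y
      + 2 * \<epsilon> / (- y * (1 + \<epsilon> * - y)) * indicator {1..} (- y))" (is "_ \<le> _ * (?a + ?b + ?c)")
  proof cases
    assume y: "\<bar>y\<bar> \<le> 1"
    have "\<epsilon> / r \<le> \<epsilon> / \<bar>Re z\<bar>" using r z \<epsilon> by (intro divide_left_mono) auto
    also have "\<dots> = ?a" using y by (simp add: abs_le_iff)
    also have "\<dots> \<le> ?a + ?b + ?c" using nn[of y] nn[of "- y"] by linarith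
    finally show ?thesis by (intro order_trans[OF A] mult_left_mono) auto
  next
    assume y: "1 \<le> y"
    have "2 * \<epsilon> / (y * (1 + \<epsilon> * y)) = ?b" using y by simp
    also have "\<dots> \<le> ?a + ?b + ?c" using nn[of y] nn[of "- y"] nn' by linarith
    finally show ?thesis using y by (intro order_trans[OF C] mult_left_mono) auto
  next
    assume y: "1 \<le> - y"
    have "2 * \<epsilon> / (- y * (1 + \<epsilon> * - y)) = ?c" using y by simp
    also have "\<dots> \<le> ?a + ?b + ?c" using nn[of y] nn[of "- y"] nn' by linarith
    finally show ?thesis using y by (intro order_trans[OF C] mult_left_mono) auto
  qed
  then show ?thesis by (simp add: \<epsilon>_def)
qed

text \<open>In the constant, 2/|\<theta>| comes from the segment |y| <= 1 of length 2, and 4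
  collects two tails of at most 2 |s| (1 + ln(1/|s|)) each.\<close>

lemma vertical_integral_increment:
  fixes h :: "real \<Rightarrow> complex" and \<theta> B :: real
  assumes \<theta>: "\<theta> \<noteq> 0" and h: "continuous_on UNIV h" "\<And>y. norm (h y) \<le> B"
    and s: "s \<noteq> 0" "\<bar>s\<bar> \<le> 1"
  defines "E \<equiv> \<lambda>t. LINT y|lborel. exp (Complex \<theta> y * of_real t) * h y / (Complex \<theta> y)\<^sup>2"
  shows "norm (E (t + s) - E t) \<le> exp (\<theta> * t) * (B * (2 * exp \<bar>\<theta>\<bar> * (2 / \<bar>\<theta>\<bar> + 4))) * (\<bar>s\<bar> * (1 + ln (1 / \<bar>s\<bar>)))"
proof -
  define \<epsilon> where "\<epsilon> = \<bar>s\<bar>"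
  have \<epsilon>: "0 < \<epsilon>" "\<epsilon> \<le> 1" using s by (auto simp: \<epsilon>_def)
  have "B \<ge> 0" using order_trans[OF norm_ge_zero h(2)] .
  have cont: "continuous_on UNIV (\<lambda>y. exp (Complex \<theta> y * of_real u) * h y / (Complex \<theta> y)\<^sup>2)" for u
    using \<theta> by (intro continuous_intros continuous_on_Complex h) (simp add: Complex_eq_0)
  have int: "integrable lborel (\<lambda>y. exp (Complex \<theta> y * of_real u) * h y / (Complex \<theta> y)\<^sup>2)" for u
  proof (rule integrable_quadratic_decay[OF cont, where T=1 and C="exp (\<theta> * u) * B"])
    fix y :: real assume "1 \<le> \<bar>y\<bar>"
    then have "norm (exp (Complex \<theta> y * of_real u) * h y / (Complex \<theta> y)\<^sup>2)
        \<le> norm (exp (Complex \<theta> y * of_real u) * h y) / y\<^sup>2"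
      using norm_vertical_line_ge[of 1 "Complex \<theta> y"] by simp
    also have "\<dots> \<le> exp (\<theta> * u) * B / y\<^sup>2"
      using h(2) by (intro divide_right_mono) (auto simp: norm_mult norm_exp_Complex intro!: mult_left_mono)
    finally show "norm (exp (Complex \<theta> y * of_real u) * h y / (Complex \<theta> y)\<^sup>2) \<le> exp (\<theta> * u) * B / y\<^sup>2" .
  qed
  define D where "D y = exp (Complex \<theta> y * of_real (t + s)) * h y / (Complex \<theta> y)\<^sup>2
      - exp (Complex \<theta> y * of_real t) * h y / (Complex \<theta> y)\<^sup>2" for y
  define A where "A = exp (\<theta> * t) * B * (2 * exp \<bar>\<theta>\<bar>)"
  have "A \<ge> 0" using \<open>B \<ge> 0\<close> by (simp add: A_def)
  define k where "k y = 2 * \<epsilon> / (y * (1 + \<epsilon> * y)) * indicator {1..} y" for y :: real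
  have k_nn: "0 \<le> k y" for y
    using \<epsilon> by (auto simp: k_def indicator_def intro!: divide_nonneg_nonneg mult_nonneg_nonneg add_nonneg_nonneg)
  have [measurable]: "k \<in> borel_measurable borel" unfolding k_def by measurable
  have k_int: "(\<integral>\<^sup>+y. ennreal (k y) \<partial>lborel) \<le> ennreal (2 * \<epsilon> * (1 + ln (1 / \<epsilon>)))"
  proof -
    have "ennreal (k y) = ennreal (2 * \<epsilon> / (y * (1 + \<epsilon> * y))) * indicator {1..} y" for y
      by (simp add: k_def indicator_def)
    then show ?thesis using nn_integral_log_kernel[OF \<epsilon>] by simp
  qed
  have k_int': "(\<integral>\<^sup>+y. ennreal (k (- y)) \<partial>lborel) \<le> ennreal (2 * \<epsilon> * (1 + ln (1 / \<epsilon>)))"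
    using k_int nn_integral_real_affine[of "\<lambda>y. ennreal (k y)" "-1" 0] by simp
  have D_bound: "norm (D y) \<le> A * (\<epsilon> / \<bar>\<theta>\<bar> * indicator {-1..1} y + k y + k (- y))" for y
  proof -
    define z where "z = Complex \<theta> y"
    have "D y = exp (z * of_real t) * h y * ((exp (of_real s * z) - 1) / z\<^sup>2)"
      by (simp add: D_def z_def[symmetric] distrib_left exp_add diff_divide_distrib algebra_simps)
    then have "norm (D y) = norm (exp (z * of_real t)) * norm (h y) * norm ((exp (of_real s * z) - 1) / z\<^sup>2)"
      by (simp only: norm_mult)
    then have "norm (D y) = exp (\<theta> * t) * norm (h y) * norm ((exp (of_real s * z) - 1) / z\<^sup>2)"
      by (simp only: z_def norm_exp_Complex)
    also have "\<dots> \<le> exp (\<theta> * t) * B * (2 * exp \<bar>\<theta>\<bar> * (\<epsilon> / \<bar>\<theta>\<bar> * indicator {-1..1} y + k y + k (- y)))"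
    proof (intro mult_mono)
      show "norm ((exp (of_real s * z) - 1) / z\<^sup>2) \<le> 2 * exp \<bar>\<theta>\<bar> * (\<epsilon> / \<bar>\<theta>\<bar> * indicator {-1..1} y + k y + k (- y))"
        using norm_exp_minus_one_quotient_le[OF s, of z y] \<theta> unfolding z_def \<epsilon>_def k_def by simp
    qed (use h(2) \<open>B \<ge> 0\<close> in auto)
    finally show ?thesis by (simp add: A_def mult_ac)
  qed
  \<comment> \<open>The estimate runs in \<open>ennreal\<close>, so that \<open>k_int\<close> and
    \<open>k_int'\<close> apply without a separate integrability proof for the majorant.\<close>
  have "ennreal (norm (LINT y|lborel. D y)) \<le> (\<integral>\<^sup>+y. ennreal (norm (D y)) \<partial>lborel)"
    unfolding D_def by (intro integral_norm_bound_ennreal Bochner_Integration.integrable_diff int)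
  also have "\<dots> \<le> (\<integral>\<^sup>+y. ennreal A * (ennreal (\<epsilon> / \<bar>\<theta>\<bar>) * indicator {-1..1} y + ennreal (k y) + ennreal (k (- y))) \<partial>lborel)"
  proof (intro nn_integral_mono)
    fix y
    have "ennreal (norm (D y)) \<le> ennreal (A * (\<epsilon> / \<bar>\<theta>\<bar> * indicator {-1..1} y + k y + k (- y)))"
      by (rule ennreal_leI[OF D_bound])
    also have "\<dots> = ennreal A * (ennreal (\<epsilon> / \<bar>\<theta>\<bar>) * indicator {-1..1} y + ennreal (k y) + ennreal (k (- y)))"
      using \<open>A \<ge> 0\<close> k_nn \<epsilon> by (auto simp: ennreal_mult ennreal_plus indicator_def)
    finally show "ennreal (norm (D y)) \<le> \<dots>" .
  qed
  also have "\<dots> = ennreal A * (ennreal (\<epsilon> / \<bar>\<theta>\<bar>) * 2 + (\<integral>\<^sup>+y. ennreal (k y) \<partial>lborel) + (\<integral>\<^sup>+y. ennreal (k (- y)) \<partial>lborel))"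
    by (simp add: nn_integral_cmult nn_integral_add nn_integral_cmult_indicator)
  also have "\<dots> \<le> ennreal A * (ennreal (\<epsilon> / \<bar>\<theta>\<bar>) * 2 + ennreal (2 * \<epsilon> * (1 + ln (1 / \<epsilon>))) + ennreal (2 * \<epsilon> * (1 + ln (1 / \<epsilon>))))"
    by (intro mult_left_mono add_mono k_int k_int') auto
  also have "\<dots> = ennreal (A * (\<epsilon> / \<bar>\<theta>\<bar> * 2 + 2 * \<epsilon> * (1 + ln (1 / \<epsilon>)) + 2 * \<epsilon> * (1 + ln (1 / \<epsilon>))))"
  proof -
    have *: "ennreal A * (ennreal a * 2 + ennreal q + ennreal q) = ennreal (A * (a * 2 + q + q))"
      if "0 \<le> a" "0 \<le> q" for a q
    proof -
      have "ennreal (A * (a * 2 + q + q)) = ennreal A * (ennreal (a * 2) + ennreal q + ennreal q)"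
        using that \<open>A \<ge> 0\<close> by (simp only: ennreal_mult ennreal_plus add_nonneg_nonneg mult_nonneg_nonneg zero_le_numeral)
      also have "ennreal (a * 2) = ennreal a * 2" using that by (subst ennreal_mult) auto
      finally show ?thesis by simp
    qed
    show ?thesis using \<epsilon> by (intro *) (auto intro!: mult_nonneg_nonneg add_nonneg_nonneg)
  qed
  finally have "norm (LINT y|lborel. D y) \<le> A * (\<epsilon> / \<bar>\<theta>\<bar> * 2 + 2 * \<epsilon> * (1 + ln (1 / \<epsilon>)) + 2 * \<epsilon> * (1 + ln (1 / \<epsilon>)))"
    using \<epsilon> \<open>A \<ge> 0\<close> by (subst (asm) ennreal_le_iff) (auto intro!: mult_nonneg_nonneg add_nonneg_nonneg)
  also have "\<dots> \<le> A * ((2 / \<bar>\<theta>\<bar> + 4) * (\<epsilon> * (1 + ln (1 / \<epsilon>))))"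
  proof (intro mult_left_mono \<open>A \<ge> 0\<close>)
    \<comment> \<open>As \<epsilon> <= 1, the logarithm is nonnegative and the contribution of the
      middle segment is absorbed into the logarithmic term.\<close>
    have "\<epsilon> * 1 \<le> \<epsilon> * (1 + ln (1 / \<epsilon>))" using \<epsilon> by (intro mult_left_mono) auto
    then have "2 / \<bar>\<theta>\<bar> * \<epsilon> \<le> 2 / \<bar>\<theta>\<bar> * (\<epsilon> * (1 + ln (1 / \<epsilon>)))" by (intro mult_left_mono) auto
    then show "\<epsilon> / \<bar>\<theta>\<bar> * 2 + 2 * \<epsilon> * (1 + ln (1 / \<epsilon>)) + 2 * \<epsilon> * (1 + ln (1 / \<epsilon>)) \<le> (2 / \<bar>\<theta>\<bar> + 4) * (\<epsilon> * (1 + ln (1 / \<epsilon>)))"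
      by (simp add: algebra_simps)
  qed
  also have "(LINT y|lborel. D y) = E (t + s) - E t"
    unfolding D_def E_def by (intro Bochner_Integration.integral_diff int)
  finally show ?thesis by (simp add: A_def \<epsilon>_def mult_ac)
qed

text \<open>The scalar statement to be applied to each matrix entry: \<open>f\<close> continues the
  transform of \<open>M\<close> to the left, and \<open>P\<close> contains the poles that are
  crossed and also 0 when it is crossed. \<open>m \<rho> = 0\<close> is allowed, so 0 may belong to
  \<open>P\<close> without being a pole of \<open>f\<close>. The additional power at \<rho> = 0 is
  two orders from 1/z^2 minus one degree lost by differentiation.\<close>

theorem laplace_tauberian:
  fixes M :: "real measure" and f :: "complex \<Rightarrow> complex" and m :: "complex \<Rightarrow> nat" and \<theta> \<sigma> :: real
  assumes M: "locally_finite_measure M" and lap: "nn_laplace M \<sigma> < \<infinity>"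
    and ord: "\<sigma> > 0" "a < \<theta>" "\<theta> < \<sigma>" "\<theta> \<noteq> 0"
    and P: "finite P" "P \<subseteq> {z. \<theta> < Re z \<and> Re z < \<sigma>}" "\<theta> < 0 \<Longrightarrow> 0 \<in> P"
    and holo: "f holomorphic_on {z. a < Re z} - P"
    and line: "\<And>y. norm (f (Complex \<theta> y)) \<le> B"
    and strip: "\<And>z. \<theta> \<le> Re z \<Longrightarrow> Re z \<le> \<sigma> \<Longrightarrow> T \<le> \<bar>Im z\<bar> \<Longrightarrow> norm (f z) \<le> B"
    and eq: "\<And>y. f (Complex \<sigma> y) = laplace M (Complex \<sigma> y)"
    and poles: "\<And>\<rho>. \<rho> \<in> P \<Longrightarrow>
      \<exists>S G. open S \<and> \<rho> \<in> S \<and> G holomorphic_on S \<and> (\<forall>z\<in>S - {\<rho>}. f z = G z / (z - \<rho>) ^ m \<rho>)"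
  shows "\<exists>c. (\<lambda>t. complex_of_real (measure M {0..t}) -
      (\<Sum>\<rho>\<in>P. exp (\<rho> * of_real t) * (\<Sum>k<m \<rho> + (if \<rho> = 0 then 1 else 0). of_real t ^ k * c \<rho> k)))
    \<in> O[at_top](\<lambda>t. of_real (t * exp (\<theta> * t)))"
proof -
  have "B \<ge> 0" using order_trans[OF norm_ge_zero line] .
  define m' where "m' \<rho> = m \<rho> + (if \<rho> = 0 then 2 else 0)" for \<rho>
  define h where "h t z = exp (z * of_real t) * f z / z\<^sup>2" for t :: real and z
  have "\<exists>c. \<forall>t. residue (h t) \<rho> = exp (\<rho> * of_real t) * (\<Sum>k<m' \<rho>. of_real t ^ k * c k)" if \<rho>: "\<rho> \<in> P" for \<rho>
  proof -
    from poles[OF \<rho>] obtain S G where S: "open S" "\<rho> \<in> S" "G holomorphic_on S"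
      and G: "\<And>z. z \<in> S - {\<rho>} \<Longrightarrow> f z = G z / (z - \<rho>) ^ m \<rho>" by blast
    \<comment> \<open>At \<rho> = 0 the factor 1/z^2 is merged into the power; elsewhere it is
      holomorphic once 0 is removed from the neighbourhood.\<close>
    have "\<exists>S' g. open S' \<and> S' \<subseteq> S \<and> \<rho> \<in> S' \<and> g holomorphic_on S' \<and> (\<forall>z\<in>S' - {\<rho>}. f z / z\<^sup>2 = g z / (z - \<rho>) ^ m' \<rho>)"
    proof (cases "\<rho> = 0")
      case True
      then show ?thesis using S G
        by (intro exI[of _ S] exI[of _ G]) (auto simp: m'_def power_add power2_eq_square)
    next
      case False
      then show ?thesis using S G
        by (intro exI[of _ "S - {0}"] exI[of _ "\<lambda>z. G z / z\<^sup>2"])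
           (auto simp: m'_def intro!: holomorphic_intros intro: holomorphic_on_subset)
    qed
    then obtain S' g where S': "open S'" "\<rho> \<in> S'" "g holomorphic_on S'"
      and g: "\<And>z. z \<in> S' - {\<rho>} \<Longrightarrow> f z / z\<^sup>2 = g z / (z - \<rho>) ^ m' \<rho>" by blast
    obtain c where c: "\<And>t. residue (\<lambda>z. exp (z * t) * g z / (z - \<rho>) ^ m' \<rho>) \<rho> = exp (\<rho> * t) * (\<Sum>k<m' \<rho>. t ^ k * c k)"
      using residue_exp_over_power[OF S', of "m' \<rho>"] by blast
    have "residue (h t) \<rho> = residue (\<lambda>z. exp (z * of_real t) * g z / (z - \<rho>) ^ m' \<rho>) \<rho>" for t
    proof (rule residue_cong)
      have "\<forall>\<^sub>F z in at \<rho>. z \<in> S' - {\<rho>}"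
        using S' by (intro eventually_at_in_open) auto
      then show "\<forall>\<^sub>F z in at \<rho>. h t z = exp (z * of_real t) * g z / (z - \<rho>) ^ m' \<rho>"
      proof eventually_elim
        case (elim z)
        have "h t z = exp (z * of_real t) * (f z / z\<^sup>2)" by (simp add: h_def)
        then show ?case using g[OF elim] by simp
      qed
    qed auto
    then show ?thesis using c by (intro exI[of _ c]) simp
  qed
  then obtain c where c: "\<And>\<rho> t. \<rho> \<in> P \<Longrightarrow> residue (h t) \<rho> = exp (\<rho> * of_real t) * (\<Sum>k<m' \<rho>. of_real t ^ k * c \<rho> k)"
    by metis
  define W where "W w = (\<Sum>\<rho>\<in>P. exp (\<rho> * w) * (\<Sum>k<m' \<rho>. w ^ k * c \<rho> k))" for w
  define c' where "c' \<rho> k = \<rho> * c \<rho> k + (if Suc k < m' \<rho> then of_nat (Suc k) * c \<rho> (Suc k) else 0)" for \<rho> k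
  define W' where "W' w = (\<Sum>\<rho>\<in>P. exp (\<rho> * w) * (\<Sum>k<m' \<rho>. w ^ k * c' \<rho> k))" for w
  have W_deriv: "(W has_field_derivative W' w) (at w)" for w
    unfolding W_def W'_def c'_def by (intro DERIV_sum exp_poly_has_field_derivative)
  have "\<exists>K b. K \<ge> 0 \<and> b \<ge> 0 \<and> (\<forall>w. norm (W w) \<le> K * exp (b * norm w))"
    by (rule exp_poly_growth[OF P(1), where m=m' and c=c, folded W_def]) blast
  then obtain K b where K: "K \<ge> 0" "b \<ge> 0" "\<And>w. norm (W w) \<le> K * exp (b * norm w)" by blast
  define E where "E t = (LINT y|lborel. exp (Complex \<theta> y * of_real t) * f (Complex \<theta> y) / (Complex \<theta> y)\<^sup>2)" for t :: real
  define V where "V t = (LINT x|M. max 0 (t - x))" for t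
  \<comment> \<open>For \<theta> > 0 the point 0 is not in \<open>P\<close>, so the strip on which
    \<open>h\<close> has to be holomorphic must stop at 0.\<close>
  define a' where "a' = (if \<theta> > 0 then max a 0 else a)"
  have a': "a' < \<theta>" "a \<le> a'" "0 \<in> P \<or> a' \<ge> 0"
    using ord P(3) by (auto simp: a'_def not_less)
  have h_holo: "h t holomorphic_on {z. a' < Re z \<and> Re z < \<sigma> + 1} - P" for t
  proof -
    have "f holomorphic_on {z. a' < Re z \<and> Re z < \<sigma> + 1} - P"
      using a' by (intro holomorphic_on_subset[OF holo]) auto
    then show ?thesis unfolding h_def using a'(3) by (intro holomorphic_intros) auto
  qed
  have f_cont: "continuous_on UNIV (\<lambda>y. f (Complex \<theta> y))"
    by (rule continuous_on_compose2[OF holomorphic_on_imp_continuous_on[OF holo]])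
       (use P ord in \<open>auto intro!: continuous_on_Complex continuous_intros\<close>)
  have V_eq: "2 * pi * complex_of_real (V t) = E t + 2 * pi * W (of_real t)" for t
  proof -
    have "2 * pi * complex_of_real (V t) = (LINT y|lborel. h t (Complex \<sigma> y))"
      unfolding V_def h_def eq by (rule ramp_integral_inversion[OF M lap ord(1) order_refl])
    also have "\<dots> = (LINT y|lborel. h t (Complex \<theta> y)) + 2 * pi * (\<Sum>\<rho>\<in>P. residue (h t) \<rho>)"
    proof (rule vertical_line_shift[OF a'(1) ord(3) _ P(1,2) h_holo])
      fix z assume z: "\<theta> \<le> Re z" "Re z \<le> \<sigma>" "max T 1 \<le> \<bar>Im z\<bar>"
      have "norm (h t z) \<le> norm (exp (z * of_real t) * f z) / (Im z)\<^sup>2"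
        unfolding h_def using z by (intro norm_vertical_line_ge[of 1]) auto
      also have "\<dots> \<le> exp (max \<bar>\<theta>\<bar> \<bar>\<sigma>\<bar> * \<bar>t\<bar>) * B / (Im z)\<^sup>2"
      proof (intro divide_right_mono)
        have "Re z * t \<le> \<bar>Re z\<bar> * \<bar>t\<bar>" by (metis abs_ge_self abs_mult)
        also have "\<dots> \<le> max \<bar>\<theta>\<bar> \<bar>\<sigma>\<bar> * \<bar>t\<bar>" using z by (intro mult_right_mono) auto
        finally have "norm (exp (z * of_real t)) \<le> exp (max \<bar>\<theta>\<bar> \<bar>\<sigma>\<bar> * \<bar>t\<bar>)" by (simp add: norm_exp_eq_Re)
        then show "norm (exp (z * of_real t) * f z) \<le> exp (max \<bar>\<theta>\<bar> \<bar>\<sigma>\<bar> * \<bar>t\<bar>) * B"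
          unfolding norm_mult using strip z by (intro mult_mono) auto
      qed auto
      finally show "norm (h t z) \<le> exp (max \<bar>\<theta>\<bar> \<bar>\<sigma>\<bar> * \<bar>t\<bar>) * B / (Im z)\<^sup>2" .
    qed auto
    also have "(\<Sum>\<rho>\<in>P. residue (h t) \<rho>) = W (of_real t)" by (simp add: W_def c)
    finally show ?thesis by (simp add: E_def h_def)
  qed
  define Q where "Q t s = complex_of_real ((V (t + s) - V t) / s)" for t s
  \<comment> \<open>With |s| = e^(-c0 t), the bound c0 >= b - \<theta> gives e^(bt) |s| <=
    e^(\<theta> t), which controls the second-order error of \<open>W\<close> after division by s;
    c0 >= 1 ensures |s| <= 1.\<close>
  define c0 where "c0 = max 1 (b - \<theta>)"
  define D where "D = B * (2 * exp \<bar>\<theta>\<bar> * (2 / \<bar>\<theta>\<bar> + 4))"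
  have "D \<ge> 0" using \<open>B \<ge> 0\<close> by (simp add: D_def)
  define C where "C = 2 * K * exp (2 * b) + D * (1 + c0)"
  have "C \<ge> 0" using K \<open>D \<ge> 0\<close> by (auto simp: C_def c0_def)
  have Q: "norm (Q t s - W' (of_real t)) \<le> C * (t * exp (\<theta> * t))" if t: "t \<ge> 1" and s: "\<bar>s\<bar> = exp (- c0 * t)" for t s
  proof -
    have n2pi: "norm (complex_of_real (2 * pi) * x) = 2 * pi * norm x" for x by (simp add: norm_mult)
    have c0: "c0 \<ge> 1" "c0 \<ge> b - \<theta>" by (auto simp: c0_def)
    have s': "s \<noteq> 0" "\<bar>s\<bar> \<le> 1" using s t c0 by auto
    have "2 * pi * (of_real s * Q t s) = (E (t + s) - E t) + 2 * pi * (W (of_real t + of_real s) - W (of_real t))"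
    proof -
      have "of_real s * Q t s = complex_of_real (V (t + s)) - complex_of_real (V t)"
        using s'(1) by (simp add: Q_def)
      then show ?thesis using V_eq[of "t + s"] V_eq[of t] by (simp add: right_diff_distrib)
    qed
    then have "2 * pi * (of_real s * (Q t s - W' (of_real t))) = (E (t + s) - E t) +
        2 * pi * (W (of_real t + of_real s) - W (of_real t) - of_real s * W' (of_real t))"
      by (simp add: algebra_simps)
    then have "norm (2 * pi * (of_real s * (Q t s - W' (of_real t)))) \<le> norm (E (t + s) - E t) +
        norm (2 * pi * (W (of_real t + of_real s) - W (of_real t) - of_real s * W' (of_real t)))"
      by (metis norm_triangle_ineq)
    also have "norm (2 * pi * (of_real s * (Q t s - W' (of_real t)))) = 2 * pi * (\<bar>s\<bar> * norm (Q t s - W' (of_real t)))"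
      by (simp add: norm_mult)
    also have "norm (2 * pi * (W (of_real t + of_real s) - W (of_real t) - of_real s * W' (of_real t)))
        \<le> 2 * pi * (\<bar>s\<bar> * (2 * K * exp (2 * b) * exp (\<theta> * t)))"
    proof -
      have "norm (W (of_real t + of_real s) - W (of_real t) - of_real s * W' (of_real t)) \<le>
          2 * K * exp (b * (norm (complex_of_real t) + 2)) * (norm (complex_of_real s))\<^sup>2"
        by (rule entire_first_order_remainder[OF W_deriv K(3,2,1)]) (use s' in auto)
      also have "\<dots> = \<bar>s\<bar> * (2 * K * exp (2 * b) * (exp (b * t) * \<bar>s\<bar>))"
        using t by (simp add: power2_eq_square exp_add[symmetric] distrib_left mult_ac)
      also have "\<dots> \<le> \<bar>s\<bar> * (2 * K * exp (2 * b) * exp (\<theta> * t))"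
      proof (intro mult_left_mono)
        have "b * t - c0 * t \<le> \<theta> * t" using mult_right_mono[OF c0(2), of t] t by (simp add: algebra_simps)
        then show "exp (b * t) * \<bar>s\<bar> \<le> exp (\<theta> * t)" unfolding s by (simp add: exp_add[symmetric])
      qed (use K in auto)
      finally show ?thesis unfolding n2pi by (intro mult_left_mono) auto
    qed
    also have "norm (E (t + s) - E t) \<le> 2 * pi * (\<bar>s\<bar> * (exp (\<theta> * t) * D * (1 + c0 * t)))"
    proof -
      have "norm (E (t + s) - E t) \<le> exp (\<theta> * t) * D * (\<bar>s\<bar> * (1 + ln (1 / \<bar>s\<bar>)))"
        unfolding E_def D_def by (rule vertical_integral_increment[OF ord(4) f_cont line s'])
      \<comment> \<open>The logarithm of the exponentially small step is the source of the factor
        \<open>t\<close> in the error term.\<close>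
      also have "ln (1 / \<bar>s\<bar>) = c0 * t" by (simp add: s ln_div)
      finally have "norm (E (t + s) - E t) \<le> 1 * (\<bar>s\<bar> * (exp (\<theta> * t) * D * (1 + c0 * t)))" by (simp add: mult_ac)
      \<comment> \<open>The bound is enlarged by 2 pi >= 1 only to let the common factor
        cancel.\<close>
      also have "\<dots> \<le> 2 * pi * (\<bar>s\<bar> * (exp (\<theta> * t) * D * (1 + c0 * t)))"
        using \<open>D \<ge> 0\<close> c0 t pi_gt3 by (intro mult_right_mono) auto
      finally show ?thesis .
    qed
    finally have "2 * pi * (\<bar>s\<bar> * norm (Q t s - W' (of_real t))) \<le>
        2 * pi * (\<bar>s\<bar> * (exp (\<theta> * t) * D * (1 + c0 * t) + 2 * K * exp (2 * b) * exp (\<theta> * t)))"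
      by (simp add: algebra_simps)
    then have "norm (Q t s - W' (of_real t)) \<le> exp (\<theta> * t) * D * (1 + c0 * t) + 2 * K * exp (2 * b) * exp (\<theta> * t)"
      using s' by (simp add: mult_le_cancel_left_pos)
    also have "\<dots> = exp (\<theta> * t) * (D * (1 + c0 * t) + 2 * K * exp (2 * b) * 1)" by (simp add: algebra_simps)
    also have "\<dots> \<le> exp (\<theta> * t) * (D * (t + c0 * t) + 2 * K * exp (2 * b) * t)"
      using \<open>D \<ge> 0\<close> t K(1) c0(1) by (intro mult_left_mono add_mono) auto
    also have "\<dots> = C * (t * exp (\<theta> * t))" by (simp add: C_def algebra_simps)
    finally show ?thesis .
  qed
  have main: "norm (complex_of_real (measure M {0..t}) - W' (of_real t)) \<le> 3 * C * norm (complex_of_real (t * exp (\<theta> * t)))"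
    if t: "t \<ge> 1" for t
  proof -
    define \<epsilon> where "\<epsilon> = exp (- c0 * t)"
    define u where "u = measure M {0..t}"
    define X where "X = C * (t * exp (\<theta> * t))"
    have \<epsilon>: "\<epsilon> > 0" by (simp add: \<epsilon>_def)
    \<comment> \<open>The backward quotient is written with the increment
      \<open>- \<epsilon>\<close>, so that the estimate for \<open>Q\<close> serves both
      sides.\<close>
    define l r where "l = (V (t + - \<epsilon>) - V t) / - \<epsilon>" and "r = (V (t + \<epsilon>) - V t) / \<epsilon>"
    have "l \<le> u" "u \<le> r"
      using measure_between_ramp_quotients[OF M lap \<epsilon>, of t]
      by (simp_all add: l_def r_def u_def V_def minus_divide_left[symmetric] divide_minus_right minus_divide_left)
    have l: "norm (of_real l - W' (of_real t)) \<le> X" and r: "norm (of_real r - W' (of_real t)) \<le> X"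
      using Q[OF t, of "- \<epsilon>"] Q[OF t, of \<epsilon>] by (simp_all only: Q_def l_def r_def X_def) (auto simp: \<epsilon>_def)
    have "norm (complex_of_real r - of_real l) \<le> norm (of_real r - W' (of_real t)) + norm (of_real l - W' (of_real t))"
      using norm_triangle_ineq4[of "of_real r - W' (of_real t)" "of_real l - W' (of_real t)"] by simp
    \<comment> \<open>Since \<open>l\<close> and \<open>r\<close> are within \<open>X\<close> of the
      main term and enclose \<open>u\<close>, the value \<open>u\<close> is within 2 X of
      \<open>l\<close>, hence within 3 X of the main term.\<close>
    then have "\<bar>r - l\<bar> \<le> 2 * X" using l r by (simp flip: of_real_diff)
    then have "norm (complex_of_real u - of_real l) \<le> 2 * X"
      using \<open>l \<le> u\<close> \<open>u \<le> r\<close> by (simp flip: of_real_diff)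
    then have "norm (complex_of_real u - W' (of_real t)) \<le> 3 * X"
      using l norm_triangle_ineq[of "complex_of_real u - of_real l" "of_real l - W' (of_real t)"] by simp
    moreover have "norm (complex_of_real (t * exp (\<theta> * t))) = t * exp (\<theta> * t)" using t by (simp add: norm_mult)
    ultimately show ?thesis by (simp add: u_def X_def)
  qed
  have W'_eq: "W' w = (\<Sum>\<rho>\<in>P. exp (\<rho> * w) * (\<Sum>k<m \<rho> + (if \<rho> = 0 then 1 else 0). w ^ k * c' \<rho> k))" for w
    unfolding W'_def by (rule sum.cong[OF refl]) (auto simp: m'_def c'_def)
  show ?thesis
    by (intro exI[of _ c'] bigoI[of _ "3 * C"] eventually_mono[OF eventually_ge_at_top[of 1]])
       (use main W'_eq in simp)
qed

subsection \<open>Inverse matrices\<close>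

text \<open>Entry (k, j) of the classical adjugate in Cramer's form. As a determinant it is a
  polynomial in the entries, so holomorphy and bounds carry over from them.\<close>

definition adjugate_entry :: "'a::comm_ring_1^'n^'n \<Rightarrow> 'n \<Rightarrow> 'n \<Rightarrow> 'a" where
  "adjugate_entry A k j = det (\<chi> i l. if l = k then (if i = j then 1 else 0) else A $ i $ l)"

lemma invertible_matrix_inv:
  assumes "invertible A"
  shows "A ** matrix_inv A = mat 1" "matrix_inv A ** A = mat 1"
  using someI_ex[OF assms[unfolded invertible_def]] by (auto simp: matrix_inv_def)

lemma matrix_inv_eqI:
  fixes A B :: "'a::field^'n^'n"
  assumes "A ** B = mat 1"
  shows "matrix_inv A = B"
proof -
  have "B ** A = mat 1" using assms matrix_left_right_inverse by blast
  then have "invertible A" using assms by (auto simp: invertible_def)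
  then have "matrix_inv A = matrix_inv A ** (A ** B)" using assms by simp
  also have "\<dots> = B" using invertible_matrix_inv(2)[OF \<open>invertible A\<close>] by (simp add: matrix_mul_assoc)
  finally show ?thesis .
qed

text \<open>Cramer's rule for the system solved by column \<open>j\<close> of the inverse. The
  common denominator confines all poles of the inverse to zeros of the determinant.\<close>

lemma matrix_inv_adjugate:
  fixes A :: "'a::field^'n^'n"
  assumes "det A \<noteq> 0"
  shows "matrix_inv A $ k $ j = adjugate_entry A k j / det A"
proof -
  define x where "x = column j (matrix_inv A)"
  have inv: "A ** matrix_inv A = mat 1" using assms by (simp add: invertible_matrix_inv invertible_det_nz)
  have "(A *v x) $ i = (if i = j then 1 else 0)" for i
  proof -
    have "(A *v x) $ i = (A ** matrix_inv A) $ i $ j"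
      by (simp add: x_def matrix_vector_mult_def matrix_matrix_mult_def column_def)
    then show ?thesis by (simp add: inv mat_def)
  qed
  then have "adjugate_entry A k j = x $ k * det A"
    using cramer_lemma[of k A x] unfolding adjugate_entry_def by (simp only:)
  then show ?thesis using assms by (simp add: x_def column_def)
qed

lemma norm_det_le:
  fixes A :: "'a::{real_normed_field}^'n^'n"
  assumes "\<And>i j. norm (A $ i $ j) \<le> K"
  shows "norm (det A) \<le> fact CARD('n) * K ^ CARD('n)"
proof -
  have "norm (det A) \<le> (\<Sum>p | p permutes (UNIV :: 'n set). K ^ CARD('n))"
    unfolding det_def
  proof (rule sum_norm_le)
    fix p :: "'n \<Rightarrow> 'n"
    have "norm (of_int (sign p) * (\<Prod>i\<in>UNIV. A $ i $ p i)) = (\<Prod>i\<in>UNIV. norm (A $ i $ p i))"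
      by (simp add: norm_mult prod_norm sign_def)
    also have "\<dots> \<le> (\<Prod>i\<in>(UNIV::'n set). K)" using assms by (intro prod_mono) auto
    finally show "norm (of_int (sign p) * (\<Prod>i\<in>UNIV. A $ i $ p i)) \<le> K ^ CARD('n)" by simp
  qed
  also have "\<dots> = fact CARD('n) * K ^ CARD('n)" by (simp add: card_permutations)
  finally show ?thesis .
qed

lemma holomorphic_on_det:
  fixes A :: "complex \<Rightarrow> complex^'n^'n"
  assumes "\<And>i j. (\<lambda>z. A z $ i $ j) holomorphic_on S"
  shows "(\<lambda>z. det (A z)) holomorphic_on S"
  unfolding det_def using assms by (intro holomorphic_intros)

lemma holomorphic_on_adjugate_entry:
  fixes A :: "complex \<Rightarrow> complex^'n^'n"
  assumes "\<And>i j. (\<lambda>z. A z $ i $ j) holomorphic_on S"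
  shows "(\<lambda>z. adjugate_entry (A z) k j) holomorphic_on S"
  unfolding adjugate_entry_def
proof (rule holomorphic_on_det)
  show "(\<lambda>z. (\<chi> i l. if l = k then if i = j then 1 else 0 else A z $ i $ l) $ i $ l) holomorphic_on S" for i l
    using assms[of i l] by (cases "l = k") simp_all
qed

lemma norm_adjugate_entry_le:
  fixes A :: "complex^'n^'n"
  assumes "\<And>i j. norm (A $ i $ j) \<le> K" "1 \<le> K"
  shows "norm (adjugate_entry A k j) \<le> fact CARD('n) * K ^ CARD('n)"
  unfolding adjugate_entry_def using assms by (intro norm_det_le) auto

text \<open>In the norm max |w_i| / v_i the matrix \<open>L\<close> contracts by \<open>q\<close>.
  At an index where the maximum r is attained, the equation for \<open>w\<close> gives r <= \<beta>
  + r q.\<close>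

lemma weighted_contraction_bound:
  fixes L :: "complex^'n^'n" and w b :: "complex^'n" and v :: "'n \<Rightarrow> real" and A :: "'n \<Rightarrow> 'n \<Rightarrow> real"
  assumes v: "\<And>i. 1 \<le> v i" and A: "\<And>i. (\<Sum>k\<in>UNIV. A i k * v k) \<le> q * v i" and q: "q < 1"
    and L: "\<And>i j. norm (L $ i $ j) \<le> A i j"
    and b: "\<And>i. norm (b $ i) \<le> \<beta>" and w: "w = b + L *v w"
  shows "norm (w $ i) \<le> \<beta> / (1 - q) * v i"
proof -
  define r where "r = Max (range (\<lambda>i. norm (w $ i) / v i))"
  have v0: "0 < v i" for i using v[of i] by simp
  have r: "norm (w $ i) \<le> r * v i" for i
  proof -
    have "norm (w $ i) / v i \<le> r" unfolding r_def by (intro Max_ge) auto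
    then show ?thesis using v0[of i] by (simp add: field_simps)
  qed
  have "r \<in> range (\<lambda>i. norm (w $ i) / v i)" unfolding r_def by (intro Max_in) auto
  then obtain i0 where i0: "r = norm (w $ i0) / v i0" by auto
  have "r \<ge> 0" using v0[of i0] by (simp add: i0)
  have "\<beta> \<ge> 0" using order_trans[OF norm_ge_zero b] .
  have "norm (w $ i0) \<le> norm (b $ i0) + norm ((L *v w) $ i0)"
    by (subst (1) w) (simp add: norm_triangle_ineq)
  also have "norm ((L *v w) $ i0) \<le> (\<Sum>k\<in>UNIV. A i0 k * (r * v k))"
    unfolding matrix_vector_mult_def
    by (auto simp: norm_mult intro!: sum_norm_le mult_mono L r order_trans[OF norm_ge_zero L])
  also have "\<dots> = r * (\<Sum>k\<in>UNIV. A i0 k * v k)" by (simp add: sum_distrib_left mult_ac)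
  also have "\<dots> \<le> r * (q * v i0)" using A \<open>r \<ge> 0\<close> by (intro mult_left_mono)
  also have "norm (b $ i0) \<le> \<beta> * v i0"
    using b[of i0] mult_left_mono[OF v[of i0] \<open>\<beta> \<ge> 0\<close>] by simp
  finally have "r * v i0 \<le> (\<beta> + r * q) * v i0" using v0[of i0] by (simp add: i0 algebra_simps)
  then have "r \<le> \<beta> + r * q" using v0[of i0] by simp
  then have "r \<le> \<beta> / (1 - q)" using q by (simp add: field_simps)
  then show ?thesis using r[of i] v0[of i] by (meson mult_right_mono less_imp_le order_trans)
qed

text \<open>Bounds the set of eigenvalue moduli, which makes the supremum in
  \<open>spectral_radius\<close> a genuine upper bound.\<close>

lemma eigenvalue_bound:
  fixes C :: "complex^'n^'n"
  assumes "v \<noteq> 0" "C *v v = c *s v"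
  shows "norm c \<le> (\<Sum>i\<in>UNIV. \<Sum>j\<in>UNIV. norm (C $ i $ j))"
proof -
  define r where "r = Max (range (\<lambda>i. norm (v $ i)))"
  have r: "norm (v $ i) \<le> r" for i unfolding r_def by (intro Max_ge) auto
  have "r \<in> range (\<lambda>i. norm (v $ i))" unfolding r_def by (intro Max_in) auto
  then obtain i0 where i0: "r = norm (v $ i0)" by auto
  obtain i where "v $ i \<noteq> 0" using assms(1) by (auto simp: vec_eq_iff)
  then have "r > 0" using r[of i] by (meson less_le_trans zero_less_norm_iff)
  have "norm c * r = norm ((C *v v) $ i0)" by (simp add: assms(2) i0 norm_mult)
  also have "\<dots> \<le> (\<Sum>j\<in>UNIV. norm (C $ i0 $ j) * r)"
    unfolding matrix_vector_mult_def by (auto simp: norm_mult intro!: sum_norm_le mult_left_mono r)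
  also have "\<dots> = (\<Sum>j\<in>UNIV. norm (C $ i0 $ j)) * r" by (simp add: sum_distrib_right)
  also have "\<dots> \<le> (\<Sum>i\<in>UNIV. \<Sum>j\<in>UNIV. norm (C $ i $ j)) * r"
    using \<open>r > 0\<close> by (intro mult_right_mono member_le_sum) (auto intro: sum_nonneg)
  finally show ?thesis using \<open>r > 0\<close> by simp
qed

text \<open>A kernel vector of I - s B would be an eigenvector of B for 1/s >= 1. It is read as a
  complex vector because \<open>spectral_radius\<close> concerns complex matrices.\<close>

lemma det_nonzero_of_spectral_radius:
  fixes B :: "real^'n^'n"
  assumes sr: "spectral_radius (\<chi> i j. complex_of_real (B $ i $ j)) < 1" and s: "0 \<le> s" "s \<le> 1"
  shows "det (mat 1 - s *\<^sub>R B) \<noteq> 0"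
proof
  assume "det (mat 1 - s *\<^sub>R B) = 0"
  then have "\<not> (\<exists>C. C ** (mat 1 - s *\<^sub>R B) = mat 1)"
    by (simp add: invertible_left_inverse[symmetric] invertible_det_nz)
  then obtain x where x: "(mat 1 - s *\<^sub>R B) *v x = 0" "x \<noteq> 0"
    unfolding matrix_left_invertible_ker by auto
  then have eq: "x = s *\<^sub>R (B *v x)"
    by (simp add: matrix_vector_mult_diff_rdistrib scaleR_matrix_vector_assoc[symmetric])
  have "s \<noteq> 0" using eq x(2) by auto
  define C where "C = (\<chi> i j. complex_of_real (B $ i $ j))"
  define y where "y = (\<chi> i. complex_of_real (x $ i))"
  have "(C *v y) $ i = (complex_of_real (1 / s) *s y) $ i" for i
  proof -
    have "x $ i = s * (B *v x) $ i" using eq by (metis vector_scaleR_component real_scaleR_def)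
    then have "(B *v x) $ i = 1 / s * x $ i" using \<open>s \<noteq> 0\<close> by simp
    moreover have "(C *v y) $ i = complex_of_real ((B *v x) $ i)"
      by (simp add: C_def y_def matrix_vector_mult_def)
    ultimately show ?thesis by (simp add: y_def)
  qed
  then have "C *v y = complex_of_real (1 / s) *s y" by (simp add: vec_eq_iff)
  moreover have "y \<noteq> 0" using x(2) by (auto simp: y_def vec_eq_iff)
  ultimately have "cmod (complex_of_real (1 / s)) \<in> {cmod c | c. \<exists>v. v \<noteq> 0 \<and> C *v v = c *s v}" by blast
  moreover have "bdd_above {cmod c | c. \<exists>v. v \<noteq> 0 \<and> C *v v = c *s v}"
    using eigenvalue_bound[of _ C] by (intro bdd_aboveI) blast
  ultimately have "cmod (complex_of_real (1 / s)) \<le> spectral_radius C"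
    unfolding spectral_radius_def by (rule cSup_upper)
  moreover have "1 \<le> cmod (complex_of_real (1 / s))" using s \<open>s \<noteq> 0\<close> by (simp add: norm_divide)
  ultimately show False using sr by (simp add: C_def)
qed

text \<open>A solution of \<open>v = 1 + s B v\<close> which is nonnegative is at least \<open>1\<close>, so that along the continuous
  family of solutions nonnegativity is both an open and a closed condition on \<open>s \<in> [0, 1]\<close>.\<close>

lemma neumann_vector_exists:
  fixes B :: "real^'n^'n"
  assumes nn: "\<And>i j. 0 \<le> B $ i $ j" and det: "\<And>s. 0 \<le> s \<Longrightarrow> s \<le> 1 \<Longrightarrow> det (mat 1 - s *\<^sub>R B) \<noteq> 0"
  shows "\<exists>v. \<forall>i. 1 \<le> v i \<and> v i = 1 + (\<Sum>k\<in>UNIV. B $ i $ k * v k)"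
proof -
  \<comment> \<open>Cramer's solution of (I - s B) v = (1, ..., 1), a form in which continuity in
    \<open>s\<close> is evident.\<close>
  define v where "v s = (\<chi> k. det (\<chi> i j. if j = k then 1 else (mat 1 - s *\<^sub>R B) $ i $ j) / det (mat 1 - s *\<^sub>R B))" for s
  have v_eq: "v s $ i = 1 + s * (\<Sum>k\<in>UNIV. B $ i $ k * v s $ k)" if "0 \<le> s" "s \<le> 1" for s i
  proof -
    have "(mat 1 - s *\<^sub>R B) *v v s = (\<chi> i. 1)"
      unfolding cramer[OF det[OF that]] v_def by (simp only: vec_lambda_beta)
    then have "v s - s *\<^sub>R (B *v v s) = (\<chi> i. 1)"
      by (simp add: matrix_vector_mult_diff_rdistrib scaleR_matrix_vector_assoc[symmetric])
    then have "(v s - s *\<^sub>R (B *v v s)) $ i = 1" by simp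
    then show ?thesis by (simp add: matrix_vector_mult_def)
  qed
  have v_ge: "1 \<le> v s $ i" if "0 \<le> s" "s \<le> 1" "\<And>i. 0 \<le> v s $ i" for s i
    using v_eq[OF that(1,2), of i] that nn by (simp add: sum_nonneg)
  have cont: "continuous_on {0..1} (\<lambda>s. v s $ i)" for i
  proof -
    have "continuous_on {0..1} (\<lambda>s. det (mat 1 - s *\<^sub>R B))"
      unfolding det_def by (intro continuous_intros)
    moreover have "continuous_on {0..1} (\<lambda>s. det (\<chi> ia j. if j = i then 1 else (mat 1 - s *\<^sub>R B) $ ia $ j))"
      unfolding det_def
    proof (intro continuous_on_sum continuous_on_mult continuous_on_const continuous_on_prod)
      show "continuous_on {0..1} (\<lambda>s. (\<chi> ia j. if j = i then 1 else (mat 1 - s *\<^sub>R B) $ ia $ j) $ k $ p k)" for k p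
        by (cases "p k = i") (auto intro!: continuous_intros)
    qed
    ultimately show ?thesis unfolding v_def using det by (auto intro!: continuous_intros)
  qed
  define Z where "Z = {s \<in> {0..1}. \<forall>i. v s $ i \<in> {0..}}"
  have "closedin (top_of_set {0..1}) (\<Inter>i. {0..1} \<inter> (\<lambda>s. v s $ i) -` {0..})"
    by (rule closedin_Inter) (use continuous_closedin_preimage[OF cont] in auto)
  also have "(\<Inter>i. {0..1} \<inter> (\<lambda>s. v s $ i) -` {0..}) = Z" by (auto simp: Z_def)
  finally have cl: "closedin (top_of_set {0..1}) Z" .
  have "openin (top_of_set {0..1}) (\<Inter>i. {0..1} \<inter> (\<lambda>s. v s $ i) -` {0<..})"
    by (rule openin_Inter) (use continuous_openin_preimage_gen[OF cont] in auto)
  also have "(\<Inter>i. {0..1} \<inter> (\<lambda>s. v s $ i) -` {0<..}) = Z"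
  proof -
    have "v s $ i > 0" if "s \<in> Z" for s i
      using v_ge[of s i] that by (auto simp: Z_def intro: less_le_trans[OF zero_less_one])
    then show ?thesis by (fastforce simp: Z_def less_imp_le)
  qed
  finally have op: "openin (top_of_set {0..1}) Z" .
  have "Z = {} \<or> Z = {0..1}"
    using connected_clopen[THEN iffD1, OF connected_Icc] cl op by blast
  moreover have "0 \<in> Z" using v_eq[of 0] by (auto simp: Z_def)
  ultimately have "Z = {0..1}" by blast
  then have "1 \<in> Z" by simp
  then have Z1: "\<And>i. 0 \<le> v 1 $ i" by (simp add: Z_def)
  show ?thesis
  proof (intro exI[of _ "\<lambda>i. v 1 $ i"] allI conjI)
    show "1 \<le> v 1 $ i" for i by (rule v_ge[OF _ _ Z1]) auto
    have "v 1 $ i = 1 + 1 * (\<Sum>k\<in>UNIV. B $ i $ k * v 1 $ k)" for i by (rule v_eq) auto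
    then show "v 1 $ i = 1 + (\<Sum>k\<in>UNIV. B $ i $ k * v 1 $ k)" for i unfolding mult_1_left .
  qed
qed

subsection \<open>The renewal measure\<close>

text \<open>An integral over \<open>count_space I\<close> covers both the finite sums in
  \<open>mat_convolution\<close> and the series in \<open>renewal_measure\<close>.\<close>

lemma nn_integral_sum_of_measures:
  assumes sets: "\<And>k. k \<in> I \<Longrightarrow> sets (M k) = sets N"
    and em: "\<And>A. A \<in> sets N \<Longrightarrow> emeasure N A = (\<integral>\<^sup>+k. emeasure (M k) A \<partial>count_space I)"
    and f: "f \<in> borel_measurable N"
  shows "(\<integral>\<^sup>+x. f x \<partial>N) = (\<integral>\<^sup>+k. (\<integral>\<^sup>+x. f x \<partial>M k) \<partial>count_space I)"
  using f
proof (induction rule: borel_measurable_induct)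
  case (cong f g)
  have "(\<integral>\<^sup>+x. f x \<partial>M k) = (\<integral>\<^sup>+x. g x \<partial>M k)" if "k \<in> I" for k
    by (intro nn_integral_cong cong(3)) (use sets_eq_imp_space_eq[OF sets[OF that]] in simp)
  then have "(\<integral>\<^sup>+k. (\<integral>\<^sup>+x. f x \<partial>M k) \<partial>count_space I) = (\<integral>\<^sup>+k. (\<integral>\<^sup>+x. g x \<partial>M k) \<partial>count_space I)"
    by (rule nn_integral_cong) simp
  moreover have "(\<integral>\<^sup>+x. f x \<partial>N) = (\<integral>\<^sup>+x. g x \<partial>N)" using cong(3) by (rule nn_integral_cong)
  ultimately show ?case using cong(4) by simp
next
  case (set A)
  have "(\<integral>\<^sup>+k. (\<integral>\<^sup>+x. indicator A x \<partial>M k) \<partial>count_space I) = (\<integral>\<^sup>+k. emeasure (M k) A \<partial>count_space I)"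
    using set sets by (intro nn_integral_cong) auto
  then show ?case using set em by simp
next
  case (mult u c)
  have "(\<integral>\<^sup>+k. (\<integral>\<^sup>+x. c * u x \<partial>M k) \<partial>count_space I) = (\<integral>\<^sup>+k. c * (\<integral>\<^sup>+x. u x \<partial>M k) \<partial>count_space I)"
    using mult(2) sets by (intro nn_integral_cong nn_integral_cmult) (auto cong: measurable_cong_sets)
  then show ?case using mult by (simp add: nn_integral_cmult)
next
  case (add u v)
  have "(\<integral>\<^sup>+k. (\<integral>\<^sup>+x. v x + u x \<partial>M k) \<partial>count_space I) = (\<integral>\<^sup>+k. (\<integral>\<^sup>+x. v x \<partial>M k) + (\<integral>\<^sup>+x. u x \<partial>M k) \<partial>count_space I)"
    using add sets by (intro nn_integral_cong nn_integral_add) (auto cong: measurable_cong_sets)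
  then show ?case using add by (simp add: nn_integral_add)
next
  case (seq U)
  have U: "U i \<in> borel_measurable (M k)" if "k \<in> I" for i k
    using seq(1) sets[OF that] by (simp cong: measurable_cong_sets)
  have "(\<integral>\<^sup>+k. (\<integral>\<^sup>+x. (SUP i. U i) x \<partial>M k) \<partial>count_space I) = (\<integral>\<^sup>+k. (SUP i. (\<integral>\<^sup>+x. U i x \<partial>M k)) \<partial>count_space I)"
    using seq U unfolding SUP_apply by (intro nn_integral_cong nn_integral_monotone_convergence_SUP) auto
  also have "\<dots> = (SUP i. (\<integral>\<^sup>+k. (\<integral>\<^sup>+x. U i x \<partial>M k) \<partial>count_space I))"
    using \<open>incseq U\<close> by (intro nn_integral_monotone_convergence_SUP)
      (auto simp: incseq_def le_fun_def intro!: nn_integral_mono)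
  also have "\<dots> = (SUP i. (\<integral>\<^sup>+x. U i x \<partial>N))" using seq by simp
  also have "\<dots> = (\<integral>\<^sup>+x. (SUP i. U i) x \<partial>N)"
    using seq unfolding SUP_apply by (intro nn_integral_monotone_convergence_SUP[symmetric]) auto
  finally show ?case by simp
qed

lemma nn_integral_mat_convolution:
  assumes "f \<in> borel_measurable borel"
  shows "(\<integral>\<^sup>+x. f x \<partial>mat_convolution \<mu> \<nu> i j) = (\<Sum>k\<in>UNIV. \<integral>\<^sup>+x. f x \<partial>(\<mu> i k \<star> \<nu> k j))"
proof -
  have "(\<integral>\<^sup>+x. f x \<partial>mat_convolution \<mu> \<nu> i j) = (\<integral>\<^sup>+k. (\<integral>\<^sup>+x. f x \<partial>(\<mu> i k \<star> \<nu> k j)) \<partial>count_space UNIV)"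
    by (rule nn_integral_sum_of_measures)
       (use assms in \<open>auto simp: emeasure_mat_convolution nn_integral_count_space_finite cong: measurable_cong_sets\<close>)
  then show ?thesis by (simp add: nn_integral_count_space_finite)
qed

lemma nn_integral_renewal_measure:
  assumes "f \<in> borel_measurable borel"
  shows "(\<integral>\<^sup>+x. f x \<partial>renewal_measure \<mu> i j) = (\<Sum>n. \<integral>\<^sup>+x. f x \<partial>conv_power \<mu> n i j)"
proof -
  have "(\<integral>\<^sup>+x. f x \<partial>renewal_measure \<mu> i j) = (\<integral>\<^sup>+n. (\<integral>\<^sup>+x. f x \<partial>conv_power \<mu> n i j) \<partial>count_space UNIV)"
    by (rule nn_integral_sum_of_measures)
       (use assms in \<open>auto simp: emeasure_renewal_measure nn_integral_count_space_nat cong: measurable_cong_sets\<close>)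
  then show ?thesis by (simp add: nn_integral_count_space_nat)
qed

text \<open>Tonelli's theorem in the generality of entries with possibly infinite total
  mass.\<close>

lemma nn_integral_convolution_sigma_finite:
  assumes "sigma_finite_measure M" "sigma_finite_measure N"
  assumes [measurable_cong]: "sets N = sets borel" "sets M = sets borel"
  assumes [measurable]: "f \<in> borel_measurable borel"
  shows "(\<integral>\<^sup>+x. f x \<partial>convolution M N) = (\<integral>\<^sup>+x. \<integral>\<^sup>+y. f (x + y) \<partial>N \<partial>M)"
proof -
  interpret M: sigma_finite_measure M by fact
  interpret N: sigma_finite_measure N by fact
  interpret pair_sigma_finite M N ..
  show ?thesis
    unfolding convolution_def
    by (simp add: nn_integral_distr N.nn_integral_fst[symmetric])
qed

section \<open>Laplace transforms of convolution powers and of the renewal measure\<close>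

lemma emeasure_convolution_negative:
  assumes M: "locally_finite_measure M" and N: "locally_finite_measure N"
  shows "emeasure (M \<star> N) {..<0} = 0"
proof -
  have "emeasure (M \<star> N) {..<0} = (\<integral>\<^sup>+x. indicator {..<0} x \<partial>(M \<star> N))" by simp
  also have "\<dots> = (\<integral>\<^sup>+x. \<integral>\<^sup>+y. indicator {..<0} (x + y) \<partial>N \<partial>M)"
    by (intro nn_integral_convolution_sigma_finite locally_finite_measure_sigma_finite
        locally_finite_measureD(1) M N) auto
  also have "\<dots> = (\<integral>\<^sup>+x. 0 \<partial>M)"
  proof (rule nn_integral_cong_AE, use locally_finite_measureD(3)[OF M] in eventually_elim)
    case (elim x)
    have "(\<integral>\<^sup>+y. indicator {..<0} (x + y) \<partial>N) = (\<integral>\<^sup>+y. 0 \<partial>N)"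
      by (rule nn_integral_cong_AE, use locally_finite_measureD(3)[OF N] in eventually_elim) (use elim in auto)
    then show ?case by simp
  qed
  finally show ?thesis by simp
qed

text \<open>The left side integrates over the whole line, so the formula is available before
  \<open>M \<star> N\<close> is known to be locally finite.\<close>

lemma nn_integral_exp_convolution:
  assumes M: "locally_finite_measure M" and N: "locally_finite_measure N"
  shows "(\<integral>\<^sup>+x. ennreal (exp (- s * x)) \<partial>(M \<star> N)) = nn_laplace M s * nn_laplace N s"
proof -
  have [measurable]: "(\<lambda>x. ennreal (exp (- s * x))) \<in> borel_measurable N"
    by (subst measurable_cong_sets[OF locally_finite_measureD(1)[OF N] refl]) measurable
  have [measurable]: "(\<lambda>x. ennreal (exp (- s * x))) \<in> borel_measurable M"
    by (subst measurable_cong_sets[OF locally_finite_measureD(1)[OF M] refl]) measurable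
  have "(\<integral>\<^sup>+x. ennreal (exp (- s * x)) \<partial>(M \<star> N)) = (\<integral>\<^sup>+x. \<integral>\<^sup>+y. ennreal (exp (- s * (x + y))) \<partial>N \<partial>M)"
    by (intro nn_integral_convolution_sigma_finite locally_finite_measure_sigma_finite
        locally_finite_measureD(1) M N) auto
  also have "\<dots> = (\<integral>\<^sup>+x. ennreal (exp (- s * x)) * nn_laplace N s \<partial>M)"
  proof (rule nn_integral_cong)
    fix x
    have "(\<integral>\<^sup>+y. ennreal (exp (- s * (x + y))) \<partial>N) = (\<integral>\<^sup>+y. ennreal (exp (- s * x)) * ennreal (exp (- s * y)) \<partial>N)"
      by (simp only: distrib_left exp_add ennreal_mult exp_ge_zero)
    also have "\<dots> = ennreal (exp (- s * x)) * nn_laplace N s"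
      unfolding nn_laplace_eq[OF N] by (rule nn_integral_cmult) measurable
    finally show "(\<integral>\<^sup>+y. ennreal (exp (- s * (x + y))) \<partial>N) = ennreal (exp (- s * x)) * nn_laplace N s" .
  qed
  also have "\<dots> = nn_laplace M s * nn_laplace N s"
    unfolding nn_laplace_eq[OF M] by (rule nn_integral_multc) measurable
  finally show ?thesis .
qed

context
  fixes \<mu> :: "'p::finite \<Rightarrow> 'p \<Rightarrow> real measure" and s :: real
  assumes lfm: "\<And>i j. locally_finite_measure (\<mu> i j)"
    and fin: "\<And>i j. nn_laplace (\<mu> i j) s < \<infinity>"
begin

text \<open>The two properties go through the induction together: local finiteness permits the
  product formula for the next power, and finiteness of the product gives its local
  finiteness.\<close>

lemma conv_power_locally_finite:
  "locally_finite_measure (conv_power \<mu> n i j) \<and> nn_laplace (conv_power \<mu> n i j) s < \<infinity>"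
proof (induction n arbitrary: i j)
  case 0
  have "emeasure (conv_power \<mu> 0 i j) {..<0} = 0" "nn_laplace (conv_power \<mu> 0 i j) s < \<infinity>"
    by (auto simp: nn_laplace_def nn_integral_return)
  then show ?case using locally_finite_measureI_nn_laplace[of "conv_power \<mu> 0 i j" s] by simp
next
  case (Suc n)
  have neg: "emeasure (conv_power \<mu> (Suc n) i j) {..<0} = 0"
    using Suc lfm by (simp add: emeasure_mat_convolution emeasure_convolution_negative)
  have "nn_laplace (conv_power \<mu> (Suc n) i j) s \<le> (\<integral>\<^sup>+x. ennreal (exp (- s * x)) \<partial>conv_power \<mu> (Suc n) i j)"
    unfolding nn_laplace_def by (intro nn_integral_mono) (auto simp: indicator_def)
  also have "\<dots> = (\<Sum>k\<in>UNIV. nn_laplace (\<mu> i k) s * nn_laplace (conv_power \<mu> n k j) s)"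
    using Suc lfm unfolding conv_power.simps
    by (subst nn_integral_mat_convolution) (measurable, intro sum.cong refl nn_integral_exp_convolution, auto)
  also have "\<dots> < \<infinity>" using fin Suc by (auto simp: ennreal_mult_less_top)
  finally show ?case using neg locally_finite_measureI_nn_laplace[of "conv_power \<mu> (Suc n) i j" s] by simp
qed

lemma nn_laplace_conv_power_0: "nn_laplace (conv_power \<mu> 0 i j) s = (if i = j then 1 else 0)"
  by (auto simp: nn_laplace_def nn_integral_return)

lemma nn_laplace_conv_power_Suc:
  "nn_laplace (conv_power \<mu> (Suc n) i j) s = (\<Sum>k\<in>UNIV. nn_laplace (\<mu> i k) s * nn_laplace (conv_power \<mu> n k j) s)"
proof -
  have "nn_laplace (conv_power \<mu> (Suc n) i j) s = (\<integral>\<^sup>+x. ennreal (exp (- s * x)) \<partial>conv_power \<mu> (Suc n) i j)"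
    using conv_power_locally_finite nn_laplace_eq by blast
  also have "\<dots> = (\<Sum>k\<in>UNIV. nn_laplace (\<mu> i k) s * nn_laplace (conv_power \<mu> n k j) s)"
    using conv_power_locally_finite lfm unfolding conv_power.simps
    by (subst nn_integral_mat_convolution) (measurable, intro sum.cong refl nn_integral_exp_convolution, auto)
  finally show ?thesis .
qed

lemma nn_laplace_renewal_measure:
  "nn_laplace (renewal_measure \<mu> i j) s = (\<Sum>n. nn_laplace (conv_power \<mu> n i j) s)"
  unfolding nn_laplace_def by (rule nn_integral_renewal_measure) measurable

text \<open>The transform of U = I + \<mu> * U, obtained by splitting off the term n = 0. In
  \<open>ennreal\<close> it holds even before the transform of U is known to be finite.\<close>

lemma nn_laplace_renewal_equation:
  "nn_laplace (renewal_measure \<mu> i j) s =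
    (if i = j then 1 else 0) + (\<Sum>k\<in>UNIV. nn_laplace (\<mu> i k) s * nn_laplace (renewal_measure \<mu> k j) s)"
proof -
  have "nn_laplace (renewal_measure \<mu> i j) s =
      (\<Sum>n. nn_laplace (conv_power \<mu> (n + 1) i j) s) + (\<Sum>n<1. nn_laplace (conv_power \<mu> n i j) s)"
    unfolding nn_laplace_renewal_measure by (rule suminf_offset) simp
  also have "(\<Sum>n. nn_laplace (conv_power \<mu> (n + 1) i j) s) =
      (\<Sum>n. \<Sum>k\<in>UNIV. nn_laplace (\<mu> i k) s * nn_laplace (conv_power \<mu> n k j) s)"
    unfolding Suc_eq_plus1[symmetric] nn_laplace_conv_power_Suc ..
  also have "\<dots> = (\<Sum>k\<in>UNIV. nn_laplace (\<mu> i k) s * nn_laplace (renewal_measure \<mu> k j) s)"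
    unfolding nn_laplace_renewal_measure by (subst suminf_sum) auto
  finally show ?thesis using nn_laplace_conv_power_0 by (simp add: add.commute)
qed

text \<open>The n-th power has transform at most q^n v_i, by induction starting from
  \<open>1 \<le> v i\<close>; the series is then geometric.\<close>

lemma nn_laplace_renewal_finite:
  assumes v: "\<And>i. 1 \<le> v i" and q: "0 \<le> q" "q < 1"
    and contr: "\<And>i. (\<Sum>k\<in>UNIV. enn2real (nn_laplace (\<mu> i k) s) * v k) \<le> q * v i"
  shows "nn_laplace (renewal_measure \<mu> i j) s < \<infinity>"
proof -
  have v0: "0 \<le> v i" for i using v[of i] by simp
  have A: "nn_laplace (\<mu> i k) s = ennreal (enn2real (nn_laplace (\<mu> i k) s))" for i k
    using fin[of i k] by simp
  have bound: "nn_laplace (conv_power \<mu> n i j) s \<le> ennreal (q ^ n * v i)" for n i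
  proof (induction n arbitrary: i)
    case 0
    have "nn_laplace (conv_power \<mu> 0 i j) s \<le> ennreal 1" unfolding nn_laplace_conv_power_0 by simp
    also have "\<dots> \<le> ennreal (v i)" using v by (rule ennreal_leI)
    finally show ?case by simp
  next
    case (Suc n)
    have "nn_laplace (conv_power \<mu> (Suc n) i j) s \<le> (\<Sum>k\<in>UNIV. ennreal (enn2real (nn_laplace (\<mu> i k) s)) * ennreal (q ^ n * v k))"
      unfolding nn_laplace_conv_power_Suc A[symmetric] by (intro sum_mono mult_left_mono Suc) auto
    also have "\<dots> = ennreal (\<Sum>k\<in>UNIV. enn2real (nn_laplace (\<mu> i k) s) * (q ^ n * v k))"
      using q v0 by (subst sum_ennreal[symmetric]) (auto simp: ennreal_mult)
    also have "(\<Sum>k\<in>UNIV. enn2real (nn_laplace (\<mu> i k) s) * (q ^ n * v k)) = q ^ n * (\<Sum>k\<in>UNIV. enn2real (nn_laplace (\<mu> i k) s) * v k)"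
      by (simp add: sum_distrib_left mult_ac)
    also have "\<dots> \<le> q ^ n * (q * v i)" using q contr by (intro mult_left_mono) auto
    finally show ?case by (simp add: mult_ac ennreal_leI)
  qed
  have "nn_laplace (renewal_measure \<mu> i j) s \<le> (\<Sum>n. ennreal (q ^ n * v i))"
    unfolding nn_laplace_renewal_measure by (intro suminf_le bound) auto
  also have "\<dots> = ennreal (\<Sum>n. q ^ n * v i)"
    using q v0 by (intro suminf_ennreal2) (auto intro!: summable_mult2 summable_geometric)
  finally show ?thesis by (simp add: le_less_trans)
qed

end

lemma locally_finite_renewal_measure:
  assumes lfm: "\<And>i j. locally_finite_measure (\<mu> i j)" and fin: "\<And>i j. nn_laplace (\<mu> i j) s < \<infinity>"
    and "nn_laplace (renewal_measure \<mu> i j) s < \<infinity>"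
  shows "locally_finite_measure (renewal_measure \<mu> i j)"
proof (rule locally_finite_measureI_nn_laplace[where s=s])
  have "emeasure (conv_power \<mu> n i j) {..<0} = 0" for n
    using conv_power_locally_finite[where \<mu>=\<mu> and s=s and n=n and i=i and j=j, OF lfm fin] by (auto simp: locally_finite_measure_def)
  then show "emeasure (renewal_measure \<mu> i j) {..<0} = 0" by (simp add: emeasure_renewal_measure)
qed (use assms in auto)

section \<open>The characteristic matrix \<open>mat 1 - laplace_mat \<mu> z\<close> on a
  half-plane\<close>

lemma laplace_mat_nth: "laplace_mat \<mu> z $ i $ j = laplace (\<mu> i j) z"
  by (simp add: laplace_mat_def laplace_def)

lemma laplace_dom_iff: "z \<in> laplace_dom \<mu> \<longleftrightarrow> (\<forall>i j. nn_laplace (\<mu> i j) (Re z) < \<infinity>)"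
  by (simp add: laplace_dom_def nn_laplace_def)

context
  fixes \<mu> :: "'p::finite \<Rightarrow> 'p \<Rightarrow> real measure" and a :: real
  assumes lfm: "\<And>i j. locally_finite_measure (\<mu> i j)"
    and fin: "\<And>i j. nn_laplace (\<mu> i j) a < \<infinity>"
begin

lemma laplace_mat_fin: "a \<le> s \<Longrightarrow> nn_laplace (\<mu> i j) s < \<infinity>"
  using nn_laplace_antimono[of a s "\<mu> i j"] fin[of i j] by (rule le_less_trans)

lemma laplace_dom_halfplane: "a \<le> Re z \<Longrightarrow> z \<in> laplace_dom \<mu>"
  by (simp add: laplace_dom_iff laplace_mat_fin[unfolded infinity_ennreal_def])

lemma holomorphic_char_mat: "(\<lambda>z. (mat 1 - laplace_mat \<mu> z) $ i $ j) holomorphic_on {z. a < Re z}"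
  using holomorphic_laplace[OF lfm fin]
  by (auto simp: laplace_mat_nth intro!: holomorphic_intros)

lemma char_mat_bound: "a \<le> Re z \<Longrightarrow>
  norm ((mat 1 - laplace_mat \<mu> z) $ i $ j) \<le> 1 + (\<Sum>i\<in>UNIV. \<Sum>j\<in>UNIV. enn2real (nn_laplace (\<mu> i j) a))"
proof -
  assume z: "a \<le> Re z"
  have "norm ((mat 1 - laplace_mat \<mu> z) $ i $ j) \<le> norm ((mat 1 :: complex^'p^'p) $ i $ j) + norm (laplace (\<mu> i j) z)"
    by (simp add: laplace_mat_nth norm_triangle_ineq4)
  also have "norm ((mat 1 :: complex^'p^'p) $ i $ j) \<le> 1" by (simp add: mat_def)
  also have "norm (laplace (\<mu> i j) z) \<le> enn2real (nn_laplace (\<mu> i j) (Re z))"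
    by (rule norm_laplace_le[OF lfm fin z])
  also have "\<dots> \<le> enn2real (nn_laplace (\<mu> i j) a)"
    using z fin by (intro enn2real_mono nn_laplace_antimono) auto
  also have "\<dots> \<le> (\<Sum>j\<in>UNIV. enn2real (nn_laplace (\<mu> i j) a))" by (intro member_le_sum) auto
  also have "\<dots> \<le> (\<Sum>i\<in>UNIV. \<Sum>j\<in>UNIV. enn2real (nn_laplace (\<mu> i j) a))"
    by (rule member_le_sum[of i UNIV "\<lambda>i. \<Sum>j\<in>UNIV. enn2real (nn_laplace (\<mu> i j) a)"]) (auto intro: sum_nonneg)
  finally show ?thesis by simp
qed

text \<open>For v = 1 + B v with B the matrix of atoms, B v = v - 1 is strictly below q v, and
  strictness survives when B is replaced by the transform at large s.\<close>

lemma eventually_contraction: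
  assumes "spectral_radius (atom_zero_mat \<mu>) < 1"
  shows "\<exists>v q. (\<forall>i. 1 \<le> v i) \<and> 0 \<le> q \<and> q < 1 \<and>
    (\<forall>\<^sub>F s in at_top. \<forall>i. (\<Sum>k\<in>UNIV. enn2real (nn_laplace (\<mu> i k) s) * v k) \<le> q * v i)"
proof -
  define B :: "real^'p^'p" where "B = (\<chi> i j. measure (\<mu> i j) {0})"
  have "spectral_radius (\<chi> i j. complex_of_real (B $ i $ j)) < 1"
    using assms by (simp add: B_def atom_zero_mat_def)
  then have "det (mat 1 - s *\<^sub>R B) \<noteq> 0" if "0 \<le> s" "s \<le> 1" for s
    using that by (rule det_nonzero_of_spectral_radius)
  moreover have "0 \<le> B $ i $ j" for i j by (simp add: B_def)
  ultimately have "\<exists>v. \<forall>i. 1 \<le> v i \<and> v i = 1 + (\<Sum>k\<in>UNIV. B $ i $ k * v k)"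
    by (intro neumann_vector_exists)
  then obtain v where v: "\<And>i. 1 \<le> v i" "\<And>i. v i = 1 + (\<Sum>k\<in>UNIV. B $ i $ k * v k)" by blast
  define w where "w = Max (range v)"
  have w: "v i \<le> w" for i unfolding w_def by (intro Max_ge) auto
  have w1: "1 \<le> w" using v(1) w by (rule order_trans)
  \<comment> \<open>As \<open>w\<close> is the maximum of \<open>v\<close>, the loss v_i / (2 w) is
    at most 1/2, so q v_i still exceeds v_i - 1.\<close>
  define q where "q = 1 - 1 / (2 * w)"
  have q: "0 \<le> q" "q < 1" using w1 by (auto simp: q_def field_simps)
  have "\<forall>\<^sub>F s in at_top. (\<Sum>k\<in>UNIV. enn2real (nn_laplace (\<mu> i k) s) * v k) \<le> q * v i" for i
  proof -
    have "((\<lambda>s. \<Sum>k\<in>UNIV. enn2real (nn_laplace (\<mu> i k) s) * v k) \<longlongrightarrow> (\<Sum>k\<in>UNIV. B $ i $ k * v k)) at_top"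
      unfolding B_def vec_lambda_beta by (intro tendsto_intros nn_laplace_tendsto_atom[OF lfm fin])
    moreover have "(\<Sum>k\<in>UNIV. B $ i $ k * v k) < q * v i"
    proof -
      have "(\<Sum>k\<in>UNIV. B $ i $ k * v k) = v i - 1" using v(2)[of i] by linarith
      moreover have "v i / (2 * w) < 1" using w[of i] w1 by (simp add: field_simps)
      ultimately show ?thesis by (simp add: q_def algebra_simps)
    qed
    ultimately have "\<forall>\<^sub>F s in at_top. (\<Sum>k\<in>UNIV. enn2real (nn_laplace (\<mu> i k) s) * v k) < q * v i"
      by (rule order_tendstoD(2))
    then show ?thesis by eventually_elim simp
  qed
  then have "\<forall>\<^sub>F s in at_top. \<forall>i. (\<Sum>k\<in>UNIV. enn2real (nn_laplace (\<mu> i k) s) * v k) \<le> q * v i"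
    by (rule eventually_all_finite)
  then show ?thesis using v(1) q by blast
qed

context
  fixes v :: "'p \<Rightarrow> real" and q :: real
  assumes v: "\<And>i. 1 \<le> v i" and q: "0 \<le> q" "q < 1"
    and contr: "\<And>i. (\<Sum>k\<in>UNIV. enn2real (nn_laplace (\<mu> i k) a) * v k) \<le> q * v i"
begin

lemma norm_laplace_mat_le: "a \<le> Re z \<Longrightarrow> norm (laplace_mat \<mu> z $ i $ j) \<le> enn2real (nn_laplace (\<mu> i j) a)"
proof -
  assume z: "a \<le> Re z"
  have "norm (laplace_mat \<mu> z $ i $ j) \<le> enn2real (nn_laplace (\<mu> i j) (Re z))"
    unfolding laplace_mat_nth by (rule norm_laplace_le[OF lfm fin z])
  also have "\<dots> \<le> enn2real (nn_laplace (\<mu> i j) a)"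
    using z fin by (intro enn2real_mono nn_laplace_antimono) auto
  finally show ?thesis .
qed

text \<open>Here \<open>a\<close> lies so far to the right that the contraction holds at
  \<open>a\<close>, whose entries dominate those at \<open>z\<close>. A kernel vector is a fixed
  point of the contraction, hence 0.\<close>

lemma char_det_nonzero_right: assumes z: "a \<le> Re z" shows "det (mat 1 - laplace_mat \<mu> z) \<noteq> 0"
proof -
  have "x = 0" if "(mat 1 - laplace_mat \<mu> z) *v x = 0" for x
  proof -
    have "x = 0 + laplace_mat \<mu> z *v x" using that by (simp add: matrix_vector_mult_diff_rdistrib)
    then have "norm (x $ i) \<le> 0 / (1 - q) * v i" for i
      using weighted_contraction_bound[OF v contr q(2) norm_laplace_mat_le[OF z], of 0 0 x i] by simp
    then show ?thesis by (simp add: vec_eq_iff)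
  qed
  then have "invertible (mat 1 - laplace_mat \<mu> z)"
    unfolding invertible_left_inverse matrix_left_invertible_ker by blast
  then show ?thesis by (simp add: invertible_det_nz)
qed

text \<open>Column \<open>j\<close> of the inverse solves w = e_j + L w, so the contraction bound
  applies with \<beta> = 1.\<close>

lemma char_inverse_bound_right:
  assumes z: "a \<le> Re z"
  shows "norm (matrix_inv (mat 1 - laplace_mat \<mu> z) $ i $ j) \<le> v i / (1 - q)"
proof -
  define F where "F = matrix_inv (mat 1 - laplace_mat \<mu> z)"
  have "(mat 1 - laplace_mat \<mu> z) ** F = mat 1"
    unfolding F_def using char_det_nonzero_right[OF z] by (intro invertible_matrix_inv) (simp add: invertible_det_nz)
  then have "((mat 1 - laplace_mat \<mu> z) ** F) *v axis j 1 = axis j 1" by simp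
  then have "(mat 1 - laplace_mat \<mu> z) *v (F *v axis j 1) = axis j 1"
    by (simp only: matrix_vector_mul_assoc)
  then have "F *v axis j 1 = axis j 1 + laplace_mat \<mu> z *v (F *v axis j 1)"
    by (simp add: matrix_vector_mult_diff_rdistrib diff_eq_eq)
  then have "norm ((F *v axis j 1) $ i) \<le> 1 / (1 - q) * v i"
    by (intro weighted_contraction_bound[OF v contr q(2) norm_laplace_mat_le[OF z], of "axis j 1"])
       (simp_all add: axis_def)
  moreover have "(F *v axis j 1) $ i = F $ i $ j" by (simp add: matrix_vector_mul_component inner_axis' axis_def matrix_vector_mult_def if_distrib cong: if_cong)
  ultimately show ?thesis by (simp add: F_def)
qed

lemma renewal_laplace_fin: "nn_laplace (renewal_measure \<mu> i j) a < \<infinity>"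
  using nn_laplace_renewal_finite[OF lfm fin v q contr] .

lemma renewal_locally_finite: "locally_finite_measure (renewal_measure \<mu> i j)"
  using locally_finite_renewal_measure[OF lfm fin renewal_laplace_fin] .

text \<open>At real \<open>s\<close> the renewal equation relates finite nonnegative numbers and
  becomes the matrix identity (I - L) Y = I.\<close>

lemma laplace_renewal_measure_real:
  assumes s: "a \<le> s"
  shows "laplace (renewal_measure \<mu> i j) (of_real s) = matrix_inv (mat 1 - laplace_mat \<mu> (of_real s)) $ i $ j"
proof -
  define Y :: "'p \<Rightarrow> 'p \<Rightarrow> real" where "Y i j = enn2real (nn_laplace (renewal_measure \<mu> i j) s)" for i j
  define A :: "'p \<Rightarrow> 'p \<Rightarrow> real" where "A i j = enn2real (nn_laplace (\<mu> i j) s)" for i j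
  have A: "nn_laplace (\<mu> i j) s = ennreal (A i j)" for i j
    using laplace_mat_fin[OF s, of i j] by (simp add: A_def)
  have "nn_laplace (renewal_measure \<mu> i j) s < \<infinity>" for i j
    using nn_laplace_antimono[OF s] renewal_laplace_fin by (rule le_less_trans)
  then have Y: "nn_laplace (renewal_measure \<mu> i j) s = ennreal (Y i j)" for i j by (simp add: Y_def)
  have nn: "0 \<le> A i j" "0 \<le> Y i j" for i j by (auto simp: A_def Y_def)
  have eq: "Y i j = (if i = j then 1 else 0) + (\<Sum>k\<in>UNIV. A i k * Y k j)" for i j
  proof -
    have "ennreal (Y i j) = (if i = j then 1 else 0) + (\<Sum>k\<in>UNIV. ennreal (A i k) * ennreal (Y k j))"
      using nn_laplace_renewal_equation[where \<mu>=\<mu> and s=s and i=i and j=j, OF lfm laplace_mat_fin[OF s]] unfolding A Y .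
    also have "\<dots> = ennreal (if i = j then 1 else 0) + ennreal (\<Sum>k\<in>UNIV. A i k * Y k j)"
      using nn by (subst sum_ennreal[symmetric]) (auto simp: ennreal_mult)
    also have "\<dots> = ennreal ((if i = j then 1 else 0) + (\<Sum>k\<in>UNIV. A i k * Y k j))"
      using nn by (intro ennreal_plus[symmetric]) (auto intro!: sum_nonneg)
    finally show ?thesis using nn by (subst (asm) ennreal_inj) (auto intro!: add_nonneg_nonneg sum_nonneg)
  qed
  define Ym :: "complex^'p^'p" where "Ym = (\<chi> i j. of_real (Y i j))"
  have L: "laplace_mat \<mu> (of_real s) $ i $ j = of_real (A i j)" for i j
    unfolding laplace_mat_nth A_def by (rule laplace_of_real[OF lfm fin s])
  have "(mat 1 - laplace_mat \<mu> (of_real s)) ** Ym = mat 1"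
  proof -
    have "((mat 1 - laplace_mat \<mu> (of_real s)) ** Ym) $ i $ j = mat 1 $ i $ j" for i j
    proof -
      have "((mat 1 - laplace_mat \<mu> (of_real s)) ** Ym) $ i $ j = Ym $ i $ j - (\<Sum>k\<in>UNIV. of_real (A i k) * Ym $ k $ j)"
        by (simp add: matrix_matrix_mult_def mat_def left_diff_distrib sum_subtractf L if_distrib[of "\<lambda>x. x * _"] cong: if_cong)
      also have "\<dots> = of_real (Y i j - (\<Sum>k\<in>UNIV. A i k * Y k j))" by (simp add: Ym_def)
      also have "Y i j - (\<Sum>k\<in>UNIV. A i k * Y k j) = (if i = j then 1 else 0)" using eq[of i j] by linarith
      finally show ?thesis by (simp add: mat_def)
    qed
    then show ?thesis by (simp add: vec_eq_iff)
  qed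
  then have "matrix_inv (mat 1 - laplace_mat \<mu> (of_real s)) = Ym" by (rule matrix_inv_eqI)
  moreover have "laplace (renewal_measure \<mu> i j) (of_real s) = of_real (Y i j)"
    unfolding Y_def by (rule laplace_of_real[OF renewal_locally_finite renewal_laplace_fin s])
  ultimately show ?thesis by (simp add: Ym_def)
qed

text \<open>Identity theorem: both sides are holomorphic on the half-plane and agree on its real
  half-line.\<close>

lemma laplace_renewal_measure:
  assumes z: "a < Re z"
  shows "laplace (renewal_measure \<mu> i j) z = matrix_inv (mat 1 - laplace_mat \<mu> z) $ i $ j"
proof -
  let ?H = "{z. a < Re z}"
  define f where "f z = laplace (renewal_measure \<mu> i j) z
    - adjugate_entry (mat 1 - laplace_mat \<mu> z) i j / det (mat 1 - laplace_mat \<mu> z)" for z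
  have inv: "matrix_inv (mat 1 - laplace_mat \<mu> z) $ i $ j =
      adjugate_entry (mat 1 - laplace_mat \<mu> z) i j / det (mat 1 - laplace_mat \<mu> z)" if "a \<le> Re z" for z
    by (rule matrix_inv_adjugate[OF char_det_nonzero_right[OF that]])
  have "f z = 0"
  proof (rule analytic_continuation[where f=f and w=z and S="?H" and U="of_real ` {a<..}" and \<xi>="of_real (a + 1)"])
    show "f holomorphic_on ?H" unfolding f_def
      by (intro holomorphic_intros holomorphic_laplace[OF renewal_locally_finite renewal_laplace_fin]
          holomorphic_on_adjugate_entry holomorphic_on_det holomorphic_char_mat) (simp add: char_det_nonzero_right)
    show "open ?H" by (rule open_halfspace_Re_gt)
    show "connected ?H" by (intro convex_connected convex_halfspace_Re_gt)
    show "complex_of_real (a + 1) islimpt of_real ` {a<..}"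
      unfolding islimpt_approachable
    proof (intro allI impI)
      fix e :: real assume "e > 0"
      then show "\<exists>x'\<in>complex_of_real ` {a<..}. x' \<noteq> of_real (a + 1) \<and> dist x' (of_real (a + 1)) < e"
        by (intro bexI[of _ "of_real (a + 1 + e / 2)"])
           (auto simp: dist_norm simp flip: of_real_add of_real_diff intro!: imageI)
    qed
    show "f u = 0" if "u \<in> of_real ` {a<..}" for u
      using that laplace_renewal_measure_real inv by (auto simp: f_def)
  qed (use z in auto)
  then show ?thesis using inv z by (simp add: f_def)
qed

end

text \<open>A \<open>LEAST\<close> has its defining property only if some number does. The zero
  order of the determinant at \<rho> is such a number: if det = (z - \<rho>)^n g, then adjugate / g
  is the holomorphic extension. The point \<open>z0\<close> excludes a determinant that vanishes
  identically.\<close>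

lemma pole_order_property:
  assumes \<rho>: "\<rho> \<in> roots \<mu>" "a < Re \<rho>"
    and nz: "a < Re z0" "det (mat 1 - laplace_mat \<mu> z0) \<noteq> 0"
  shows "\<exists>S (G :: complex \<Rightarrow> complex^'p^'p). open S \<and> \<rho> \<in> S \<and> (\<forall>i j. (\<lambda>z. G z $ i $ j) holomorphic_on S) \<and>
    (\<forall>z\<in>S - {\<rho>}. \<forall>i j. G z $ i $ j = (z - \<rho>) ^ pole_order \<mu> \<rho> * matrix_inv (mat 1 - laplace_mat \<mu> z) $ i $ j)"
proof -
  let ?H = "{z. a < Re z}"
  define d where "d z = det (mat 1 - laplace_mat \<mu> z)" for z
  define P where "P k \<longleftrightarrow> 1 \<le> k \<and>
           (\<exists>S (G :: complex \<Rightarrow> complex^'p^'p).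
              open S \<and> \<rho> \<in> S \<and> S - {\<rho>} \<subseteq> laplace_dom \<mu> - roots \<mu> \<and>
              (\<forall>i j. (\<lambda>z. G z $ i $ j) holomorphic_on S) \<and>
              (\<forall>z\<in>S - {\<rho>}. \<forall>i j.
                 G z $ i $ j = (z - \<rho>) ^ k * matrix_inv (mat 1 - laplace_mat \<mu> z) $ i $ j))" for k
  have "\<exists>k. P k"
  proof -
    have holo: "d holomorphic_on ?H" unfolding d_def by (intro holomorphic_on_det holomorphic_char_mat)
    have d\<rho>: "d \<rho> = 0" using \<rho> by (simp add: roots_def d_def)
    have "\<not> d constant_on ?H"
    proof
      assume "d constant_on ?H"
      then obtain y where "\<And>z. z \<in> ?H \<Longrightarrow> d z = y" by (auto simp: constant_on_def)
      then have "d z0 = d \<rho>" using \<rho>(2) nz(1) by simp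
      then show False using d\<rho> nz(2) by (simp add: d_def)
    qed
    then obtain g r n where g: "0 < n" "0 < r" "ball \<rho> r \<subseteq> ?H" "g holomorphic_on ball \<rho> r"
      "\<And>w. w \<in> ball \<rho> r \<Longrightarrow> d w = (w - \<rho>) ^ n * g w" "\<And>w. w \<in> ball \<rho> r \<Longrightarrow> g w \<noteq> 0"
      using holomorphic_factor_zero_nonconstant[OF holo open_halfspace_Re_gt convex_connected[OF convex_halfspace_Re_gt], of \<rho>]
        \<rho>(2) d\<rho> by (metis mem_Collect_eq)
    define G :: "complex \<Rightarrow> complex^'p^'p" where
      "G z = (\<chi> i j. adjugate_entry (mat 1 - laplace_mat \<mu> z) i j / g z)" for z
    have "G z $ i $ j = (z - \<rho>) ^ n * matrix_inv (mat 1 - laplace_mat \<mu> z) $ i $ j" if z: "z \<in> ball \<rho> r - {\<rho>}" for z i j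
    proof -
      have "d z \<noteq> 0" using g(5,6)[of z] z by simp
      then have "matrix_inv (mat 1 - laplace_mat \<mu> z) $ i $ j = adjugate_entry (mat 1 - laplace_mat \<mu> z) i j / d z"
        unfolding d_def by (rule matrix_inv_adjugate)
      then show ?thesis using g(5,6)[of z] z by (simp add: G_def)
    qed
    moreover have "(\<lambda>z. G z $ i $ j) holomorphic_on ball \<rho> r" for i j
      unfolding G_def vec_lambda_beta using g(3,4,6)
      by (intro holomorphic_on_divide holomorphic_on_adjugate_entry holomorphic_on_subset[OF holomorphic_char_mat]) auto
    moreover have "ball \<rho> r - {\<rho>} \<subseteq> laplace_dom \<mu> - roots \<mu>"
    proof
      fix z assume z: "z \<in> ball \<rho> r - {\<rho>}"
      then have "a < Re z" using g(3) by auto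
      moreover have "d z \<noteq> 0" using g(5,6)[of z] z by simp
      ultimately show "z \<in> laplace_dom \<mu> - roots \<mu>"
        using laplace_dom_halfplane[of z] by (auto simp: roots_def d_def)
    qed
    ultimately have "P n" unfolding P_def using g(1,2)
      by (intro conjI exI[of _ "ball \<rho> r"] exI[of _ G]) auto
    then show ?thesis ..
  qed
  then have "P (LEAST k. P k)" by (rule LeastI_ex)
  moreover have "pole_order \<mu> \<rho> = (LEAST k. P k)" using \<rho>(1) by (simp add: pole_order_def P_def)
  ultimately have "P (pole_order \<mu> \<rho>)" by simp
  then show ?thesis unfolding P_def by blast
qed

end

text \<open>From det A det A^(-1) = 1. In this form the uniform bound on the inverse enters the
  complex analysis.\<close>

lemma norm_det_ge:
  fixes A :: "complex^'n^'n"
  assumes "det A \<noteq> 0" "\<And>i j. norm (matrix_inv A $ i $ j) \<le> B" "0 < B"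
  shows "1 / (fact CARD('n) * B ^ CARD('n)) \<le> norm (det A)"
proof -
  have "A ** matrix_inv A = mat 1" using assms(1) by (simp add: invertible_matrix_inv invertible_det_nz)
  then have "det A * det (matrix_inv A) = 1" by (metis det_mul det_I)
  then have "1 = norm (det A) * norm (det (matrix_inv A))" by (metis norm_mult norm_one)
  also have "\<dots> \<le> norm (det A) * (fact CARD('n) * B ^ CARD('n))"
    using assms(2) by (intro mult_left_mono norm_det_le) auto
  finally show ?thesis using assms(3) by (simp add: divide_le_eq)
qed

theorem theorem2p3:
  fixes \<mu> :: "'p::finite \<Rightarrow> 'p \<Rightarrow> real measure" and \<theta> :: real
  assumes "\<And>i j. locally_finite_measure (\<mu> i j)"
    and "non_lattice \<mu>"
    and "complex_of_real \<theta> \<in> interior (laplace_dom \<mu>)"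
    and "spectral_radius (atom_zero_mat \<mu>) < 1"
    and "\<And>\<eta>::real. invertible (mat 1 - laplace_mat \<mu> (Complex \<theta> \<eta>))"
    and "bdd_above (range (\<lambda>\<eta>::real. norm (matrix_inv (mat 1 - laplace_mat \<mu> (Complex \<theta> \<eta>)))))"
    and "finite (roots_above \<mu> \<theta>)"
  shows "\<exists>C :: complex \<Rightarrow> nat \<Rightarrow> complex^'p^'p. \<forall>i j.
    (\<lambda>t::real. complex_of_real (renewal_fun \<mu> t $ i $ j)
        - ((\<Sum>\<rho>\<in>roots_above \<mu> \<theta>. exp (\<rho> * complex_of_real t) *
              (\<Sum>k<pole_order \<mu> \<rho>. complex_of_real t ^ k * C \<rho> k $ i $ j))
           + complex_of_real t ^ pole_order \<mu> 0 * C 0 (pole_order \<mu> 0) $ i $ j))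
      \<in> O[at_top](\<lambda>t. complex_of_real (t * exp (\<theta> * t)))"
proof -
  note lfm = assms(1)
  define R where "R = roots_above \<mu> \<theta>"
  define F where "F z = matrix_inv (mat 1 - laplace_mat \<mu> z)" for z
  define d where "d z = det (mat 1 - laplace_mat \<mu> z)" for z
  define adj where "adj i j z = adjugate_entry (mat 1 - laplace_mat \<mu> z) i j" for i j z

  obtain e0 where e0: "e0 > 0" "ball (complex_of_real \<theta>) e0 \<subseteq> laplace_dom \<mu>"
    using assms(3) by (auto simp: mem_interior)
  \<comment> \<open>A point of the domain to the left of \<theta>; by monotonicity of the real
    transforms the whole half-plane Re z >= a lies in the domain.\<close>
  define a where "a = \<theta> - e0 / 2"
  have a: "a < \<theta>" using e0 by (simp add: a_def)
  have "complex_of_real a \<in> laplace_dom \<mu>"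
    using e0 by (intro subsetD[OF e0(2)]) (auto simp: a_def dist_norm simp flip: of_real_diff)
  then have fin: "nn_laplace (\<mu> i j) a < \<infinity>" for i j by (simp add: laplace_dom_iff)
  note dom = laplace_dom_halfplane[where \<mu>=\<mu> and a=a, OF lfm fin]

  \<comment> \<open>Contraction far to the right\<close>
  obtain v q where v: "\<And>i. 1 \<le> v i" and q: "0 \<le> q" "q < 1"
    and contr: "\<forall>\<^sub>F s in at_top. \<forall>i. (\<Sum>k\<in>UNIV. enn2real (nn_laplace (\<mu> i k) s) * v k) \<le> q * v i"
    using eventually_contraction[OF lfm fin assms(4)] by blast
  obtain s0 where s0: "\<And>s i. s0 \<le> s \<Longrightarrow> (\<Sum>k\<in>UNIV. enn2real (nn_laplace (\<mu> i k) s) * v k) \<le> q * v i"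
    using contr by (auto simp: eventually_at_top_linorder)
  \<comment> \<open>Including \<theta> and 0 makes \<sigma> > \<theta> and \<sigma> > 0, the latter
    for the inversion formula. The step from \<open>s1\<close> to \<sigma> provides the strict
    inequality in \<open>F_laplace\<close>.\<close>
  define s1 where "s1 = max s0 (max \<theta> 0)"
  define \<sigma> where "\<sigma> = s1 + 1"
  have s1: "a \<le> s1" "s0 \<le> s1" and \<sigma>: "\<sigma> > 0" "\<theta> < \<sigma>" "s1 < \<sigma>"
    using a by (auto simp: s1_def \<sigma>_def)
  have fin1: "nn_laplace (\<mu> i j) s1 < \<infinity>" for i j by (rule laplace_mat_fin[OF lfm fin s1(1)])
  note right = lfm fin1 v q s0[OF s1(2)]
  have d_right: "d z \<noteq> 0" if "s1 \<le> Re z" for z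
    unfolding d_def using char_det_nonzero_right[where \<mu>=\<mu> and a=s1 and v=v and q=q, OF right that] .
  have F_right: "norm (F z $ i $ j) \<le> v i / (1 - q)" if "s1 \<le> Re z" for z i j
    unfolding F_def using char_inverse_bound_right[where \<mu>=\<mu> and a=s1 and v=v and q=q, OF right that] .
  have F_laplace: "F z $ i $ j = laplace (renewal_measure \<mu> i j) z" if "s1 < Re z" for z i j
    unfolding F_def using laplace_renewal_measure[where \<mu>=\<mu> and a=s1 and v=v and q=q, OF right that] by simp
  have U_fin: "nn_laplace (renewal_measure \<mu> i j) \<sigma> < \<infinity>" for i j
    using nn_laplace_antimono[of s1 \<sigma>] \<sigma> renewal_laplace_fin[where \<mu>=\<mu> and a=s1 and v=v and q=q, OF right]
    by (meson le_less_trans less_imp_le)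
  have U_lfm: "locally_finite_measure (renewal_measure \<mu> i j)" for i j
    by (rule renewal_locally_finite[where \<mu>=\<mu> and a=s1 and v=v and q=q, OF right])

  \<comment> \<open>Determinant and adjugate on the half-plane Re z >= a\<close>
  define K where "K = 1 + (\<Sum>i\<in>UNIV. \<Sum>j\<in>UNIV. enn2real (nn_laplace (\<mu> i j) a))"
  define N where "N = fact CARD('p) * K ^ CARD('p)"
  have "1 \<le> K" by (simp add: K_def sum_nonneg)
  have entries: "norm ((mat 1 - laplace_mat \<mu> z) $ i $ j) \<le> K" if "a \<le> Re z" for z i j
    unfolding K_def by (rule char_mat_bound[OF lfm fin that])
  have d_bound: "norm (d z) \<le> N" if "a \<le> Re z" for z
    unfolding d_def N_def by (rule norm_det_le[OF entries[OF that]])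
  have adj_bound: "norm (adj i j z) \<le> N" if "a \<le> Re z" for i j z
    unfolding adj_def N_def by (rule norm_adjugate_entry_le[OF entries[OF that] \<open>1 \<le> K\<close>])
  have d_holo: "d holomorphic_on {z. a < Re z}"
    unfolding d_def by (intro holomorphic_on_det holomorphic_char_mat[OF lfm fin])
  have adj_holo: "adj i j holomorphic_on {z. a < Re z}" for i j
    unfolding adj_def by (intro holomorphic_on_adjugate_entry holomorphic_char_mat[OF lfm fin])
  have F_adj: "F z $ i $ j = adj i j z / d z" if "d z \<noteq> 0" for z i j
    using that unfolding F_def adj_def d_def by (rule matrix_inv_adjugate)

  \<comment> \<open>Lower bounds for the determinant\<close>
  obtain B0 where B0: "\<And>y. norm (F (Complex \<theta> y)) \<le> B0"
    using assms(6) by (auto simp: bdd_above_def F_def)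
  \<comment> \<open>A common bound for the inverse on the lines through \<theta> and \<sigma>; the 1
    makes it positive.\<close>
  define B where "B = max 1 (max B0 (Max (range (\<lambda>i. v i / (1 - q)))))"
  define c where "c = 1 / (fact CARD('p) * B ^ CARD('p))"
  have "B > 0" by (simp add: B_def)
  then have "c > 0" by (simp add: c_def)
  have line\<theta>: "c \<le> norm (d (Complex \<theta> y))" for y
    unfolding c_def d_def
  proof (rule norm_det_ge[OF _ _ \<open>B > 0\<close>])
    show "det (mat 1 - laplace_mat \<mu> (Complex \<theta> y)) \<noteq> 0" using assms(5) by (simp add: invertible_det_nz)
    show "norm (matrix_inv (mat 1 - laplace_mat \<mu> (Complex \<theta> y)) $ i $ j) \<le> B" for i j
    proof -
      have "norm (F (Complex \<theta> y) $ i $ j) \<le> norm (F (Complex \<theta> y) $ i)" by (rule Finite_Cartesian_Product.norm_nth_le)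
      also have "\<dots> \<le> norm (F (Complex \<theta> y))" by (rule Finite_Cartesian_Product.norm_nth_le)
      also have "\<dots> \<le> B" using B0[of y] by (simp add: B_def)
      finally show ?thesis by (simp add: F_def)
    qed
  qed
  have line\<sigma>: "c \<le> norm (d (Complex \<sigma> y))" for y
    unfolding c_def d_def
  proof (rule norm_det_ge[OF _ _ \<open>B > 0\<close>])
    have *: "s1 \<le> Re (Complex \<sigma> y)" using \<sigma> by simp
    show "det (mat 1 - laplace_mat \<mu> (Complex \<sigma> y)) \<noteq> 0" using d_right[OF *] by (simp add: d_def)
    show "norm (matrix_inv (mat 1 - laplace_mat \<mu> (Complex \<sigma> y)) $ i $ j) \<le> B" for i j
    proof -
      have "v i / (1 - q) \<le> Max (range (\<lambda>i. v i / (1 - q)))" by (intro Max_ge) auto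
      then have "v i / (1 - q) \<le> B" by (simp add: B_def)
      then show ?thesis using F_right[OF *, of i j] by (simp add: F_def)
    qed
  qed
  have R_eq: "R = {z. \<theta> < Re z \<and> d z = 0}"
    using dom a by (auto simp: R_def roots_above_def roots_def d_def)
  have "finite R" using assms(7) by (simp add: R_def)
  obtain \<delta> e T where \<delta>: "\<delta> > 0" "\<delta> < \<theta> - a" and e: "e > 0"
    and near: "\<And>z. \<bar>Re z - \<theta>\<bar> \<le> \<delta> \<Longrightarrow> e \<le> norm (d z)"
    and strip: "\<And>z. \<theta> - \<delta> \<le> Re z \<Longrightarrow> Re z \<le> \<sigma> \<Longrightarrow> T \<le> \<bar>Im z\<bar> \<Longrightarrow> e \<le> norm (d z)"
  proof (rule strip_lower_bound[OF d_holo _ \<open>c > 0\<close> a \<sigma>(2) line\<theta> line\<sigma>])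
    show "norm (d z) \<le> N" if "a < Re z" for z using d_bound that by simp
    show "finite {z. \<theta> < Re z \<and> d z = 0}" using \<open>finite R\<close> R_eq by simp
  qed (rule that; blast)
  \<comment> \<open>Within \<delta> of \<theta>, nonzero, and positive exactly when \<theta> is:
    \<theta>/2 keeps it positive, and for \<theta> <= 0 it is negative. So 0 is to the right of the
    new line exactly when \<theta> <= 0.\<close>
  define \<theta>' where "\<theta>' = (if \<theta> > 0 then max (\<theta> - \<delta> / 2) (\<theta> / 2) else \<theta> - \<delta> / 2)"
  have \<theta>': "\<theta> - \<delta> < \<theta>'" "\<theta>' < \<theta>" "\<theta>' \<noteq> 0" "0 < \<theta> \<longleftrightarrow> 0 < \<theta>'"
    using \<delta>(1) by (auto simp: \<theta>'_def)
  have aH: "a < Re z" if "\<theta> - \<delta> < Re z" for z using that \<delta> by simp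
  have d_nz: "d z \<noteq> 0" if "\<theta> - \<delta> < Re z" "z \<notin> R" for z
  proof (cases "Re z \<le> \<theta>")
    case True
    then have "e \<le> norm (d z)" using that by (intro near) auto
    then show ?thesis using e by auto
  next
    case False
    then show ?thesis using that(2) by (auto simp: R_eq)
  qed
  have F_holo: "(\<lambda>z. F z $ i $ j) holomorphic_on {z. \<theta> - \<delta> < Re z} - R" for i j
  proof (rule holomorphic_transform)
    show "(\<lambda>z. adj i j z / d z) holomorphic_on {z. \<theta> - \<delta> < Re z} - R"
      using d_nz aH
      by (intro holomorphic_on_divide holomorphic_on_subset[OF adj_holo] holomorphic_on_subset[OF d_holo]) auto
    show "adj i j z / d z = F z $ i $ j" if "z \<in> {z. \<theta> - \<delta> < Re z} - R" for z
      using that d_nz by (auto simp: F_adj)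
  qed
  have F_bound: "norm (F z $ i $ j) \<le> N / e" if "e \<le> norm (d z)" "a \<le> Re z" for z i j
  proof -
    have "d z \<noteq> 0" using that e by auto
    then show ?thesis
      using adj_bound[OF that(2), of i j] that(1) e by (auto simp: F_adj norm_divide intro!: frac_le order_trans[OF norm_ge_zero adj_bound[OF that(2)]])
  qed

  \<comment> \<open>When the shift crosses 0, this point joins as the pole of 1/z^2, whether or not
    it is a root.\<close>
  define P where "P = R \<union> (if \<theta> \<le> 0 then {0} else {})"
  \<comment> \<open>For \<theta> = 0 the point 0 lies on the original line, where the lower bound
    excludes a root. The separate term is then a constant.\<close>
  have pole_0: "pole_order \<mu> 0 = 0" if "0 \<notin> R" "\<theta> \<le> 0"
  proof -
    have "d 0 \<noteq> 0" using that d_nz[of 0] \<delta>(1) by simp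
    then show ?thesis by (simp add: pole_order_def roots_def d_def)
  qed
  define Q where "Q i j c \<longleftrightarrow> (\<lambda>t. complex_of_real (measure (renewal_measure \<mu> i j) {0..t}) -
      (\<Sum>\<rho>\<in>P. exp (\<rho> * of_real t) * (\<Sum>k<pole_order \<mu> \<rho> + (if \<rho> = 0 then 1 else 0). of_real t ^ k * c \<rho> k)))
      \<in> O[at_top](\<lambda>t. of_real (t * exp (\<theta>' * t)))" for i j c
  have "\<exists>c. Q i j c" for i j
    unfolding Q_def
  proof (rule laplace_tauberian[OF U_lfm U_fin \<sigma>(1) \<theta>'(1) _ \<theta>'(3)])
    show "\<theta>' < \<sigma>" using \<theta>' \<sigma> by simp
    show "finite P" using \<open>finite R\<close> by (simp add: P_def)
    show "P \<subseteq> {z. \<theta>' < Re z \<and> Re z < \<sigma>}"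
    proof
      fix z assume z: "z \<in> P"
      show "z \<in> {z. \<theta>' < Re z \<and> Re z < \<sigma>}"
      proof (cases "z \<in> R")
        case True
        then have "\<not> s1 \<le> Re z" using d_right by (auto simp: R_eq)
        then show ?thesis using True \<theta>'(2) \<sigma> by (auto simp: R_eq)
      next
        case False
        then show ?thesis using z \<theta>' \<sigma> by (auto simp: P_def split: if_splits)
      qed
    qed
    show "0 \<in> P" if "\<theta>' < 0" using that \<theta>' by (auto simp: P_def)
    show "(\<lambda>z. F z $ i $ j) holomorphic_on {z. \<theta> - \<delta> < Re z} - P"
      by (rule holomorphic_on_subset[OF F_holo]) (auto simp: P_def)
    show "norm (F (Complex \<theta>' y) $ i $ j) \<le> N / e" for y
      using \<theta>' \<delta> by (intro F_bound near) auto
    show "norm (F z $ i $ j) \<le> N / e" if "\<theta>' \<le> Re z" "Re z \<le> \<sigma>" "T \<le> \<bar>Im z\<bar>" for z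
      using that \<theta>' \<delta> by (intro F_bound strip) auto
    show "F (Complex \<sigma> y) $ i $ j = laplace (renewal_measure \<mu> i j) (Complex \<sigma> y)" for y
      using \<sigma> by (intro F_laplace) simp
  next
    fix \<rho> assume \<rho>: "\<rho> \<in> P"
    show "\<exists>S G. open S \<and> \<rho> \<in> S \<and> G holomorphic_on S \<and>
        (\<forall>z\<in>S - {\<rho>}. F z $ i $ j = G z / (z - \<rho>) ^ pole_order \<mu> \<rho>)"
    proof (cases "\<rho> \<in> R")
      case True
      have "\<exists>S (G :: complex \<Rightarrow> complex^'p^'p). open S \<and> \<rho> \<in> S \<and> (\<forall>i j. (\<lambda>z. G z $ i $ j) holomorphic_on S) \<and>
        (\<forall>z\<in>S - {\<rho>}. \<forall>i j. G z $ i $ j = (z - \<rho>) ^ pole_order \<mu> \<rho> * matrix_inv (mat 1 - laplace_mat \<mu> z) $ i $ j)"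
      proof (rule pole_order_property[where \<mu>=\<mu> and a=a and \<rho>=\<rho> and ?z0.0="complex_of_real \<sigma>", OF lfm fin])
        show "\<rho> \<in> roots \<mu>" using True by (simp add: R_def roots_above_def)
        show "a < Re \<rho>" using True a by (simp add: R_eq)
        show "a < Re (complex_of_real \<sigma>)" using a \<sigma> by simp
        show "det (mat 1 - laplace_mat \<mu> (complex_of_real \<sigma>)) \<noteq> 0" using d_right[of "of_real \<sigma>"] \<sigma> by (simp add: d_def)
      qed
      then obtain S and G :: "complex \<Rightarrow> complex^'p^'p" where S: "open S" "\<rho> \<in> S" "\<forall>i j. (\<lambda>z. G z $ i $ j) holomorphic_on S"
        and G: "\<forall>z\<in>S - {\<rho>}. \<forall>i j. G z $ i $ j = (z - \<rho>) ^ pole_order \<mu> \<rho> * F z $ i $ j"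
        unfolding F_def by blast
      then show ?thesis by (intro exI[of _ S] exI[of _ "\<lambda>z. G z $ i $ j"]) auto
    next
      case False
      \<comment> \<open>Here 0 is crossed without being a root; \<open>F\<close> is holomorphic near
        it, in accordance with order 0.\<close>
      then have \<rho>0: "\<rho> = 0" "\<theta> \<le> 0" using \<rho> by (auto simp: P_def split: if_splits)
      then have "pole_order \<mu> \<rho> = 0" using False pole_0 by simp
      moreover have "open ({z. \<theta> - \<delta> < Re z} - R)"
        using \<open>finite R\<close> by (intro open_Diff open_halfspace_Re_gt finite_imp_closed)
      ultimately show ?thesis
        using False \<rho>0 \<delta>(1) F_holo
        by (intro exI[of _ "{z. \<theta> - \<delta> < Re z} - R"] exI[of _ "\<lambda>z. F z $ i $ j"]) auto
    qed
  qed
  then obtain c' where c': "\<And>i j. Q i j (c' i j)" by metis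
  \<comment> \<open>The default 0 matters for \<theta> > 0: then 0 is not in \<open>P\<close>,
    although it may be a root of positive order, and the separate term has to vanish.\<close>
  define C :: "complex \<Rightarrow> nat \<Rightarrow> complex^'p^'p" where "C \<rho> k = (\<chi> i j. if \<rho> \<in> P then c' i j \<rho> k else 0)" for \<rho> k
  have sum_eq: "(\<Sum>\<rho>\<in>P. exp (\<rho> * of_real t) * (\<Sum>k<pole_order \<mu> \<rho> + (if \<rho> = 0 then 1 else 0). of_real t ^ k * c' i j \<rho> k)) =
      (\<Sum>\<rho>\<in>R. exp (\<rho> * of_real t) * (\<Sum>k<pole_order \<mu> \<rho>. of_real t ^ k * C \<rho> k $ i $ j))
      + of_real t ^ pole_order \<mu> 0 * C 0 (pole_order \<mu> 0) $ i $ j" for t :: real and i j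
  proof -
    define g where "g \<rho> = exp (\<rho> * of_real t) * (\<Sum>k<pole_order \<mu> \<rho>. of_real t ^ k * C \<rho> k $ i $ j)" for \<rho>
    \<comment> \<open>The index k(0) lies just beyond the range k < k(0) of the sum at the root 0,
      so the separate term takes exactly the additional coefficient.\<close>
    define g0 where "g0 \<rho> = (if \<rho> = 0 then of_real t ^ pole_order \<mu> 0 * C 0 (pole_order \<mu> 0) $ i $ j else 0)" for \<rho> :: complex
    have "finite P" using \<open>finite R\<close> by (simp add: P_def)
    have "(\<Sum>\<rho>\<in>P. exp (\<rho> * of_real t) * (\<Sum>k<pole_order \<mu> \<rho> + (if \<rho> = 0 then 1 else 0). of_real t ^ k * c' i j \<rho> k))
        = (\<Sum>\<rho>\<in>P. g \<rho> + g0 \<rho>)"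
      by (rule sum.cong[OF refl]) (auto simp: g_def g0_def C_def)
    also have "\<dots> = (\<Sum>\<rho>\<in>P. g \<rho>) + (\<Sum>\<rho>\<in>P. g0 \<rho>)" by (rule sum.distrib)
    also have "(\<Sum>\<rho>\<in>P. g \<rho>) = (\<Sum>\<rho>\<in>R. g \<rho>)"
    proof (rule sum.mono_neutral_right[OF \<open>finite P\<close>])
      show "\<forall>\<rho>\<in>P - R. g \<rho> = 0"
        using pole_0 by (auto simp: P_def g_def split: if_splits)
    qed (auto simp: P_def)
    also have "(\<Sum>\<rho>\<in>P. g0 \<rho>) = of_real t ^ pole_order \<mu> 0 * C 0 (pole_order \<mu> 0) $ i $ j"
      using \<open>finite P\<close> by (simp add: g0_def C_def)
    finally show ?thesis by (simp add: g_def)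
  qed
  \<comment> \<open>The estimate obtained has \<theta>' < \<theta> in the exponent and is weakened
    to \<theta>.\<close>
  have "(\<lambda>t. complex_of_real (t * exp (\<theta>' * t))) \<in> O[at_top](\<lambda>t. complex_of_real (t * exp (\<theta> * t)))"
  proof (rule bigoI[of _ 1], rule eventually_mono[OF eventually_ge_at_top[of 0]])
    fix t :: real assume "0 \<le> t"
    then show "norm (complex_of_real (t * exp (\<theta>' * t))) \<le> 1 * norm (complex_of_real (t * exp (\<theta> * t)))"
      using \<theta>'(2) by (simp add: norm_mult mult_left_mono mult_right_mono)
  qed
  from landau_o.big_trans[OF c'[unfolded Q_def] this] show ?thesis
    by (intro exI[of _ C]) (simp add: sum_eq renewal_fun_def R_def)
qed

end
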